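(* Let $d\ge 1$, $2<p<\infty$ and $1\leqslant q<\infty$, and let $q'$ be the dual exponent ($\frac1q+\frac1{q'}=1$, so $q'=\infty$ if $q=1$). Let $S\subset\mathbb{R}^d$ be a compact set which is $\sigma$-finite with respect to $\mathcal{H}_{\frac{2d}{p},\frac{q'}{2}}$, i.e. $S$ is a countable union of sets $S_i$ with $\mathcal{H}_{\frac{2d}{p},\frac{q'}{2}}(S_i)<\infty$. Let $\zeta$ be a tempered distribution on $\mathbb{R}^d$ such that $\hat{\zeta}\in L_{p,q}(\mathbb{R}^d)$ and $\operatorname{supp}\zeta\subset S$. Then $\zeta=0$.
   Context: Lorentz spaces: for a measure space $(X,\mu)$ and $p,q\in(0,\infty)$, $\|f\|^q_{L_{p,q}}=q\int_0^\infty (m_f(t)t^p)^{q/p}\frac{dt}{t}$, where $m_f(t)=\mu(\{x: |f(x)|\geqslant t\})$; $L_{p,q}(\mathbb{R}^d)$ is taken with Lebesgue measure. Netrusov--Hausdorff capacity: let $\Delta_k=[2^{-k-1},2^{-k})$ for $k\in\mathbb{Z}$. For $F\subset\mathbb{R}^d$, $\alpha>0$, $\delta>0$ and $0<\beta<\infty$ set $\mathcal{H}_{\alpha,\beta}(F,\delta)=\inf\big\{\sum_{k}\big(\sum_{j:\,\operatorname{diam}B_j\in\Delta_k}(\operatorname{diam}B_j)^\alpha\big)^\beta : F\subset\bigcup_j B_j,\ \operatorname{diam}B_j<\delta\big\}$ (infimum over countable covers by sets $B_j$), and for $\beta=\infty$ replace $\sum_k(\cdot)^\beta$ by $\sup_k(\cdot)$.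 Then $\mathcal{H}_{\alpha,\beta}(F)=\lim_{\delta\to0}\mathcal{H}_{\alpha,\beta}(F,\delta)$. *)

theory Defs
  imports "HOL-Analysis.Analysis"
begin

definition epow :: "ennreal \<Rightarrow> real \<Rightarrow> ennreal" where
  "epow x b = (if x = top then top else ennreal (enn2real x powr b))"

definition distrib_fun :: "'a measure \<Rightarrow> ('a \<Rightarrow> complex) \<Rightarrow> real \<Rightarrow> ennreal" where
  "distrib_fun M f t = emeasure M {x \<in> space M. cmod (f x) \<ge> t}"

definition lorentz_qnorm_pow :: "real \<Rightarrow> real \<Rightarrow> 'a measure \<Rightarrow> ('a \<Rightarrow> complex) \<Rightarrow> ennreal" where
  "lorentz_qnorm_pow p q M f =
     ennreal q * (\<integral>\<^sup>+ t. indicator {0<..} t *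
        epow (distrib_fun M f t * ennreal (t powr p)) (q / p) * ennreal (1 / t) \<partial>lborel)"

definition in_lorentz :: "real \<Rightarrow> real \<Rightarrow> 'a measure \<Rightarrow> ('a \<Rightarrow> complex) \<Rightarrow> bool" where
  "in_lorentz p q M f \<longleftrightarrow> f \<in> borel_measurable M \<and> lorentz_qnorm_pow p q M f < top"

definition dyadic_band :: "int \<Rightarrow> real set" where
  "dyadic_band k = {2 powr (- real_of_int k - 1) ..< 2 powr (- real_of_int k)}"

definition nnsum :: "('i \<Rightarrow> ennreal) \<Rightarrow> ennreal" where
  "nnsum f = (SUP K \<in> {K. finite K}. sum f K)"

definition cover_cost :: "real \<Rightarrow> ereal \<Rightarrow> (nat \<Rightarrow> 'a::metric_space set) \<Rightarrow> ennreal" where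
  "cover_cost \<alpha> \<beta> B =
     (let inner = (\<lambda>k::int. nnsum (\<lambda>j::nat.
                     if diameter (B j) \<in> dyadic_band k then ennreal (diameter (B j) powr \<alpha>) else 0))
      in if \<beta> = \<infinity> then (SUP k. inner k)
         else nnsum (\<lambda>k. epow (inner k) (real_of_ereal \<beta>)))"

definition NH_cap_delta :: "real \<Rightarrow> ereal \<Rightarrow> 'a::metric_space set \<Rightarrow> real \<Rightarrow> ennreal" where
  "NH_cap_delta \<alpha> \<beta> F \<delta> =
     (INF B \<in> {B :: nat \<Rightarrow> 'a set. F \<subseteq> (\<Union>j. B j) \<and> (\<forall>j. bounded (B j) \<and> diameter (B j) < \<delta>)}.
        cover_cost \<alpha> \<beta> B)"

text \<open>H_{alpha,beta}(F) = lim_{delta -> 0} H_{alpha,beta}(F,delta); the function is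
  nonincreasing in delta, so the limit is the supremum over delta > 0.\<close>
definition NH_cap :: "real \<Rightarrow> ereal \<Rightarrow> 'a::metric_space set \<Rightarrow> ennreal" where
  "NH_cap \<alpha> \<beta> F = (SUP \<delta> \<in> {0<..}. NH_cap_delta \<alpha> \<beta> F \<delta>)"

definition sigma_finite_NH :: "real \<Rightarrow> ereal \<Rightarrow> 'a::metric_space set \<Rightarrow> bool" where
  "sigma_finite_NH \<alpha> \<beta> S \<longleftrightarrow> (\<exists>Si :: nat \<Rightarrow> 'a set. S = (\<Union>i. Si i) \<and> (\<forall>i. NH_cap \<alpha> \<beta> (Si i) < top))"

definition dual_exp :: "real \<Rightarrow> ereal" where
  "dual_exp q = (if q = 1 then \<infinity> else ereal (q / (q - 1)))"

fun dir_derivs :: "'a::real_normed_vector list \<Rightarrow> ('a \<Rightarrow> complex) \<Rightarrow> ('a \<Rightarrow> complex)" where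
  "dir_derivs [] f = f"
| "dir_derivs (v # vs) f = (\<lambda>x. vector_derivative (\<lambda>t::real. dir_derivs vs f (x + t *\<^sub>R v)) (at 0))"

definition smooth_fun :: "('a::real_normed_vector \<Rightarrow> complex) \<Rightarrow> bool" where
  "smooth_fun f \<longleftrightarrow> (\<forall>vs x. dir_derivs vs f differentiable (at x))"

definition tsupport :: "('a::topological_space \<Rightarrow> complex) \<Rightarrow> 'a set" where
  "tsupport f = closure {x. f x \<noteq> 0}"

definition test_fun_off :: "'a::euclidean_space set \<Rightarrow> ('a \<Rightarrow> complex) \<Rightarrow> bool" where
  "test_fun_off S \<phi> \<longleftrightarrow> smooth_fun \<phi> \<and> compact (tsupport \<phi>) \<and> tsupport \<phi> \<inter> S = {}"

definition inv_fourier :: "('a::euclidean_space \<Rightarrow> complex) \<Rightarrow> 'a \<Rightarrow> complex" where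
  "inv_fourier \<phi> \<xi> = (\<integral>x. \<phi> x * cis (x \<bullet> \<xi>) \<partial>lebesgue)"

text \<open>The tempered distribution zeta with Fourier transform g (a function in L_{p,q}) has
  support in S: <zeta, phi> = <g, F^{-1} phi> vanishes for every test function phi supported off S.\<close>
definition ft_distrib_supported_in :: "('a::euclidean_space \<Rightarrow> complex) \<Rightarrow> 'a set \<Rightarrow> bool" where
  "ft_distrib_supported_in g S \<longleftrightarrow>
     (\<forall>\<phi>. test_fun_off S \<phi> \<longrightarrow> (\<integral>\<xi>. g \<xi> * inv_fourier \<phi> \<xi> \<partial>lebesgue) = 0)"

end

theory Submission
  imports Defs "HOL-Probability.Characteristic_Functions" "HOL-Probability.Sinc_Integral"
begin

text \<open>
  Cover $S$ by finitely many balls, the $i$-th piece of $S$ being covered at scales fine enough for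
  it, and split a test function \<open>\<psi>\<close> into a part vanishing near $S$ and layers supported on the dyadic
  cubes of side comparable to $2^{-k}$ meeting the balls of that scale. The cutoff for scale $k$ is
  multiplied by the complements of all coarser cutoffs; their derivatives, measured at scale $k$,
  form a geometric series, so the layers satisfy uniform bounds. The pairing of $g$ with the Fourier
  transform of layer $k$ is estimated by cutting $g$ at a height $\lambda_k$: above it by the
  Plancherel inequality, below it by the decay of the transform. If $a_k$ is the number of cubes times
  $2^{-2dk/p}$, the result is at most a constant times $w_k \sqrt{a_k}$, and choosing $\lambda_k$ as
  the height above which $g$ lives on a set of measure $2^{dk}$ makes the $q$-th powers of $w_k$
  summable because $g$ lies in the Lorentz space. By duality with the capacity, the sum over $k$ is
  small once all scales are fine. Hence $g$ annihilates the Fourier transform of every test function,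
  and averaging $g$ against dilated bumps gives $g = 0$.
\<close>

section \<open>Smooth functions\<close>

definition dir_deriv :: "'a::real_normed_vector \<Rightarrow> ('a \<Rightarrow> complex) \<Rightarrow> 'a \<Rightarrow> complex" where
  "dir_deriv v f x = vector_derivative (\<lambda>t::real. f (x + t *\<^sub>R v)) (at 0)"

lemma dir_derivs_snoc: "dir_derivs (vs @ [v]) f = dir_derivs vs (dir_deriv v f)"
  by (induction vs) (auto simp: dir_deriv_def[abs_def])

lemma smooth_fun_coinduct:
  assumes "P f"
    and "\<And>f x. P f \<Longrightarrow> f differentiable (at x)"
    and "\<And>f v. P f \<Longrightarrow> P (dir_deriv v f)"
  shows "smooth_fun f"
proof -
  have "\<forall>f. P f \<longrightarrow> (\<forall>x. dir_derivs vs f differentiable (at x))" for vs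
    using assms(2,3) by (induction vs rule: rev_induct) (simp_all add: dir_derivs_snoc)
  then show ?thesis using assms(1) unfolding smooth_fun_def by blast
qed

lemma smooth_fun_differentiable: "smooth_fun f \<Longrightarrow> f differentiable (at x)"
  unfolding smooth_fun_def by (metis dir_derivs.simps(1))

lemma smooth_fun_dir_deriv: "smooth_fun f \<Longrightarrow> smooth_fun (dir_deriv v f)"
  unfolding smooth_fun_def by (metis dir_derivs_snoc)

lemma dir_deriv_eqI:
  assumes "(f has_derivative f') (at x)"
  shows "dir_deriv v f x = f' v"
proof -
  have "((\<lambda>t::real. f (x + t *\<^sub>R v)) has_derivative (\<lambda>t. f' (t *\<^sub>R v))) (at 0)"
    by (rule has_derivative_compose[where f="\<lambda>t::real. x + t *\<^sub>R v" and g=f])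
       (use assms in \<open>auto intro!: derivative_eq_intros\<close>)
  moreover have "f' (t *\<^sub>R v) = t *\<^sub>R f' v" for t
    using assms by (simp add: has_derivative_linear linear_cmul)
  ultimately have "((\<lambda>t::real. f (x + t *\<^sub>R v)) has_vector_derivative f' v) (at 0)"
    by (simp add: has_vector_derivative_def)
  then show ?thesis unfolding dir_deriv_def by (rule vector_derivative_at)
qed

lemma has_derivative_dir_deriv:
  assumes "f differentiable (at x)"
  shows "(f has_derivative (\<lambda>v. dir_deriv v f x)) (at x)"
proof -
  obtain f' where f': "(f has_derivative f') (at x)"
    using assms by (auto simp: differentiable_def)
  then have "f' = (\<lambda>v. dir_deriv v f x)" by (auto simp: dir_deriv_eqI)
  then show ?thesis using f' by simp
qed

lemma smooth_fun_has_derivative: "smooth_fun f \<Longrightarrow> (f has_derivative (\<lambda>v. dir_deriv v f x)) (at x)"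
  by (intro has_derivative_dir_deriv smooth_fun_differentiable)

lemma dir_deriv_scaleR: "smooth_fun f \<Longrightarrow> dir_deriv (s *\<^sub>R v) f x = s *\<^sub>R dir_deriv v f x"
  using linear_cmul[OF has_derivative_linear[OF smooth_fun_has_derivative]] by blast

lemma smooth_fun_continuous_on: "smooth_fun f \<Longrightarrow> continuous_on A f"
  by (meson continuous_at_imp_continuous_on differentiable_imp_continuous_within smooth_fun_differentiable)

lemma smooth_fun_borel [measurable (raw)]:
  fixes f :: "'a::real_normed_vector \<Rightarrow> complex"
  shows "smooth_fun f \<Longrightarrow> f \<in> borel_measurable borel"
  by (intro borel_measurable_continuous_onI smooth_fun_continuous_on)

inductive smooth_closure ::
  "(('a::real_normed_vector \<Rightarrow> complex) \<Rightarrow> bool) \<Rightarrow> ('a \<Rightarrow> complex) \<Rightarrow> bool" for P where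
  base: "P f \<Longrightarrow> smooth_closure P f"
| const: "smooth_closure P (\<lambda>_. c)"
| add: "smooth_closure P f \<Longrightarrow> smooth_closure P g \<Longrightarrow> smooth_closure P (\<lambda>x. f x + g x)"
| mult: "smooth_closure P f \<Longrightarrow> smooth_closure P g \<Longrightarrow> smooth_closure P (\<lambda>x. f x * g x)"
| inverse: "smooth_closure P f \<Longrightarrow> (\<And>x. f x \<noteq> 0) \<Longrightarrow> smooth_closure P (\<lambda>x. inverse (f x))"

lemma smooth_closure_step:
  assumes "\<And>f x. P f \<Longrightarrow> f differentiable (at x)"
    and "\<And>f v. P f \<Longrightarrow> smooth_closure P (dir_deriv v f)"
  shows "smooth_closure P f \<Longrightarrow> (\<forall>x. f differentiable (at x)) \<and> (\<forall>v. smooth_closure P (dir_deriv v f))"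
proof (induction rule: smooth_closure.induct)
  case (base f)
  then show ?case using assms by blast
next
  case (const c)
  have "dir_deriv v (\<lambda>_. c) = (\<lambda>_. 0)" for v :: 'a by (auto intro!: ext dir_deriv_eqI)
  then show ?case by (auto intro: smooth_closure.const)
next
  case (add f g)
  have "dir_deriv v (\<lambda>x. f x + g x) = (\<lambda>x. dir_deriv v f x + dir_deriv v g x)" for v
    using add by (auto intro!: ext dir_deriv_eqI derivative_eq_intros has_derivative_dir_deriv)
  then show ?case using add by (auto intro: smooth_closure.add)
next
  case (mult f g)
  have "dir_deriv v (\<lambda>x. f x * g x) = (\<lambda>x. f x * dir_deriv v g x + dir_deriv v f x * g x)" for v
    using mult by (auto intro!: ext dir_deriv_eqI derivative_eq_intros has_derivative_dir_deriv)
  then show ?case using mult by (auto intro!: smooth_closure.add smooth_closure.mult)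
next
  case (inverse f)
  have deriv: "((\<lambda>x. inverse (f x)) has_derivative
      (\<lambda>v. - (inverse (f x) * dir_deriv v f x * inverse (f x)))) (at x)" for x
    by (rule Deriv.has_derivative_inverse) (use inverse in \<open>auto intro: has_derivative_dir_deriv\<close>)
  have "dir_deriv v (\<lambda>x. inverse (f x))
      = (\<lambda>x. (-1) * (inverse (f x) * (dir_deriv v f x * inverse (f x))))" for v
    by (rule ext, subst dir_deriv_eqI[OF deriv]) auto
  moreover have "smooth_closure P (\<lambda>x. (-1) * (inverse (f x) * (dir_deriv v f x * inverse (f x))))"
    for v
    using inverse by (intro smooth_closure.const smooth_closure.mult smooth_closure.inverse) auto
  ultimately show ?case using deriv by (metis differentiable_def)
qed

lemma smooth_fun_coinduct_closure:
  assumes "smooth_closure P f"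
    and "\<And>f x. P f \<Longrightarrow> f differentiable (at x)"
    and "\<And>f v. P f \<Longrightarrow> smooth_closure P (dir_deriv v f)"
  shows "smooth_fun f"
  using assms(1) by (rule smooth_fun_coinduct) (use smooth_closure_step[OF assms(2,3)] in blast)+

lemma smooth_closure_smooth_fun: "smooth_closure smooth_fun f \<Longrightarrow> smooth_fun f"
  by (rule smooth_fun_coinduct_closure[where P=smooth_fun])
     (auto intro: smooth_closure.base smooth_fun_dir_deriv smooth_fun_differentiable)

lemma smooth_fun_const [simp]: "smooth_fun (\<lambda>_. c)"
  by (rule smooth_closure_smooth_fun, rule smooth_closure.const)

lemma smooth_fun_add: "smooth_fun f \<Longrightarrow> smooth_fun g \<Longrightarrow> smooth_fun (\<lambda>x. f x + g x)"
  by (rule smooth_closure_smooth_fun, rule smooth_closure.add) (auto intro: smooth_closure.base)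

lemma smooth_fun_mult: "smooth_fun f \<Longrightarrow> smooth_fun g \<Longrightarrow> smooth_fun (\<lambda>x. f x * g x)"
  by (rule smooth_closure_smooth_fun, rule smooth_closure.mult) (auto intro: smooth_closure.base)

lemma smooth_fun_inverse: "smooth_fun f \<Longrightarrow> (\<And>x. f x \<noteq> 0) \<Longrightarrow> smooth_fun (\<lambda>x. inverse (f x))"
  by (rule smooth_closure_smooth_fun, rule smooth_closure.inverse) (auto intro: smooth_closure.base)

lemma smooth_fun_uminus: "smooth_fun f \<Longrightarrow> smooth_fun (\<lambda>x. - f x)"
  using smooth_fun_mult[of "\<lambda>_. -1" f] by simp

lemma smooth_fun_diff: "smooth_fun f \<Longrightarrow> smooth_fun g \<Longrightarrow> smooth_fun (\<lambda>x. f x - g x)"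
  using smooth_fun_add[of f "\<lambda>x. - g x"] smooth_fun_uminus[of g] by simp

lemma smooth_fun_sum:
  assumes "\<And>i. i \<in> I \<Longrightarrow> smooth_fun (f i)"
  shows "smooth_fun (\<lambda>x. \<Sum>i\<in>I. f i x)"
  using assms by (induction I rule: infinite_finite_induct) (auto intro: smooth_fun_add)

lemma smooth_fun_prod:
  assumes "\<And>i. i \<in> I \<Longrightarrow> smooth_fun (f i)"
  shows "smooth_fun (\<lambda>x. \<Prod>i\<in>I. f i x)"
  using assms by (induction I rule: infinite_finite_induct) (auto intro: smooth_fun_mult)

lemma dir_deriv_const [simp]: "dir_deriv v (\<lambda>_. c) x = 0"
  by (intro dir_deriv_eqI) auto

lemma dir_deriv_add:
  "smooth_fun f \<Longrightarrow> smooth_fun g \<Longrightarrow> dir_deriv v (\<lambda>x. f x + g x) x = dir_deriv v f x + dir_deriv v g x"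
  by (auto intro!: dir_deriv_eqI derivative_eq_intros smooth_fun_has_derivative)

lemma dir_deriv_mult:
  "smooth_fun f \<Longrightarrow> smooth_fun g \<Longrightarrow>
    dir_deriv v (\<lambda>x. f x * g x) x = f x * dir_deriv v g x + dir_deriv v f x * g x"
  by (auto intro!: dir_deriv_eqI derivative_eq_intros smooth_fun_has_derivative)

lemma dir_deriv_cmult: "smooth_fun f \<Longrightarrow> dir_deriv v (\<lambda>x. c * f x) x = c * dir_deriv v f x"
  by (subst dir_deriv_mult) auto

lemma dir_deriv_zero_on:
  assumes "open U" "x \<in> U" "\<And>x. x \<in> U \<Longrightarrow> f x = 0"
  shows "dir_deriv v f x = 0"
proof (rule dir_deriv_eqI)
  have "((\<lambda>_. 0::complex) has_derivative (\<lambda>_. 0)) (at x)" by simp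
  then show "(f has_derivative (\<lambda>_. 0)) (at x)"
    by (rule has_derivative_transform_within_open[where s=U]) (use assms in auto)
qed

lemma has_derivative_affine:
  assumes "bounded_linear L" "smooth_fun h"
  shows "((\<lambda>x. h (L x + a)) has_derivative (\<lambda>v. dir_deriv (L v) h (L x + a))) (at x)"
proof (rule has_derivative_compose[where f="\<lambda>x. L x + a" and g=h])
  show "((\<lambda>x. L x + a) has_derivative L) (at x)"
    using bounded_linear_imp_has_derivative[OF assms(1)] by (auto intro!: derivative_eq_intros)
qed (rule smooth_fun_has_derivative[OF assms(2)])

lemma dir_deriv_affine:
  "bounded_linear L \<Longrightarrow> smooth_fun h \<Longrightarrow>
    dir_deriv v (\<lambda>x. h (L x + a)) x = dir_deriv (L v) h (L x + a)"
  by (rule dir_deriv_eqI[OF has_derivative_affine])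

lemma smooth_fun_affine:
  assumes L: "bounded_linear L" and "smooth_fun h"
  shows "smooth_fun (\<lambda>x. h (L x + a))"
proof (rule smooth_fun_coinduct[where P="\<lambda>f. \<exists>h. smooth_fun h \<and> f = (\<lambda>x. h (L x + a))"])
  fix f x assume "\<exists>h. smooth_fun h \<and> f = (\<lambda>x. h (L x + a))"
  then show "f differentiable (at x)"
    using has_derivative_affine[OF L] unfolding differentiable_def by blast
next
  fix f v assume "\<exists>h. smooth_fun h \<and> f = (\<lambda>x. h (L x + a))"
  then obtain h where h: "smooth_fun h" and f: "f = (\<lambda>x. h (L x + a))" by blast
  have "dir_deriv v f = (\<lambda>x. dir_deriv (L v) h (L x + a))"
    unfolding f by (rule ext) (rule dir_deriv_affine[OF L h])
  then show "\<exists>h. smooth_fun h \<and> dir_deriv v f = (\<lambda>x. h (L x + a))"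
    using smooth_fun_dir_deriv[OF h] by blast
qed (use assms(2) in blast)

lemma smooth_fun_coord: "smooth_fun h \<Longrightarrow> smooth_fun (\<lambda>x. h (r * (x \<bullet> b) - a))"
  using smooth_fun_affine[of "\<lambda>x. r * (x \<bullet> b)" h "- a"]
  by (simp add: bounded_linear_const_mult bounded_linear_inner_left)

lemma dir_deriv_coord:
  assumes "smooth_fun h"
  shows "dir_deriv v (\<lambda>x. h (r * (x \<bullet> b) - a)) x
      = of_real (r * (v \<bullet> b)) * dir_deriv 1 h (r * (x \<bullet> b) - a)"
proof -
  have "dir_deriv (r * (v \<bullet> b)) h y = of_real (r * (v \<bullet> b)) * dir_deriv 1 h y" for y
    using dir_deriv_scaleR[OF assms, of "r * (v \<bullet> b)" 1] by (simp add: scaleR_conv_of_real)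
  then show ?thesis
    using dir_deriv_affine[OF _ assms, of "\<lambda>x. r * (x \<bullet> b)" v "- a" x]
    by (simp add: bounded_linear_const_mult bounded_linear_inner_left)
qed

lemma dir_deriv_cis: "dir_deriv v cis t = of_real v * (\<i> * cis t)"
proof -
  have "(cis has_derivative (\<lambda>v. v *\<^sub>R (\<i> * cis t))) (at t)"
    by (auto intro!: derivative_eq_intros)
  then show ?thesis by (simp add: dir_deriv_eqI scaleR_conv_of_real)
qed

lemma smooth_fun_cis: "smooth_fun cis"
proof (rule smooth_fun_coinduct_closure[where P="\<lambda>f. f = cis"])
  show "f differentiable (at x)" if "f = cis" for f x
    unfolding that differentiable_def by (rule exI) (rule derivative_eq_intros | simp)+
  have deriv: "dir_deriv v cis = (\<lambda>t. of_real v * (\<i> * cis t))" for v by (rule ext) (rule dir_deriv_cis)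
  show "smooth_closure (\<lambda>f. f = cis) (dir_deriv v f)" if "f = cis" for f v
    unfolding that deriv by (intro smooth_closure.mult smooth_closure.const) (rule smooth_closure.base, rule refl)
qed (rule smooth_closure.base, rule refl)

section \<open>Test functions\<close>

definition test_fun :: "('a::euclidean_space \<Rightarrow> complex) \<Rightarrow> bool" where
  "test_fun f \<longleftrightarrow> smooth_fun f \<and> bounded {x. f x \<noteq> 0}"

lemma test_fun_smooth: "test_fun f \<Longrightarrow> smooth_fun f"
  by (simp add: test_fun_def)

lemma test_fun_continuous_on: "test_fun f \<Longrightarrow> continuous_on A f"
  by (simp add: test_fun_def smooth_fun_continuous_on)

lemma test_fun_borel: "test_fun f \<Longrightarrow> f \<in> borel_measurable borel"
  by (simp add: test_fun_def smooth_fun_borel)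

lemma compact_support_test_fun: "test_fun f \<Longrightarrow> compact (closure {x. f x \<noteq> 0})"
  by (simp add: test_fun_def compact_closure)

lemma test_fun_dir_deriv:
  assumes "test_fun f" shows "test_fun (dir_deriv v f)"
proof -
  have "dir_deriv v f x = 0" if "x \<notin> closure {x. f x \<noteq> 0}" for x
    by (rule dir_deriv_zero_on[of "- closure {x. f x \<noteq> 0}"])
       (use that closure_subset[of "{x. f x \<noteq> 0}"] in auto)
  then have "{x. dir_deriv v f x \<noteq> 0} \<subseteq> closure {x. f x \<noteq> 0}" by blast
  then show ?thesis
    using assms by (auto simp: test_fun_def smooth_fun_dir_deriv intro: bounded_subset[OF bounded_closure])
qed

lemma test_fun_mult: "test_fun f \<Longrightarrow> smooth_fun g \<Longrightarrow> test_fun (\<lambda>x. f x * g x)"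
  unfolding test_fun_def by (auto intro: smooth_fun_mult elim!: bounded_subset)

lemma test_fun_add: "test_fun f \<Longrightarrow> test_fun g \<Longrightarrow> test_fun (\<lambda>x. f x + g x)"
  unfolding test_fun_def
  by (auto intro!: smooth_fun_add intro: bounded_subset[of "{x. f x \<noteq> 0} \<union> {x. g x \<noteq> 0}"])

lemma test_fun_cmult: "test_fun f \<Longrightarrow> test_fun (\<lambda>x. c * f x)"
  using test_fun_mult[of f "\<lambda>_. c"] by (simp add: mult.commute)

lemma bounded_above_of_zero_off_compact:
  fixes F :: "'a::topological_space \<Rightarrow> real"
  assumes "compact K" "continuous_on K F" "\<And>x. x \<notin> K \<Longrightarrow> F x = 0"
  shows "\<exists>B\<ge>0. \<forall>x. F x \<le> B"
proof -
  have "compact (F ` K)" by (intro compact_continuous_image assms)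
  then obtain B where "\<forall>x\<in>K. \<bar>F x\<bar> \<le> B"
    by (auto dest!: compact_imp_bounded simp: bounded_iff)
  then have "F x \<le> max B 0" for x
    using assms(3)[of x] by (cases "x \<in> K") (fastforce simp: le_max_iff_disj)+
  then show ?thesis by (intro exI[of _ "max B 0"]) auto
qed

lemma test_fun_bounded:
  assumes "test_fun f" shows "\<exists>B\<ge>0. \<forall>x. cmod (f x) \<le> B"
proof (rule bounded_above_of_zero_off_compact[OF compact_support_test_fun[OF assms]])
  show "cmod (f x) = 0" if "x \<notin> closure {x. f x \<noteq> 0}" for x
    using that closure_subset[of "{x. f x \<noteq> 0}"] by auto
qed (intro continuous_intros test_fun_continuous_on assms)

lemma test_fun_offI:
  assumes "test_fun \<phi>" "open V" "S \<subseteq> V" "\<And>x. x \<in> V \<Longrightarrow> \<phi> x = 0"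
  shows "test_fun_off S \<phi>"
proof -
  have "closure {x. \<phi> x \<noteq> 0} \<subseteq> - V"
    using assms by (intro closure_minimal) (auto simp: closed_Compl)
  then show ?thesis
    using assms compact_support_test_fun
    by (auto simp: test_fun_off_def test_fun_smooth tsupport_def simp del: compact_closure)
qed

section \<open>A smooth partition of unity on the line\<close>

definition flat_exp :: "nat \<Rightarrow> real \<Rightarrow> complex" where
  "flat_exp n x = (if x > 0 then of_real ((1 / x) ^ n * exp (- 1 / x)) else 0)"

lemma flat_exp_divide_tendsto_0: "((\<lambda>x. flat_exp n x / of_real x) \<longlongrightarrow> 0) (at 0)"
proof -
  have "((\<lambda>y::real. y ^ Suc n / exp y) \<longlongrightarrow> 0) at_top" by (rule tendsto_power_div_exp_0)
  then have "((\<lambda>x::real. (inverse x) ^ Suc n / exp (inverse x)) \<longlongrightarrow> 0) (at_right 0)"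
    by (rule filterlim_compose) (rule filterlim_inverse_at_top_right)
  then have "((\<lambda>x::real. complex_of_real ((inverse x) ^ Suc n / exp (inverse x))) \<longlongrightarrow> of_real 0) (at_right 0)"
    by (intro tendsto_of_real)
  moreover have "\<forall>\<^sub>F x in at_right 0. complex_of_real ((inverse x) ^ Suc n / exp (inverse x))
      = flat_exp n x / of_real x"
    unfolding eventually_at_filter
    by (rule always_eventually) (auto simp: flat_exp_def exp_minus field_simps)
  ultimately have right: "((\<lambda>x. flat_exp n x / of_real x) \<longlongrightarrow> of_real 0) (at_right 0)"
    by (rule Lim_transform_eventually)
  have left: "((\<lambda>x. flat_exp n x / of_real x) \<longlongrightarrow> 0) (at_left 0)"
    by (rule tendsto_eventually) (auto simp: eventually_at_filter flat_exp_def)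
  show ?thesis using filterlim_split_at[OF left] right by simp
qed

lemma DERIV_inverse_power_mult_exp:
  fixes x :: real
  assumes "x \<noteq> 0"
  shows "((\<lambda>x. (1 / x) ^ n * exp (- 1 / x)) has_real_derivative
    (1 / x) ^ (n + 2) * exp (- 1 / x) - n * ((1 / x) ^ (n + 1) * exp (- 1 / x))) (at x)"
proof -
  have "((\<lambda>x. (1 / x) ^ n) has_real_derivative real n * ((- 1 / x^2) * (1 / x) ^ (n - 1))) (at x)"
    using assms by (auto intro!: derivative_eq_intros simp: power2_eq_square)
  moreover have "real n * ((- 1 / x^2) * (1 / x) ^ (n - 1)) = - n * (1 / x) ^ (n + 1)"
    using assms by (cases n) (auto simp: field_simps power2_eq_square)
  ultimately have power: "((\<lambda>x. (1 / x) ^ n) has_real_derivative - n * (1 / x) ^ (n + 1)) (at x)"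
    by simp
  have exp: "((\<lambda>x. exp (- 1 / x)) has_real_derivative (1 / x)^2 * exp (- 1 / x)) (at x)"
    using assms by (auto intro!: derivative_eq_intros simp: power2_eq_square)
  show ?thesis
    using DERIV_mult[OF power exp] by (simp add: algebra_simps power_add power2_eq_square)
qed

lemma flat_exp_has_vector_derivative_0: "(flat_exp n has_vector_derivative 0) (at 0)"
proof -
  have "((\<lambda>y. norm (flat_exp n y / of_real y)) \<longlongrightarrow> 0) (at 0)"
    by (rule tendsto_norm_zero[OF flat_exp_divide_tendsto_0])
  then have "((\<lambda>y. norm ((1 / \<bar>y\<bar>) *\<^sub>R (flat_exp n y - flat_exp n 0))) \<longlongrightarrow> 0) (at 0)"
    by (rule Lim_transform_eventually)
       (auto intro!: always_eventually simp: flat_exp_def norm_divide norm_mult divide_simps)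
  then have "((\<lambda>y. (1 / \<bar>y\<bar>) *\<^sub>R (flat_exp n y - flat_exp n 0)) \<longlongrightarrow> 0) (at 0)"
    by (rule tendsto_norm_zero_cancel)
  then show ?thesis
    unfolding has_vector_derivative_def has_derivative_at2 by simp
qed

lemma flat_exp_has_vector_derivative:
  "(flat_exp n has_vector_derivative (flat_exp (n + 2) x - n * flat_exp (n + 1) x)) (at x)"
proof (cases x "0::real" rule: linorder_cases)
  case less
  have "((\<lambda>_. 0::complex) has_vector_derivative 0) (at x)" by simp
  then have "(flat_exp n has_vector_derivative 0) (at x)"
    by (rule has_vector_derivative_transform_within_open[where S="{..<0}"])
       (use less in \<open>auto simp: flat_exp_def\<close>)
  then show ?thesis using less by (simp add: flat_exp_def)
next
  case equal
  then show ?thesis using flat_exp_has_vector_derivative_0[of n] by (simp add: flat_exp_def)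
next
  case greater
  have "((\<lambda>x. complex_of_real ((1 / x) ^ n * exp (- 1 / x))) has_vector_derivative
      of_real ((1 / x) ^ (n + 2) * exp (- 1 / x) - n * ((1 / x) ^ (n + 1) * exp (- 1 / x)))) (at x)"
    using greater by (intro has_vector_derivative_of_real DERIV_inverse_power_mult_exp) auto
  then have "(flat_exp n has_vector_derivative
      of_real ((1 / x) ^ (n + 2) * exp (- 1 / x) - n * ((1 / x) ^ (n + 1) * exp (- 1 / x)))) (at x)"
    by (rule has_vector_derivative_transform_within_open[where S="{0<..}"])
       (use greater in \<open>auto simp: flat_exp_def\<close>)
  then show ?thesis using greater by (simp add: flat_exp_def)
qed

lemma smooth_flat_exp: "smooth_fun (flat_exp n)"
proof (rule smooth_fun_coinduct_closure[where P="\<lambda>f. f \<in> range flat_exp"])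
  note has_derivative = flat_exp_has_vector_derivative[unfolded has_vector_derivative_def]
  show "f differentiable (at x)" if "f \<in> range flat_exp" for f x
    using that has_derivative unfolding differentiable_def by blast
  have deriv: "dir_deriv v (flat_exp m)
      = (\<lambda>x. of_real v * (flat_exp (m + 2) x + - of_nat m * flat_exp (m + 1) x))" for v m
    by (rule ext) (simp add: dir_deriv_eqI[OF has_derivative] scaleR_conv_of_real)
  show "smooth_closure (\<lambda>f. f \<in> range flat_exp) (dir_deriv v f)" if "f \<in> range flat_exp" for f v
  proof -
    obtain m where f: "f = flat_exp m" using \<open>f \<in> range flat_exp\<close> by blast
    show ?thesis
      unfolding f deriv
      by (intro smooth_closure.add smooth_closure.mult smooth_closure.const; rule smooth_closure.base, rule rangeI)
  qed
qed (auto intro: smooth_closure.base)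

definition smooth_step :: "real \<Rightarrow> complex" where
  "smooth_step x = flat_exp 0 x * inverse (flat_exp 0 x + flat_exp 0 (1 - x))"

lemma flat_exp_add_reflect_nonzero: "flat_exp 0 x + flat_exp 0 (1 - x) \<noteq> 0"
proof -
  have "0 < Re (flat_exp 0 x + flat_exp 0 (1 - x))" by (auto simp: flat_exp_def add_pos_pos)
  then show ?thesis by force
qed

lemma smooth_step_eq_0: "x \<le> 0 \<Longrightarrow> smooth_step x = 0"
  and smooth_step_eq_1: "1 \<le> x \<Longrightarrow> smooth_step x = 1"
  by (auto simp: smooth_step_def flat_exp_def)

lemma smooth_step_reflect: "smooth_step (1 - x) = 1 - smooth_step x"
  using flat_exp_add_reflect_nonzero[of x] by (simp add: smooth_step_def field_simps)

lemma smooth_step_nonneg: "smooth_step x \<in> \<real>\<^sub>\<ge>\<^sub>0"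
  unfolding smooth_step_def
  by (intro nonneg_Reals_mult_I nonneg_Reals_inverse_I nonneg_Reals_add_I) (auto simp: flat_exp_def)

lemma smooth_smooth_step: "smooth_fun smooth_step"
  unfolding smooth_step_def[abs_def]
  using smooth_fun_affine[of "\<lambda>x. - x" "flat_exp 0" 1] flat_exp_add_reflect_nonzero
  by (intro smooth_fun_mult smooth_fun_inverse smooth_fun_add smooth_flat_exp)
     (simp_all add: smooth_flat_exp bounded_linear_minus bounded_linear_ident)

definition unit_bump :: "real \<Rightarrow> complex" where
  "unit_bump x = smooth_step (x + 1) - smooth_step x"

lemma smooth_unit_bump: "smooth_fun unit_bump"
  unfolding unit_bump_def[abs_def]
  using smooth_fun_affine[OF bounded_linear_ident smooth_smooth_step]
  by (intro smooth_fun_diff smooth_smooth_step)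

lemma unit_bump_eq_0: "1 \<le> \<bar>x\<bar> \<Longrightarrow> unit_bump x = 0"
  by (auto simp: unit_bump_def abs_if smooth_step_eq_0 smooth_step_eq_1 split: if_splits)

lemma unit_bump_eq_smooth_step: "unit_bump x = smooth_step (1 - \<bar>x\<bar>)"
proof (cases "0 \<le> x")
  case True
  then show ?thesis by (simp add: unit_bump_def smooth_step_eq_1 smooth_step_reflect)
next
  case False
  then show ?thesis by (simp add: unit_bump_def smooth_step_eq_0 add.commute)
qed

lemma unit_bump_0 [simp]: "unit_bump 0 = 1"
  by (simp add: unit_bump_eq_smooth_step smooth_step_eq_1)

lemma unit_bump_nonneg: "unit_bump x \<in> \<real>\<^sub>\<ge>\<^sub>0"
  by (simp add: unit_bump_eq_smooth_step smooth_step_nonneg)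

lemma norm_unit_bump_le_1: "cmod (unit_bump x) \<le> 1"
proof -
  have "smooth_step \<bar>x\<bar> = 1 - unit_bump x"
    using smooth_step_reflect[of "\<bar>x\<bar>"] by (simp add: unit_bump_eq_smooth_step)
  then have "Re (unit_bump x) \<le> 1"
    using smooth_step_nonneg[of "\<bar>x\<bar>"] by (simp add: complex_nonneg_Reals_iff)
  then show ?thesis by (simp add: nonneg_Reals_cmod_eq_Re unit_bump_nonneg)
qed

lemma sum_unit_bump:
  assumes "finite F" "{\<lfloor>y\<rfloor>, \<lfloor>y\<rfloor> + 1} \<subseteq> F"
  shows "(\<Sum>n\<in>F. unit_bump (y - of_int n)) = 1"
proof -
  have "unit_bump (y - of_int n) = 0" if "n \<notin> {\<lfloor>y\<rfloor>, \<lfloor>y\<rfloor> + 1}" for n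
  proof (rule unit_bump_eq_0)
    have "n \<le> \<lfloor>y\<rfloor> - 1 \<or> n \<ge> \<lfloor>y\<rfloor> + 2" using that by auto
    then show "1 \<le> \<bar>y - of_int n\<bar>" by linarith
  qed
  then have "(\<Sum>n\<in>F. unit_bump (y - of_int n)) = (\<Sum>n\<in>{\<lfloor>y\<rfloor>, \<lfloor>y\<rfloor> + 1}. unit_bump (y - of_int n))"
    by (intro sum.mono_neutral_right assms) auto
  also have "\<dots> = smooth_step (y - of_int \<lfloor>y\<rfloor> + 1) - smooth_step (y - of_int \<lfloor>y\<rfloor> - 1)"
    by (simp add: unit_bump_def algebra_simps)
  also have "smooth_step (y - of_int \<lfloor>y\<rfloor> + 1) = 1" by (rule smooth_step_eq_1) linarith
  also have "smooth_step (y - of_int \<lfloor>y\<rfloor> - 1) = 0" by (rule smooth_step_eq_0) linarith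
  finally show ?thesis by simp
qed

lemma norm_sum_nonneg_Reals:
  fixes f :: "'i \<Rightarrow> complex"
  assumes "\<And>i. i \<in> I \<Longrightarrow> f i \<in> \<real>\<^sub>\<ge>\<^sub>0"
  shows "cmod (\<Sum>i\<in>I. f i) = (\<Sum>i\<in>I. cmod (f i))" and "(\<Sum>i\<in>I. f i) \<in> \<real>\<^sub>\<ge>\<^sub>0"
proof -
  show nonneg: "(\<Sum>i\<in>I. f i) \<in> \<real>\<^sub>\<ge>\<^sub>0"
    using assms by (induction I rule: infinite_finite_induct) auto
  show "cmod (\<Sum>i\<in>I. f i) = (\<Sum>i\<in>I. cmod (f i))"
    using nonneg_Reals_cmod_eq_Re[OF nonneg] assms by (simp add: nonneg_Reals_cmod_eq_Re)
qed

lemma sum_norm_unit_bump: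
  assumes "finite F" "{\<lfloor>y\<rfloor>, \<lfloor>y\<rfloor> + 1} \<subseteq> F"
  shows "(\<Sum>n\<in>F. cmod (unit_bump (y - of_int n))) = 1"
  using norm_sum_nonneg_Reals(1)[of F "\<lambda>n. unit_bump (y - of_int n)"] sum_unit_bump[OF assms]
  by (simp add: unit_bump_nonneg)

definition bump_slope :: real where
  "bump_slope = (SUP x. cmod (dir_deriv 1 unit_bump x))"

lemma norm_dir_deriv_unit_bump_le: "cmod (dir_deriv 1 unit_bump x) \<le> bump_slope"
proof -
  have "\<bar>x\<bar> \<le> 1" if "unit_bump x \<noteq> 0" for x using that unit_bump_eq_0[of x] by linarith
  then have "test_fun unit_bump"
    using smooth_unit_bump by (auto simp: test_fun_def bounded_iff)
  then obtain B where "\<forall>x. cmod (dir_deriv 1 unit_bump x) \<le> B"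
    using test_fun_bounded test_fun_dir_deriv by blast
  then have "bdd_above (range (\<lambda>x. cmod (dir_deriv 1 unit_bump x)))" by (auto intro: bdd_aboveI)
  then show ?thesis unfolding bump_slope_def by (rule cSUP_upper[rotated]) simp
qed

lemma bump_slope_nonneg: "0 \<le> bump_slope"
  using norm_dir_deriv_unit_bump_le[of 0] norm_ge_zero by (rule order_trans[rotated])

lemma sum_norm_dir_deriv_unit_bump_le:
  assumes "finite F"
  shows "(\<Sum>n\<in>F. cmod (dir_deriv 1 unit_bump (y - of_int n))) \<le> 4 * bump_slope"
proof -
  let ?G = "{\<lfloor>y\<rfloor> - 1..\<lfloor>y\<rfloor> + 2}"
  have "dir_deriv 1 unit_bump (y - of_int n) = 0" if "n \<notin> ?G" for n
  proof (rule dir_deriv_zero_on[of "{x. 1 < \<bar>x\<bar>}"])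
    have "n \<le> \<lfloor>y\<rfloor> - 2 \<or> n \<ge> \<lfloor>y\<rfloor> + 3" using that by auto
    then show "y - of_int n \<in> {x. 1 < \<bar>x\<bar>}" by simp linarith
  qed (auto simp: unit_bump_eq_0 intro!: open_Collect_less continuous_intros)
  then have "(\<Sum>n\<in>F. cmod (dir_deriv 1 unit_bump (y - of_int n)))
      = (\<Sum>n\<in>F \<inter> ?G. cmod (dir_deriv 1 unit_bump (y - of_int n)))"
    using assms by (intro sum.mono_neutral_right) auto
  also have "\<dots> \<le> (\<Sum>n\<in>?G. cmod (dir_deriv 1 unit_bump (y - of_int n)))" by (rule sum_mono2) auto
  also have "\<dots> \<le> (\<Sum>n\<in>?G. bump_slope)" by (intro sum_mono norm_dir_deriv_unit_bump_le)
  finally show ?thesis by simp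
qed

section \<open>Weighted sums of mixed derivatives\<close>

text \<open>For a list of distinct vectors, \<open>mixed_deriv_norm s bs f x\<close> is the sum of \<open>s ^ k * cmod (D f x)\<close>
  over all mixed derivatives D of order k that use each entry of the list at most once, and
  \<open>mixed_deriv_op s bs\<close> is the product of the operators \<open>1 + s * dir_deriv b\<close>.\<close>

fun mixed_deriv_norm :: "real \<Rightarrow> 'a::euclidean_space list \<Rightarrow> ('a \<Rightarrow> complex) \<Rightarrow> 'a \<Rightarrow> real" where
  "mixed_deriv_norm s [] f x = cmod (f x)"
| "mixed_deriv_norm s (b # bs) f x = mixed_deriv_norm s bs f x + s * mixed_deriv_norm s bs (dir_deriv b f) x"

fun mixed_deriv_op :: "real \<Rightarrow> 'a::euclidean_space list \<Rightarrow> ('a \<Rightarrow> complex) \<Rightarrow> 'a \<Rightarrow> complex" where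
  "mixed_deriv_op s [] f = f"
| "mixed_deriv_op s (b # bs) f = mixed_deriv_op s bs (\<lambda>x. f x + of_real s * dir_deriv b f x)"

lemma mixed_deriv_norm_nonneg: "0 \<le> s \<Longrightarrow> 0 \<le> mixed_deriv_norm s bs f x"
  by (induction bs arbitrary: f) auto

lemma mixed_deriv_norm_const: "mixed_deriv_norm s bs (\<lambda>_. c) x = cmod c"
proof (induction bs arbitrary: c)
  case (Cons b bs)
  have "dir_deriv b (\<lambda>_. c) = (\<lambda>_. 0)" by (rule ext) simp
  then show ?case using Cons[of c] Cons[of 0] by simp
qed simp

lemma mixed_deriv_norm_add_le:
  assumes "0 \<le> s" "smooth_fun f" "smooth_fun g"
  shows "mixed_deriv_norm s bs (\<lambda>x. f x + g x) x
      \<le> mixed_deriv_norm s bs f x + mixed_deriv_norm s bs g x"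
  using assms(2,3)
proof (induction bs arbitrary: f g)
  case (Cons b bs)
  have "dir_deriv b (\<lambda>x. f x + g x) = (\<lambda>x. dir_deriv b f x + dir_deriv b g x)"
    using Cons.prems by (auto simp: dir_deriv_add)
  then have "mixed_deriv_norm s bs (dir_deriv b (\<lambda>x. f x + g x)) x
      \<le> mixed_deriv_norm s bs (dir_deriv b f) x + mixed_deriv_norm s bs (dir_deriv b g) x"
    using Cons.IH[OF smooth_fun_dir_deriv smooth_fun_dir_deriv, OF Cons.prems] by simp
  from mult_left_mono[OF this assms(1)] Cons.IH[OF Cons.prems] show ?case by (simp add: algebra_simps)
qed (simp add: norm_triangle_ineq)

lemma mixed_deriv_norm_uminus:
  "smooth_fun f \<Longrightarrow> mixed_deriv_norm s bs (\<lambda>x. - f x) x = mixed_deriv_norm s bs f x"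
proof (induction bs arbitrary: f)
  case (Cons b bs)
  have "dir_deriv b (\<lambda>x. - f x) = (\<lambda>x. - dir_deriv b f x)"
    using dir_deriv_cmult[OF Cons.prems, of b "-1"] by auto
  then show ?case using Cons.IH[of f] Cons.IH[of "dir_deriv b f"] Cons.prems by (simp add: smooth_fun_dir_deriv)
qed simp

lemma mixed_deriv_norm_sum_le:
  assumes "0 \<le> s" "finite I" "\<And>i. i \<in> I \<Longrightarrow> smooth_fun (f i)"
  shows "mixed_deriv_norm s bs (\<lambda>x. \<Sum>i\<in>I. f i x) x \<le> (\<Sum>i\<in>I. mixed_deriv_norm s bs (f i) x)"
  using assms(2,3)
proof (induction I)
  case (insert i I)
  have "mixed_deriv_norm s bs (\<lambda>x. f i x + (\<Sum>i\<in>I. f i x)) x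
      \<le> mixed_deriv_norm s bs (f i) x + mixed_deriv_norm s bs (\<lambda>x. \<Sum>i\<in>I. f i x) x"
    by (intro mixed_deriv_norm_add_le assms smooth_fun_sum insert) auto
  then show ?case using insert by fastforce
qed (simp add: mixed_deriv_norm_const)

lemma mixed_deriv_norm_mult_le:
  assumes "0 \<le> s" "smooth_fun f" "smooth_fun g"
  shows "mixed_deriv_norm s bs (\<lambda>x. f x * g x) x
      \<le> mixed_deriv_norm s bs f x * mixed_deriv_norm s bs g x"
  using assms(2,3)
proof (induction bs arbitrary: f g)
  case (Cons b bs)
  let ?N = "mixed_deriv_norm s bs"
  note f = Cons.prems(1) and g = Cons.prems(2)
  note df = smooth_fun_dir_deriv[OF f, of b] and dg = smooth_fun_dir_deriv[OF g, of b]
  have "dir_deriv b (\<lambda>x. f x * g x) = (\<lambda>x. f x * dir_deriv b g x + dir_deriv b f x * g x)"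
    using f g by (auto simp: dir_deriv_mult)
  then have "?N (dir_deriv b (\<lambda>x. f x * g x)) x
      \<le> ?N (\<lambda>x. f x * dir_deriv b g x) x + ?N (\<lambda>x. dir_deriv b f x * g x) x"
    using mixed_deriv_norm_add_le[OF assms(1) smooth_fun_mult[OF f dg] smooth_fun_mult[OF df g]] by simp
  also have "\<dots> \<le> ?N f x * ?N (dir_deriv b g) x + ?N (dir_deriv b f) x * ?N g x"
    by (intro add_mono Cons.IH f g df dg)
  finally have "s * ?N (dir_deriv b (\<lambda>x. f x * g x)) x
      \<le> s * (?N f x * ?N (dir_deriv b g) x + ?N (dir_deriv b f) x * ?N g x)"
    using assms(1) by (intro mult_left_mono)
  moreover have "0 \<le> (s * ?N (dir_deriv b f) x) * (s * ?N (dir_deriv b g) x)"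
    using assms(1) by (simp add: mixed_deriv_norm_nonneg)
  ultimately show ?case using Cons.IH[OF f g] by (simp add: algebra_simps)
qed (simp add: norm_mult)

lemma mixed_deriv_norm_prod_le:
  assumes "0 \<le> s" "finite I" "\<And>i. i \<in> I \<Longrightarrow> smooth_fun (f i)"
  shows "mixed_deriv_norm s bs (\<lambda>x. \<Prod>i\<in>I. f i x) x \<le> (\<Prod>i\<in>I. mixed_deriv_norm s bs (f i) x)"
  using assms(2,3)
proof (induction I)
  case (insert i I)
  have "mixed_deriv_norm s bs (\<lambda>x. f i x * (\<Prod>i\<in>I. f i x)) x
      \<le> mixed_deriv_norm s bs (f i) x * mixed_deriv_norm s bs (\<lambda>x. \<Prod>i\<in>I. f i x) x"
    by (intro mixed_deriv_norm_mult_le assms smooth_fun_prod insert) auto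
  also have "\<dots> \<le> mixed_deriv_norm s bs (f i) x * (\<Prod>i\<in>I. mixed_deriv_norm s bs (f i) x)"
    by (intro mult_left_mono insert mixed_deriv_norm_nonneg assms) auto
  finally show ?case using insert by simp
qed (simp add: mixed_deriv_norm_const)

lemma mixed_deriv_norm_one_minus:
  assumes "smooth_fun f"
  shows "mixed_deriv_norm s bs (\<lambda>x. 1 - f x) x
      = cmod (1 - f x) + mixed_deriv_norm s bs f x - cmod (f x)"
  using assms
proof (induction bs)
  case (Cons b bs)
  have "dir_deriv b (\<lambda>x. 1 - f x) = (\<lambda>x. - dir_deriv b f x)"
    using dir_deriv_add[of "\<lambda>_. 1" "\<lambda>x. - f x" b] dir_deriv_cmult[OF Cons.prems, of b "-1"] Cons.prems
    by (auto simp: smooth_fun_uminus)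
  then show ?case using Cons by (simp add: mixed_deriv_norm_uminus smooth_fun_dir_deriv)
qed simp

lemma mixed_deriv_norm_mono: "0 \<le> s \<Longrightarrow> s \<le> t \<Longrightarrow> mixed_deriv_norm s bs f x \<le> mixed_deriv_norm t bs f x"
proof (induction bs arbitrary: f)
  case (Cons b bs)
  show ?case using Cons by (auto intro!: add_mono mult_mono mixed_deriv_norm_nonneg)
qed simp

lemma mixed_deriv_norm_zero_on:
  assumes "open U" "x \<in> U" "\<And>x. x \<in> U \<Longrightarrow> f x = 0"
  shows "mixed_deriv_norm s bs f x = 0"
  using assms(2,3)
proof (induction bs arbitrary: f x)
  case (Cons b bs)
  have "mixed_deriv_norm s bs f x = 0" using Cons by blast
  moreover have "mixed_deriv_norm s bs (dir_deriv b f) x = 0"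
    by (rule Cons.IH) (use Cons.prems dir_deriv_zero_on[OF assms(1)] in auto)
  ultimately show ?case by simp
qed simp

lemma continuous_on_mixed_deriv_norm: "smooth_fun f \<Longrightarrow> continuous_on A (mixed_deriv_norm s bs f)"
proof (induction bs arbitrary: f)
  case Nil
  have "mixed_deriv_norm s [] f = (\<lambda>x. cmod (f x))" by auto
  then show ?case using Nil by (auto intro!: continuous_intros smooth_fun_continuous_on)
next
  case (Cons b bs)
  have "mixed_deriv_norm s (b # bs) f
      = (\<lambda>x. mixed_deriv_norm s bs f x + s * mixed_deriv_norm s bs (dir_deriv b f) x)"
    by auto
  then show ?case using Cons by (auto intro!: continuous_intros simp: smooth_fun_dir_deriv)
qed

lemma mixed_deriv_norm_test_fun_bounded:
  assumes "test_fun f"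
  shows "\<exists>B\<ge>0. \<forall>x. mixed_deriv_norm s bs f x \<le> B"
proof (rule bounded_above_of_zero_off_compact[OF compact_support_test_fun[OF assms]])
  show "mixed_deriv_norm s bs f x = 0" if "x \<notin> closure {x. f x \<noteq> 0}" for x
    by (rule mixed_deriv_norm_zero_on[of "- closure {x. f x \<noteq> 0}"])
       (use that closure_subset[of "{x. f x \<noteq> 0}"] in auto)
qed (intro continuous_on_mixed_deriv_norm test_fun_smooth assms)

lemma norm_mixed_deriv_op_le:
  assumes "0 \<le> s" "smooth_fun f"
  shows "cmod (mixed_deriv_op s bs f x) \<le> mixed_deriv_norm s bs f x"
  using assms(2)
proof (induction bs arbitrary: f)
  case (Cons b bs)
  note df = smooth_fun_dir_deriv[OF Cons.prems, of b]
  have cmult: "mixed_deriv_norm s bs (\<lambda>x. of_real s * dir_deriv b f x) x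
      \<le> s * mixed_deriv_norm s bs (dir_deriv b f) x"
    using mixed_deriv_norm_mult_le[OF assms(1) smooth_fun_const df, of bs "of_real s"] assms(1)
    by (simp add: mixed_deriv_norm_const)
  have "cmod (mixed_deriv_op s (b # bs) f x)
      \<le> mixed_deriv_norm s bs (\<lambda>x. f x + of_real s * dir_deriv b f x) x"
    unfolding mixed_deriv_op.simps
    by (intro Cons.IH smooth_fun_add smooth_fun_mult Cons.prems df smooth_fun_const)
  also have "\<dots> \<le> mixed_deriv_norm s bs f x + mixed_deriv_norm s bs (\<lambda>x. of_real s * dir_deriv b f x) x"
    by (intro mixed_deriv_norm_add_le assms Cons.prems smooth_fun_mult df) auto
  finally show ?case using cmult by simp
qed simp

lemma test_fun_mixed_deriv_op: "test_fun f \<Longrightarrow> test_fun (mixed_deriv_op s bs f)"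
  by (induction bs arbitrary: f) (auto simp: test_fun_add test_fun_cmult test_fun_dir_deriv)

lemma dir_deriv_other_coord:
  assumes "smooth_fun h" "b \<in> Basis" "c \<in> Basis" "c \<noteq> b"
  shows "dir_deriv c (\<lambda>x. h (r * (x \<bullet> b) - a)) = (\<lambda>_. 0)"
  by (rule ext) (use assms in \<open>simp add: dir_deriv_coord inner_not_same_Basis\<close>)

lemma mixed_deriv_norm_other_coords:
  assumes "smooth_fun h" "b \<in> Basis" "set cs \<subseteq> Basis - {b}"
  shows "mixed_deriv_norm s cs (\<lambda>x. h (r * (x \<bullet> b) - a)) x = cmod (h (r * (x \<bullet> b) - a))"
  using assms(3) by (induction cs) (auto simp: dir_deriv_other_coord assms mixed_deriv_norm_const)

lemma mixed_deriv_norm_coord_le: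
  assumes h: "smooth_fun h" and "0 \<le> s" "0 \<le> r" and b: "b \<in> Basis" and "set bs \<subseteq> Basis" "distinct bs"
  shows "mixed_deriv_norm s bs (\<lambda>x. h (r * (x \<bullet> b) - a)) x
    \<le> cmod (h (r * (x \<bullet> b) - a)) + s * r * cmod (dir_deriv 1 h (r * (x \<bullet> b) - a))"
  using assms(5,6)
proof (induction bs)
  case (Cons c cs)
  show ?case
  proof (cases "c = b")
    case True
    then have other_coords: "set cs \<subseteq> Basis - {b}" using Cons.prems by auto
    have "dir_deriv b (\<lambda>x. h (r * (x \<bullet> b) - a)) = (\<lambda>x. of_real r * dir_deriv 1 h (r * (x \<bullet> b) - a))"
      using b by (intro ext) (simp add: dir_deriv_coord[OF h])
    moreover have smooth: "smooth_fun (\<lambda>y. of_real r * dir_deriv 1 h y)"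
      by (intro smooth_fun_mult smooth_fun_const smooth_fun_dir_deriv h)
    ultimately show ?thesis
      using True \<open>0 \<le> r\<close> mixed_deriv_norm_other_coords[OF h b other_coords]
        mixed_deriv_norm_other_coords[OF smooth b other_coords, of s r a x]
      by (simp add: norm_mult)
  next
    case False
    then show ?thesis using Cons dir_deriv_other_coord[OF h b] by (simp add: mixed_deriv_norm_const)
  qed
qed (use assms in simp)

section \<open>Cutoff functions adapted to cubes of a grid\<close>

definition grid_cube :: "real \<Rightarrow> ('a::euclidean_space \<Rightarrow> int) \<Rightarrow> 'a set" where
  "grid_cube r n = {x. \<forall>b\<in>Basis. \<bar>r * (x \<bullet> b) - of_int (n b)\<bar> \<le> 1}"

lemma grid_cube_eq_cbox:
  fixes n :: "'a::euclidean_space \<Rightarrow> int"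
  assumes "0 < r"
  shows "grid_cube r n = cbox (\<Sum>b\<in>Basis. ((of_int (n b) - 1) / r) *\<^sub>R b) (\<Sum>b\<in>Basis. ((of_int (n b) + 1) / r) *\<^sub>R b)"
proof -
  have "\<bar>r * t - m\<bar> \<le> 1 \<longleftrightarrow> (m - 1) / r \<le> t \<and> t \<le> (m + 1) / r" for t m :: real
    using assms by (auto simp: abs_le_iff field_simps)
  then show ?thesis by (auto simp: grid_cube_def mem_box)
qed

lemma emeasure_grid_cube:
  fixes n :: "'a::euclidean_space \<Rightarrow> int"
  assumes "0 < r"
  shows "emeasure lborel (grid_cube r n) = ennreal ((2 / r) ^ DIM('a))"
proof -
  have "(of_int (n b) + 1) / r - (of_int (n b) - 1) / r = 2 / r" for b
    by (simp add: diff_divide_distrib[symmetric])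
  then show ?thesis
    unfolding grid_cube_eq_cbox[OF assms]
    by (subst emeasure_lborel_cbox) (use assms in \<open>auto simp: divide_right_mono inner_diff_left\<close>)
qed

definition box_bump :: "real \<Rightarrow> ('a::euclidean_space \<Rightarrow> int) \<Rightarrow> 'a \<Rightarrow> complex" where
  "box_bump r n x = (\<Prod>b\<in>Basis. unit_bump (r * (x \<bullet> b) - of_int (n b)))"

lemma smooth_box_bump: "smooth_fun (box_bump r n)"
  unfolding box_bump_def[abs_def] by (intro smooth_fun_prod smooth_fun_coord smooth_unit_bump)

lemma box_bump_nonneg: "box_bump r n x \<in> \<real>\<^sub>\<ge>\<^sub>0"
proof -
  have "(\<Prod>b\<in>B. unit_bump (r * (x \<bullet> b) - of_int (n b))) \<in> \<real>\<^sub>\<ge>\<^sub>0" for B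
    by (induction B rule: infinite_finite_induct) (auto simp: unit_bump_nonneg)
  then show ?thesis by (simp add: box_bump_def)
qed

lemma norm_box_bump: "cmod (box_bump r n x) = (\<Prod>b\<in>Basis. cmod (unit_bump (r * (x \<bullet> b) - of_int (n b))))"
  by (simp add: box_bump_def prod_norm)

lemma norm_box_bump_le_1: "cmod (box_bump r n x) \<le> 1"
  unfolding norm_box_bump by (intro prod_le_1) (simp add: norm_unit_bump_le_1)

lemma box_bump_eq_0: "x \<notin> grid_cube r n \<Longrightarrow> box_bump r n x = 0"
  unfolding box_bump_def grid_cube_def by (rule prod_zero) (use unit_bump_eq_0 less_imp_le in \<open>auto simp: not_le\<close>)

lemma test_fun_box_bump: "0 < r \<Longrightarrow> test_fun (box_bump r n)"
  unfolding test_fun_def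
proof
  assume "0 < r"
  then have "bounded (grid_cube r n)" by (simp add: grid_cube_eq_cbox)
  then show "bounded {x. box_bump r n x \<noteq> 0}"
    by (rule bounded_subset) (use box_bump_eq_0 in blast)
qed (rule smooth_box_bump)

lemma mixed_deriv_norm_box_bump_le:
  fixes x :: "'a::euclidean_space"
  assumes "0 \<le> s" "0 \<le> r" "set bs \<subseteq> Basis" "distinct bs"
  shows "mixed_deriv_norm s bs (box_bump r n) x
    \<le> (\<Prod>b\<in>Basis. cmod (unit_bump (r * (x \<bullet> b) - of_int (n b)))
          + s * r * cmod (dir_deriv 1 unit_bump (r * (x \<bullet> b) - of_int (n b))))"
proof -
  have "mixed_deriv_norm s bs (box_bump r n) x
      \<le> (\<Prod>b\<in>Basis. mixed_deriv_norm s bs (\<lambda>x. unit_bump (r * (x \<bullet> b) - of_int (n b))) x)"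
    unfolding box_bump_def[abs_def]
    by (intro mixed_deriv_norm_prod_le assms smooth_fun_coord smooth_unit_bump) auto
  also have "\<dots> \<le> (\<Prod>b\<in>Basis. cmod (unit_bump (r * (x \<bullet> b) - of_int (n b)))
          + s * r * cmod (dir_deriv 1 unit_bump (r * (x \<bullet> b) - of_int (n b))))"
    using assms
    by (intro prod_mono conjI mixed_deriv_norm_nonneg mixed_deriv_norm_coord_le smooth_unit_bump) auto
  finally show ?thesis .
qed

definition grid_indices :: "('a::euclidean_space \<Rightarrow> int) set \<Rightarrow> bool" where
  "grid_indices Q \<longleftrightarrow> finite Q \<and> Q \<subseteq> extensional Basis"

definition cube_cutoff :: "real \<Rightarrow> ('a::euclidean_space \<Rightarrow> int) set \<Rightarrow> 'a \<Rightarrow> complex" where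
  "cube_cutoff r Q x = (\<Sum>n\<in>Q. box_bump r n x)"

lemma smooth_cube_cutoff: "smooth_fun (cube_cutoff r Q)"
  unfolding cube_cutoff_def[abs_def] by (intro smooth_fun_sum smooth_box_bump)

lemma cube_cutoff_nonneg: "cube_cutoff r Q x \<in> \<real>\<^sub>\<ge>\<^sub>0"
  unfolding cube_cutoff_def by (intro norm_sum_nonneg_Reals box_bump_nonneg)

lemma norm_cube_cutoff: "cmod (cube_cutoff r Q x) = (\<Sum>n\<in>Q. cmod (box_bump r n x))"
  unfolding cube_cutoff_def by (intro norm_sum_nonneg_Reals box_bump_nonneg)

lemma cube_cutoff_eq_0: "x \<notin> (\<Union>n\<in>Q. grid_cube r n) \<Longrightarrow> cube_cutoff r Q x = 0"
  by (auto simp: cube_cutoff_def intro!: sum.neutral box_bump_eq_0)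

lemma sum_box_bump_PiE:
  fixes x :: "'a::euclidean_space"
  assumes "\<And>b. b \<in> Basis \<Longrightarrow> finite (F b)"
    and "\<And>b. b \<in> Basis \<Longrightarrow> {\<lfloor>r * (x \<bullet> b)\<rfloor>, \<lfloor>r * (x \<bullet> b)\<rfloor> + 1} \<subseteq> F b"
  shows "(\<Sum>n\<in>PiE Basis F. box_bump r n x) = 1"
proof -
  have "(\<Sum>n\<in>PiE Basis F. box_bump r n x) = (\<Prod>b\<in>Basis. \<Sum>n\<in>F b. unit_bump (r * (x \<bullet> b) - of_int n))"
    unfolding box_bump_def by (subst prod_sum_PiE) (use assms(1) in auto)
  also have "\<dots> = 1" by (intro prod.neutral ballI sum_unit_bump assms)
  finally show ?thesis .
qed

lemma grid_indices_subset_PiE: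
  fixes x :: "'a::euclidean_space"
  assumes "grid_indices Q"
  obtains F where "\<And>b. b \<in> Basis \<Longrightarrow> finite (F b)"
    "\<And>b. b \<in> Basis \<Longrightarrow> {\<lfloor>r * (x \<bullet> b)\<rfloor>, \<lfloor>r * (x \<bullet> b)\<rfloor> + 1} \<subseteq> F b" "Q \<subseteq> PiE Basis F"
proof
  define F where "F b = {\<lfloor>r * (x \<bullet> b)\<rfloor>, \<lfloor>r * (x \<bullet> b)\<rfloor> + 1} \<union> (\<lambda>n. n b) ` Q" for b
  show "finite (F b)" "{\<lfloor>r * (x \<bullet> b)\<rfloor>, \<lfloor>r * (x \<bullet> b)\<rfloor> + 1} \<subseteq> F b" for b
    using assms by (auto simp: F_def grid_indices_def)
  show "Q \<subseteq> PiE Basis F" using assms by (auto simp: F_def PiE_iff subset_iff grid_indices_def)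
qed

lemma cube_cutoff_eq_1:
  assumes "grid_indices Q" "\<And>n. n \<in> extensional Basis \<Longrightarrow> x \<in> grid_cube r n \<Longrightarrow> n \<in> Q"
  shows "cube_cutoff r Q x = 1"
proof -
  obtain F where F: "\<And>b. b \<in> Basis \<Longrightarrow> finite (F b)"
    "\<And>b. b \<in> Basis \<Longrightarrow> {\<lfloor>r * (x \<bullet> b)\<rfloor>, \<lfloor>r * (x \<bullet> b)\<rfloor> + 1} \<subseteq> F b" "Q \<subseteq> PiE Basis F"
    using grid_indices_subset_PiE[OF assms(1)] by blast
  have "cube_cutoff r Q x = (\<Sum>n\<in>PiE Basis F. box_bump r n x)"
    unfolding cube_cutoff_def
  proof (intro sum.mono_neutral_left F(3) ballI)
    show "finite (PiE Basis F)" using F(1) by (auto intro: finite_PiE)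
    show "box_bump r n x = 0" if "n \<in> PiE Basis F - Q" for n
      using that assms(2)[of n] by (intro box_bump_eq_0) (auto simp: PiE_iff)
  qed
  then show ?thesis using sum_box_bump_PiE[OF F(1,2)] by simp
qed

lemma norm_cube_cutoff_le_1:
  assumes "grid_indices Q"
  shows "cmod (cube_cutoff r Q x) \<le> 1"
proof -
  obtain F where F: "\<And>b. b \<in> Basis \<Longrightarrow> finite (F b)"
    "\<And>b. b \<in> Basis \<Longrightarrow> {\<lfloor>r * (x \<bullet> b)\<rfloor>, \<lfloor>r * (x \<bullet> b)\<rfloor> + 1} \<subseteq> F b" "Q \<subseteq> PiE Basis F"
    using grid_indices_subset_PiE[OF assms] by blast
  have "cmod (cube_cutoff r Q x) \<le> cmod (cube_cutoff r (PiE Basis F) x)"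
    unfolding norm_cube_cutoff using F by (intro sum_mono2 finite_PiE) auto
  also have "\<dots> = 1" by (simp add: cube_cutoff_def sum_box_bump_PiE[OF F(1,2)])
  finally show ?thesis .
qed

lemma sum_prod_diff_le_prod_sum_diff:
  fixes f g :: "'a \<Rightarrow> 'b \<Rightarrow> real"
  assumes "finite A" "\<And>a. a \<in> A \<Longrightarrow> finite (F a)" "Q \<subseteq> PiE A F"
    and "\<And>a i. 0 \<le> f a i" "\<And>a i. f a i \<le> g a i"
  shows "(\<Sum>n\<in>Q. \<Prod>a\<in>A. g a (n a)) - (\<Sum>n\<in>Q. \<Prod>a\<in>A. f a (n a))
     \<le> (\<Prod>a\<in>A. \<Sum>i\<in>F a. g a i) - (\<Prod>a\<in>A. \<Sum>i\<in>F a. f a i)"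
proof -
  have "(\<Sum>n\<in>Q. (\<Prod>a\<in>A. g a (n a)) - (\<Prod>a\<in>A. f a (n a)))
     \<le> (\<Sum>n\<in>PiE A F. (\<Prod>a\<in>A. g a (n a)) - (\<Prod>a\<in>A. f a (n a)))"
    by (rule sum_mono2) (use assms in \<open>auto intro!: finite_PiE prod_mono\<close>)
  then show ?thesis
    using assms(1,2) by (simp add: sum_subtractf prod_sum_PiE)
qed

lemma mixed_deriv_norm_cube_cutoff_excess_le:
  fixes x :: "'a::euclidean_space"
  assumes s: "0 \<le> s" and r: "0 \<le> r" and Q: "grid_indices Q" and bs: "set bs \<subseteq> Basis" "distinct bs"
  shows "mixed_deriv_norm s bs (cube_cutoff r Q) x - cmod (cube_cutoff r Q x)
    \<le> (1 + s * r * (4 * bump_slope)) ^ DIM('a) - 1"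
proof -
  define f where "f b i = cmod (unit_bump (r * (x \<bullet> b) - of_int i))" for b i
  define g where "g b i = f b i + s * r * cmod (dir_deriv 1 unit_bump (r * (x \<bullet> b) - of_int i))" for b i
  have factors: "0 \<le> f b i" "f b i \<le> g b i" for b i using s r by (auto simp: f_def g_def)
  obtain F where F: "\<And>b. b \<in> Basis \<Longrightarrow> finite (F b)"
    "\<And>b. b \<in> Basis \<Longrightarrow> {\<lfloor>r * (x \<bullet> b)\<rfloor>, \<lfloor>r * (x \<bullet> b)\<rfloor> + 1} \<subseteq> F b" "Q \<subseteq> PiE Basis F"
    using grid_indices_subset_PiE[OF Q] by blast
  have sum_f: "(\<Sum>i\<in>F b. f b i) = 1" if "b \<in> Basis" for b
    unfolding f_def using F that by (intro sum_norm_unit_bump)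
  have sum_g: "(\<Sum>i\<in>F b. g b i) \<le> 1 + s * r * (4 * bump_slope)" if "b \<in> Basis" for b
    unfolding g_def sum.distrib sum_f[OF that] sum_distrib_left[symmetric]
    using s r F that by (intro add_left_mono mult_left_mono sum_norm_dir_deriv_unit_bump_le) auto
  have "mixed_deriv_norm s bs (cube_cutoff r Q) x \<le> (\<Sum>n\<in>Q. mixed_deriv_norm s bs (box_bump r n) x)"
    unfolding cube_cutoff_def[abs_def]
    using Q by (intro mixed_deriv_norm_sum_le s smooth_box_bump) (auto simp: grid_indices_def)
  also have "\<dots> \<le> (\<Sum>n\<in>Q. \<Prod>b\<in>Basis. g b (n b))"
    unfolding g_def f_def by (intro sum_mono mixed_deriv_norm_box_bump_le s r bs)
  finally have "mixed_deriv_norm s bs (cube_cutoff r Q) x - cmod (cube_cutoff r Q x)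
      \<le> (\<Sum>n\<in>Q. \<Prod>b\<in>Basis. g b (n b)) - (\<Sum>n\<in>Q. \<Prod>b\<in>Basis. f b (n b))"
    by (simp add: norm_cube_cutoff norm_box_bump f_def)
  also have "\<dots> \<le> (\<Prod>b\<in>Basis. \<Sum>i\<in>F b. g b i) - (\<Prod>b\<in>Basis. \<Sum>i\<in>F b. f b i)"
    by (intro sum_prod_diff_le_prod_sum_diff F factors) auto
  also have "\<dots> \<le> (\<Prod>b\<in>(Basis::'a set). 1 + s * r * (4 * bump_slope)) - 1"
    using order_trans[OF factors] sum_g by (intro diff_mono prod_mono) (auto simp: sum_f intro!: sum_nonneg)
  finally show ?thesis by simp
qed

lemma mixed_deriv_norm_cube_cutoff_le:
  fixes x :: "'a::euclidean_space"
  assumes "0 \<le> s" "0 \<le> r" "grid_indices Q" "set bs \<subseteq> Basis" "distinct bs"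
  shows "mixed_deriv_norm s bs (cube_cutoff r Q) x \<le> (1 + s * r * (4 * bump_slope)) ^ DIM('a)"
    and "mixed_deriv_norm s bs (\<lambda>x. 1 - cube_cutoff r Q x) x \<le> (1 + s * r * (4 * bump_slope)) ^ DIM('a)"
proof -
  note excess = mixed_deriv_norm_cube_cutoff_excess_le[OF assms, of x]
  note le_1 = norm_cube_cutoff_le_1[OF assms(3), of r x]
  show "mixed_deriv_norm s bs (cube_cutoff r Q) x \<le> (1 + s * r * (4 * bump_slope)) ^ DIM('a)"
    using excess le_1 by linarith
  obtain t where "cube_cutoff r Q x = of_real t" "0 \<le> t"
    using cube_cutoff_nonneg by (rule nonneg_Reals_cases)
  then have "cmod (1 - cube_cutoff r Q x) = 1 - cmod (cube_cutoff r Q x)"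
    using le_1 norm_of_real[of "1 - t", where 'a=complex] by simp
  then show "mixed_deriv_norm s bs (\<lambda>x. 1 - cube_cutoff r Q x) x
      \<le> (1 + s * r * (4 * bump_slope)) ^ DIM('a)"
    using excess norm_ge_zero[of "cube_cutoff r Q x"]
    unfolding mixed_deriv_norm_one_minus[OF smooth_cube_cutoff] by linarith
qed

definition cutoff_layer :: "(nat \<Rightarrow> ('a::euclidean_space \<Rightarrow> int) set) \<Rightarrow> nat \<Rightarrow> 'a \<Rightarrow> complex" where
  "cutoff_layer Q k x = cube_cutoff (2 ^ k) (Q k) x * (\<Prod>l<k. 1 - cube_cutoff (2 ^ l) (Q l) x)"

lemma smooth_cutoff_layer: "smooth_fun (cutoff_layer Q k)"
  unfolding cutoff_layer_def[abs_def]
  by (intro smooth_fun_mult smooth_fun_prod smooth_fun_diff smooth_cube_cutoff smooth_fun_const)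

lemma sum_cutoff_layer: "(\<Sum>k<N. cutoff_layer Q k x) = 1 - (\<Prod>l<N. 1 - cube_cutoff (2 ^ l) (Q l) x)"
  by (induction N) (auto simp: cutoff_layer_def algebra_simps)

text \<open>Measured at scale k, the derivatives of the coarser cutoffs form a geometric series.\<close>

lemma mixed_deriv_norm_prod_coarser_cutoffs_le:
  fixes x :: "'a::euclidean_space"
  assumes Q: "\<And>l. grid_indices (Q l)" and bs: "set bs \<subseteq> Basis" "distinct bs"
  shows "mixed_deriv_norm (1 / 2 ^ k) bs (\<lambda>x. \<Prod>l<k. 1 - cube_cutoff (2 ^ l) (Q l) x) x
    \<le> exp (4 * bump_slope * DIM('a))"
proof -
  let ?s = "1 / 2 ^ k :: real" and ?M = "4 * bump_slope"
  have "mixed_deriv_norm ?s bs (\<lambda>x. \<Prod>l<k. 1 - cube_cutoff (2 ^ l) (Q l) x) x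
      \<le> (\<Prod>l<k. mixed_deriv_norm ?s bs (\<lambda>x. 1 - cube_cutoff (2 ^ l) (Q l) x) x)"
    by (intro mixed_deriv_norm_prod_le smooth_fun_diff smooth_cube_cutoff) auto
  also have "\<dots> \<le> (\<Prod>l<k. exp (?M * DIM('a) * (?s * 2 ^ l)))"
  proof (intro prod_mono conjI mixed_deriv_norm_nonneg)
    fix l
    have "mixed_deriv_norm ?s bs (\<lambda>x. 1 - cube_cutoff (2 ^ l) (Q l) x) x
        \<le> (1 + ?s * 2 ^ l * ?M) ^ DIM('a)"
      by (intro mixed_deriv_norm_cube_cutoff_le Q bs) auto
    also have "\<dots> \<le> exp (?s * 2 ^ l * ?M) ^ DIM('a)"
      using bump_slope_nonneg by (intro power_mono exp_ge_add_one_self add_nonneg_nonneg) auto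
    also have "\<dots> = exp (?M * DIM('a) * (?s * 2 ^ l))"
      by (simp add: exp_of_nat_mult[symmetric] mult_ac)
    finally show "mixed_deriv_norm ?s bs (\<lambda>x. 1 - cube_cutoff (2 ^ l) (Q l) x) x
      \<le> exp (?M * DIM('a) * (?s * 2 ^ l))" .
  qed auto
  also have "\<dots> = exp (?M * DIM('a) * (?s * (\<Sum>l<k. 2 ^ l)))" by (simp add: exp_sum sum_distrib_left)
  also have "\<dots> \<le> exp (?M * DIM('a) * 1)"
  proof -
    have "(\<Sum>l<k. 2 ^ l :: real) = 2 ^ k - 1" by (induction k) auto
    then show ?thesis
      unfolding exp_le_cancel_iff using bump_slope_nonneg by (intro mult_left_mono) (auto simp: field_simps)
  qed
  finally show ?thesis by simp
qed

definition layer_bound :: "nat \<Rightarrow> real" where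
  "layer_bound d = (1 + 4 * bump_slope) ^ d * exp (4 * bump_slope * d)"

lemma layer_bound_nonneg: "0 \<le> layer_bound d"
  by (simp add: layer_bound_def bump_slope_nonneg)

lemma mixed_deriv_norm_cutoff_layer_le:
  fixes x :: "'a::euclidean_space"
  assumes Q: "\<And>l. grid_indices (Q l)" and bs: "set bs \<subseteq> Basis" "distinct bs"
  shows "mixed_deriv_norm (1 / 2 ^ k) bs (cutoff_layer Q k) x \<le> layer_bound DIM('a)"
proof -
  let ?N = "mixed_deriv_norm (1 / 2 ^ k) bs"
  have "?N (cutoff_layer Q k) x
      \<le> ?N (cube_cutoff (2 ^ k) (Q k)) x * ?N (\<lambda>x. \<Prod>l<k. 1 - cube_cutoff (2 ^ l) (Q l) x) x"
    unfolding cutoff_layer_def[abs_def]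
    by (intro mixed_deriv_norm_mult_le smooth_fun_prod smooth_fun_diff smooth_cube_cutoff) auto
  also have "\<dots> \<le> (1 + 1 / 2 ^ k * 2 ^ k * (4 * bump_slope)) ^ DIM('a) * exp (4 * bump_slope * DIM('a))"
    using bump_slope_nonneg
    by (intro mult_mono mixed_deriv_norm_cube_cutoff_le mixed_deriv_norm_prod_coarser_cutoffs_le
          mixed_deriv_norm_nonneg Q bs) auto
  finally show ?thesis by (simp add: layer_bound_def)
qed

section \<open>Lebesgue integrals on Euclidean space\<close>

lemma nn_integral_lborel_affine:
  fixes f :: "'a::euclidean_space \<Rightarrow> ennreal"
  assumes [measurable]: "f \<in> borel_measurable borel" and c: "c \<noteq> 0"
  shows "(\<integral>\<^sup>+x. f x \<partial>lborel) = ennreal (\<bar>c\<bar> ^ DIM('a)) * (\<integral>\<^sup>+x. f (t + c *\<^sub>R x) \<partial>lborel)"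
  by (subst lborel_affine[OF c, of t])
     (simp add: nn_integral_density nn_integral_distr nn_integral_cmult)

lemma integral_lborel_affine:
  fixes f :: "'a::euclidean_space \<Rightarrow> 'b::{banach, second_countable_topology}"
  assumes [measurable]: "f \<in> borel_measurable borel" and c: "c \<noteq> 0"
  shows "(\<integral>x. f x \<partial>lborel) = (\<bar>c\<bar> ^ DIM('a)) *\<^sub>R (\<integral>x. f (t + c *\<^sub>R x) \<partial>lborel)"
  by (subst lborel_affine[OF c, of t]) (simp add: integral_density integral_distr)

lemma nn_integral_lborel_translate:
  fixes f :: "'a::euclidean_space \<Rightarrow> ennreal"
  assumes "f \<in> borel_measurable borel"
  shows "(\<integral>\<^sup>+x. f (x + t) \<partial>lborel) = (\<integral>\<^sup>+x. f x \<partial>lborel)"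
  using nn_integral_lborel_affine[OF assms, of 1 t] by (simp add: add.commute)

lemma integral_lborel_translate:
  fixes f :: "'a::euclidean_space \<Rightarrow> 'b::{banach, second_countable_topology}"
  assumes "f \<in> borel_measurable borel"
  shows "(\<integral>x. f (x + t) \<partial>lborel) = (\<integral>x. f x \<partial>lborel)"
  using integral_lborel_affine[OF assms, of 1 t] by (simp add: add.commute)

lemma integrable_lborel_translate:
  fixes f :: "'a::euclidean_space \<Rightarrow> 'b::{banach, second_countable_topology}"
  assumes f: "integrable lborel f"
  shows "integrable lborel (\<lambda>x. f (x + t))"
proof -
  have [measurable]: "f \<in> borel_measurable borel" using f by auto
  show ?thesis
    using f nn_integral_lborel_translate[of "\<lambda>x. ennreal (norm (f x))" t]
    by (simp add: integrable_iff_bounded)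
qed

lemma integral_lborel_prod:
  fixes f :: "'a::euclidean_space \<Rightarrow> real \<Rightarrow> 'b::{real_normed_field, banach, second_countable_topology}"
  assumes "\<And>b. b \<in> Basis \<Longrightarrow> integrable lborel (f b)"
  shows "(\<integral>x. (\<Prod>b\<in>Basis. f b (x \<bullet> b)) \<partial>lborel) = (\<Prod>b\<in>Basis. (\<integral>t. f b t \<partial>lborel))"
    and "integrable lborel (\<lambda>x::'a. \<Prod>b\<in>Basis. f b (x \<bullet> b))"
proof -
  interpret product_sigma_finite "\<lambda>_::'a. lborel :: real measure" by standard
  have [measurable]: "\<And>b. b \<in> Basis \<Longrightarrow> f b \<in> borel_measurable borel" using assms by auto
  have coords: "(\<Prod>b\<in>Basis. f b ((\<Sum>b\<in>Basis. g b *\<^sub>R b) \<bullet> b)) = (\<Prod>b\<in>Basis. f b (g b))" for g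
    by (intro prod.cong) auto
  show "(\<integral>x. (\<Prod>b\<in>Basis. f b (x \<bullet> b)) \<partial>lborel) = (\<Prod>b\<in>Basis. (\<integral>t. f b t \<partial>lborel))"
    by (subst lborel_eq, subst integral_distr) (simp_all add: coords product_integral_prod assms)
  show "integrable lborel (\<lambda>x::'a. \<Prod>b\<in>Basis. f b (x \<bullet> b))"
    by (subst lborel_eq, subst integrable_distr_eq) (simp_all add: coords product_integrable_prod assms)
qed

lemma integrable_continuous_bounded_support:
  fixes f :: "'a::euclidean_space \<Rightarrow> 'b::{banach, second_countable_topology}"
  assumes "continuous_on UNIV f" "bounded {x. f x \<noteq> 0}"
  shows "integrable lborel f"
proof -
  obtain R where R: "{x. f x \<noteq> 0} \<subseteq> cball 0 R"
    using assms(2) by (auto simp: bounded_iff subset_iff)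
  have "integrable lborel (\<lambda>x. indicator (cball 0 R) x *\<^sub>R f x)"
    by (intro borel_integrable_compact compact_cball continuous_on_subset[OF assms(1)]) auto
  moreover have "(\<lambda>x. indicator (cball 0 R) x *\<^sub>R f x) = f"
    using R by (intro ext) (auto simp: indicator_def subset_iff)
  ultimately show ?thesis by simp
qed

lemma test_fun_integrable: "test_fun f \<Longrightarrow> integrable lborel f"
  by (intro integrable_continuous_bounded_support test_fun_continuous_on) (simp_all add: test_fun_def)

lemma norm_integral_le_nn_integral:
  fixes f :: "'a \<Rightarrow> 'b::{banach, second_countable_topology}"
  shows "ennreal (norm (integral\<^sup>L M f)) \<le> (\<integral>\<^sup>+x. ennreal (norm (f x)) \<partial>M)"
  by (cases "integrable M f") (auto simp: integral_norm_bound_ennreal not_integrable_integral_eq)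

lemma has_vector_derivative_line:
  assumes "smooth_fun f"
  shows "((\<lambda>t. f (x + t *\<^sub>R v)) has_vector_derivative dir_deriv v f (x + t *\<^sub>R v)) (at t)"
  using has_derivative_affine[OF bounded_linear_scaleR_left assms, of v x t]
  by (simp add: has_vector_derivative_def dir_deriv_scaleR[OF assms] add.commute)

text \<open>Integrate \<open>f (x + v) - f x\<close>, written as the integral of its derivative along the segment.\<close>

lemma integral_dir_deriv:
  fixes f :: "'a::euclidean_space \<Rightarrow> complex"
  assumes "test_fun f"
  shows "(\<integral>x. dir_deriv v f x \<partial>lborel) = 0"
proof -
  let ?D = "dir_deriv v f"
  let ?h = "\<lambda>(t::real) x. indicator {0..1} t *\<^sub>R ?D (x + t *\<^sub>R v)"
  have [measurable]: "f \<in> borel_measurable borel" "?D \<in> borel_measurable borel"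
    using assms test_fun_borel test_fun_dir_deriv by blast+
  have integrable: "integrable lborel f" "integrable lborel ?D"
    using assms by (auto intro: test_fun_integrable test_fun_dir_deriv)
  have line: "(\<integral>t. ?h t x \<partial>lborel) = f (x + v) - f x" for x
  proof -
    have "continuous_on {0..1} (\<lambda>t. ?D (x + t *\<^sub>R v))"
      using assms
      by (intro continuous_on_compose2[OF test_fun_continuous_on[OF test_fun_dir_deriv]] continuous_intros) auto
    then have "(\<integral>t. ?h t x \<partial>lborel) = f (x + 1 *\<^sub>R v) - f (x + 0 *\<^sub>R v)"
      using assms
      by (intro integral_FTC_atLeastAtMost[where F="\<lambda>t. f (x + t *\<^sub>R v)"]
            has_vector_derivative_at_within[OF has_vector_derivative_line] test_fun_smooth) auto
    then show ?thesis by simp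
  qed
  have space: "(\<integral>x. ?h t x \<partial>lborel) = indicator {0..1} t *\<^sub>R (\<integral>x. ?D x \<partial>lborel)" for t
    by (simp add: integral_lborel_translate)
  have "integrable (lborel \<Otimes>\<^sub>M lborel) (\<lambda>(t, x). ?h t x)"
  proof (rule lborel_pair.Fubini_integrable)
    have "(\<integral>x. norm (?D (x + t *\<^sub>R v)) \<partial>lborel) = (\<integral>x. norm (?D x) \<partial>lborel)" for t
      using integral_lborel_translate[of "\<lambda>x. norm (?D x)" "t *\<^sub>R v"] by simp
    then show "integrable lborel (\<lambda>t. \<integral>x. norm (case (t, x) of (t, x) \<Rightarrow> ?h t x) \<partial>lborel)"
      by simp
  qed (auto intro!: AE_I2 integrable_lborel_translate integrable)
  then have "(\<integral>x. f (x + v) - f x \<partial>lborel)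
      = (\<integral>t. indicator {0..1::real} t *\<^sub>R (\<integral>x. ?D x \<partial>lborel) \<partial>lborel)"
    using lborel_pair.Fubini_integral[of ?h] by (simp only: line space)
  moreover have "(\<integral>x. f (x + v) - f x \<partial>lborel) = 0"
    using integrable integrable_lborel_translate[OF integrable(1)] by (simp add: integral_lborel_translate)
  ultimately show ?thesis by simp
qed

lemma set_integral_zero_of_box_integrals:
  fixes f :: "'a::euclidean_space \<Rightarrow> 'b::{banach, second_countable_topology}"
  assumes int: "integrable lborel f" and total: "(\<integral>x. f x \<partial>lborel) = 0"
    and box: "\<And>a b. (LINT x:box a b|lborel. f x) = 0" and "A \<in> sets borel"
  shows "(LINT x:A|lborel. f x) = 0"
proof -
  have set_int: "set_integrable lborel A f" if "A \<in> sets borel" for A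
    unfolding set_integrable_def by (rule integrable_mult_indicator[OF _ int]) (simp add: that)
  have "Int_stable (range (\<lambda>(a, b). box a b :: 'a set))" by (auto simp: Int_stable_def box_Int_box)
  moreover have "range (\<lambda>(a, b). box a b :: 'a set) \<subseteq> Pow UNIV" by simp
  moreover have "A \<in> sigma_sets UNIV (range (\<lambda>(a, b). box a b))"
    using assms(4) by (simp add: borel_eq_box)
  ultimately show ?thesis
  proof (induction rule: sigma_sets_induct_disjoint)
    case (basic A)
    then show ?case using box by auto
  next
    case empty
    show ?case by (simp add: set_lebesgue_integral_def)
  next
    case (compl A)
    then have A: "A \<in> sets borel" by (simp add: borel_eq_box)
    have "(LINT x:A \<union> (UNIV - A)|lborel. f x) = (LINT x:A|lborel. f x) + (LINT x:UNIV - A|lborel. f x)"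
      using A by (intro set_integral_Un set_int) auto
    moreover have "(LINT x:A \<union> (UNIV - A)|lborel. f x) = 0"
      using total by (simp add: set_lebesgue_integral_def)
    ultimately show ?case using compl by simp
  next
    case (union A)
    then have "A i \<in> sets borel" for i by (auto simp: borel_eq_box)
    then have "(LINT x:(\<Union>i. A i)|lborel. f x) = (\<Sum>i. LINT x:A i|lborel. f x)"
      using union(1) by (intro lebesgue_integral_countable_add set_int) (auto simp: disjoint_family_on_def)
    then show ?case using union by simp
  qed
qed

lemma AE_zero_of_box_integrals:
  fixes f :: "'a::euclidean_space \<Rightarrow> 'b::{banach, second_countable_topology}"
  assumes int: "\<And>a b. set_integrable lborel (box a b) f"
    and zero: "\<And>a b. (LINT x:box a b|lborel. f x) = 0"
  shows "AE x in lborel. f x = 0"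
proof -
  let ?box = "\<lambda>n. box (- (real n *\<^sub>R One)) (real n *\<^sub>R One) :: 'a set"
  have "AE x in lborel. indicator (?box n) x *\<^sub>R f x = 0" for n
  proof (rule sigma_finite_measure.density_zero[OF sigma_finite_lborel])
    let ?f = "\<lambda>x. indicator (?box n) x *\<^sub>R f x"
    show integrable: "integrable lborel ?f" using int unfolding set_integrable_def .
    have box: "(LINT x:box a b|lborel. ?f x) = 0" for a b
    proof -
      have "\<exists>c d. box a b \<inter> ?box n = box c d" unfolding box_Int_box by blast
      then obtain c d where "box a b \<inter> ?box n = box c d" by blast
      then have "indicator (box a b) x *\<^sub>R ?f x = indicator (box c d) x *\<^sub>R f x" for x
        by (auto simp: indicator_def)
      then show ?thesis using zero[of c d] unfolding set_lebesgue_integral_def by (simp only:)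
    qed
    have total: "(\<integral>x. ?f x \<partial>lborel) = 0" using zero unfolding set_lebesgue_integral_def .
    show "(LINT x:A|lborel. ?f x) = 0" if "A \<in> sets lborel" for A
      by (rule set_integral_zero_of_box_integrals[OF integrable total box]) (use that in simp)
  qed
  then have "AE x in lborel. \<forall>n. indicator (?box n) x *\<^sub>R f x = 0" by (subst AE_all_countable) blast
  then show ?thesis
  proof eventually_elim
    case (elim x)
    obtain n where "x \<in> ?box n" using UN_box_eq_UNIV by blast
    then show ?case using elim[rule_format, of n] by simp
  qed
qed

section \<open>The Fourier transform\<close>

lemma borel_measurable_cis [measurable]: "cis \<in> borel_measurable borel"
  by (intro borel_measurable_continuous_onI continuous_intros continuous_on_cis)

lemma borel_measurable_cnj [measurable]: "cnj \<in> borel_measurable borel"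
  by (intro borel_measurable_continuous_onI continuous_intros)

lemma inv_fourier_lborel:
  fixes f :: "'a::euclidean_space \<Rightarrow> complex"
  assumes [measurable]: "f \<in> borel_measurable borel"
  shows "inv_fourier f \<xi> = (\<integral>x. f x * cis (x \<bullet> \<xi>) \<partial>lborel)"
  unfolding inv_fourier_def by (rule integral_completion) measurable

lemma integrable_mult_cis:
  fixes f :: "'a::euclidean_space \<Rightarrow> complex"
  assumes "integrable lborel f"
  shows "integrable lborel (\<lambda>x. f x * cis (x \<bullet> \<xi>))"
proof (rule Bochner_Integration.integrable_bound[OF assms])
  have [measurable]: "f \<in> borel_measurable borel" using assms by auto
  show "(\<lambda>x. f x * cis (x \<bullet> \<xi>)) \<in> borel_measurable lborel" by measurable
qed (auto simp: norm_mult)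

lemma inv_fourier_add:
  assumes "integrable lborel f" "integrable lborel g"
  shows "inv_fourier (\<lambda>x. f x + g x) \<xi> = inv_fourier f \<xi> + inv_fourier g \<xi>"
proof -
  have [measurable]: "f \<in> borel_measurable borel" "g \<in> borel_measurable borel" using assms by auto
  show ?thesis
    using assms by (simp add: inv_fourier_lborel distrib_right integrable_mult_cis)
qed

lemma inv_fourier_sum:
  assumes "\<And>i. i \<in> I \<Longrightarrow> integrable lborel (f i)"
  shows "inv_fourier (\<lambda>x. \<Sum>i\<in>I. f i x) \<xi> = (\<Sum>i\<in>I. inv_fourier (f i) \<xi>)"
  using assms
proof (induction I rule: infinite_finite_induct)
  case (insert i I)
  then show ?case by (simp add: inv_fourier_add)
qed (simp_all add: inv_fourier_def)

lemma norm_inv_fourier_le: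
  assumes "integrable lborel f"
  shows "cmod (inv_fourier f \<xi>) \<le> (\<integral>x. cmod (f x) \<partial>lborel)"
proof -
  have [measurable]: "f \<in> borel_measurable borel" using assms by auto
  have "cmod (\<integral>x. f x * cis (x \<bullet> \<xi>) \<partial>lborel) \<le> (\<integral>x. cmod (f x * cis (x \<bullet> \<xi>)) \<partial>lborel)"
    by (rule integral_norm_bound)
  then show ?thesis by (simp add: inv_fourier_lborel norm_mult)
qed

lemma borel_measurable_inv_fourier:
  assumes [measurable]: "f \<in> borel_measurable borel"
  shows "inv_fourier f \<in> borel_measurable borel"
proof -
  have "(\<lambda>\<xi>. \<integral>x. f x * cis (x \<bullet> \<xi>) \<partial>lborel) \<in> borel_measurable borel" by measurable
  moreover have "inv_fourier f = (\<lambda>\<xi>. \<integral>x. f x * cis (x \<bullet> \<xi>) \<partial>lborel)"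
    by (rule ext) (simp add: inv_fourier_lborel)
  ultimately show ?thesis by simp
qed

lemma inv_fourier_dir_deriv:
  fixes f :: "'a::euclidean_space \<Rightarrow> complex"
  assumes "test_fun f"
  shows "inv_fourier (dir_deriv v f) \<xi> = - \<i> * (v \<bullet> \<xi>) * inv_fourier f \<xi>"
proof -
  let ?e = "\<lambda>x. cis (x \<bullet> \<xi>)"
  have smooth: "smooth_fun ?e"
    using smooth_fun_affine[OF bounded_linear_inner_left smooth_fun_cis, of \<xi> 0] by simp
  have deriv: "dir_deriv v ?e x = of_real (v \<bullet> \<xi>) * (\<i> * ?e x)" for x
    using dir_deriv_affine[OF bounded_linear_inner_left smooth_fun_cis, of v \<xi> 0 x] by (simp add: dir_deriv_cis)
  have "0 = (\<integral>x. dir_deriv v (\<lambda>x. f x * ?e x) x \<partial>lborel)"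
    by (rule integral_dir_deriv[symmetric]) (intro test_fun_mult assms smooth)
  also have "\<dots> = (\<integral>x. (\<i> * (v \<bullet> \<xi>)) * (f x * ?e x) + dir_deriv v f x * ?e x \<partial>lborel)"
    by (intro Bochner_Integration.integral_cong)
       (simp_all only: dir_deriv_mult[OF test_fun_smooth[OF assms] smooth] deriv, simp add: algebra_simps)
  also have "\<dots> = (\<i> * (v \<bullet> \<xi>)) * inv_fourier f \<xi> + inv_fourier (dir_deriv v f) \<xi>"
    using integrable_mult_cis[OF test_fun_integrable[OF assms]]
      integrable_mult_cis[OF test_fun_integrable[OF test_fun_dir_deriv[OF assms]]]
    by (simp add: inv_fourier_lborel test_fun_borel test_fun_dir_deriv assms)
  finally show ?thesis by (simp add: eq_neg_iff_add_eq_0 add.commute)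
qed

lemma inv_fourier_mixed_deriv_op:
  fixes f :: "'a::euclidean_space \<Rightarrow> complex"
  assumes "test_fun f"
  shows "inv_fourier (mixed_deriv_op s bs f) \<xi>
      = (\<Prod>b\<leftarrow>bs. 1 - \<i> * of_real (s * (b \<bullet> \<xi>))) * inv_fourier f \<xi>"
  using assms
proof (induction bs arbitrary: f)
  case (Cons b bs)
  have test: "test_fun (\<lambda>x. of_real s * dir_deriv b f x)"
    by (intro test_fun_cmult test_fun_dir_deriv Cons.prems)
  have "inv_fourier (\<lambda>x. of_real s * dir_deriv b f x) \<xi> = of_real s * inv_fourier (dir_deriv b f) \<xi>"
    unfolding inv_fourier_def by (simp add: mult.assoc)
  then have "inv_fourier (\<lambda>x. f x + of_real s * dir_deriv b f x) \<xi>
      = (1 - \<i> * of_real (s * (b \<bullet> \<xi>))) * inv_fourier f \<xi>"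
    using Cons.prems test by (simp add: inv_fourier_add test_fun_integrable inv_fourier_dir_deriv algebra_simps)
  moreover have "test_fun (\<lambda>x. f x + of_real s * dir_deriv b f x)"
    by (intro test_fun_add Cons.prems test)
  ultimately show ?case using Cons.IH by (simp add: mult.assoc mult.left_commute)
qed simp

lemma real_sqrt_prod: "sqrt (\<Prod>i\<in>I. f i) = (\<Prod>i\<in>I. sqrt (f i))"
  by (induction I rule: infinite_finite_induct) (simp_all add: real_sqrt_mult)

definition cauchy_weight :: "real \<Rightarrow> 'a::euclidean_space \<Rightarrow> real" where
  "cauchy_weight s \<xi> = (\<Prod>b\<in>Basis. 1 + (s * (\<xi> \<bullet> b))\<^sup>2)"

lemma borel_measurable_cauchy_weight [measurable]: "cauchy_weight s \<in> borel_measurable borel"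
  unfolding cauchy_weight_def[abs_def] by measurable

lemma cauchy_weight_ge_1: "1 \<le> cauchy_weight s \<xi>"
  unfolding cauchy_weight_def by (rule prod_ge_1) auto

lemma cauchy_weight_pos: "0 < cauchy_weight s \<xi>"
  using cauchy_weight_ge_1[of s \<xi>] by linarith

lemma norm_inv_fourier_mixed_deriv_op:
  fixes f :: "'a::euclidean_space \<Rightarrow> complex"
  assumes "test_fun f" "distinct bs" "set bs = Basis"
  shows "cmod (inv_fourier (mixed_deriv_op s bs f) \<xi>)
      = sqrt (cauchy_weight s \<xi>) * cmod (inv_fourier f \<xi>)"
proof -
  have "cmod (1 - \<i> * complex_of_real (s * (b \<bullet> \<xi>))) = sqrt (1 + (s * (\<xi> \<bullet> b))\<^sup>2)" for b
    by (simp add: cmod_def inner_commute)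
  then have "cmod (\<Prod>b\<leftarrow>bs. 1 - \<i> * complex_of_real (s * (b \<bullet> \<xi>)))
      = (\<Prod>b\<in>Basis. sqrt (1 + (s * (\<xi> \<bullet> b))\<^sup>2))"
    unfolding prod.distinct_set_conv_list[OF assms(2), symmetric] assms(3) by (simp add: prod_norm[symmetric])
  then show ?thesis
    using assms(1) by (simp add: inv_fourier_mixed_deriv_op norm_mult cauchy_weight_def real_sqrt_prod)
qed

lemma nn_integral_inverse_one_plus_square:
  assumes "0 < s"
  shows "(\<integral>\<^sup>+x. ennreal (1 / (1 + (s * x)\<^sup>2)) \<partial>lborel) = ennreal (pi / s)"
proof -
  have "integrable lborel (\<lambda>x::real. inverse (1 + x\<^sup>2))"
    using integrable_inverse_1_plus_square by (simp add: set_integrable_def)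
  moreover have "(\<integral>x. inverse (1 + x\<^sup>2) \<partial>lborel) = pi"
    using LBINT_inverse_1_plus_square
    by (simp add: interval_lebesgue_integral_def set_lebesgue_integral_def)
  ultimately have "(\<integral>\<^sup>+x. ennreal (inverse (1 + x\<^sup>2)) \<partial>lborel) = ennreal pi"
    by (simp add: nn_integral_eq_integral)
  then have "ennreal s * (\<integral>\<^sup>+x. ennreal (1 / (1 + (s * x)\<^sup>2)) \<partial>lborel) = ennreal pi"
    using nn_integral_real_affine[of "\<lambda>x. ennreal (inverse (1 + x\<^sup>2))" s 0] assms by (simp add: inverse_eq_divide)
  then have "ennreal (1 / s) * (ennreal s * (\<integral>\<^sup>+x. ennreal (1 / (1 + (s * x)\<^sup>2)) \<partial>lborel))
      = ennreal (1 / s) * ennreal pi"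
    by (rule arg_cong)
  then show ?thesis
    using assms by (simp add: mult.assoc[symmetric] ennreal_mult'[symmetric])
qed

lemma nn_integral_inverse_cauchy_weight:
  assumes "0 < s"
  shows "(\<integral>\<^sup>+\<xi>. ennreal (1 / cauchy_weight s \<xi>) \<partial>(lborel :: 'a::euclidean_space measure))
      = ennreal ((pi / s) ^ DIM('a))"
proof -
  have "(\<integral>\<^sup>+\<xi>. ennreal (1 / cauchy_weight s \<xi>) \<partial>(lborel :: 'a measure))
      = (\<integral>\<^sup>+\<xi>. (\<Prod>b\<in>Basis. ennreal (1 / (1 + (s * (\<xi> \<bullet> b))\<^sup>2))) \<partial>(lborel :: 'a measure))"
    unfolding cauchy_weight_def
    by (intro nn_integral_cong) (simp add: prod_ennreal prod_dividef)
  also have "\<dots> = (\<Prod>b\<in>(Basis :: 'a set). ennreal (pi / s))"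
    by (subst nn_integral_lborel_prod) (auto simp: nn_integral_inverse_one_plus_square[OF assms])
  finally show ?thesis using assms by (simp add: ennreal_power)
qed

lemma integral_inv_fourier_mult:
  fixes f u :: "'a::euclidean_space \<Rightarrow> complex"
  assumes f: "integrable lborel f" and u: "integrable lborel u"
  shows "(\<integral>\<xi>. inv_fourier f \<xi> * u \<xi> \<partial>lborel) = (\<integral>x. f x * (\<integral>\<xi>. cis (x \<bullet> \<xi>) * u \<xi> \<partial>lborel) \<partial>lborel)"
proof -
  have [measurable]: "f \<in> borel_measurable borel" "u \<in> borel_measurable borel" using assms by auto
  let ?h = "\<lambda>x \<xi>. f x * cis (x \<bullet> \<xi>) * u \<xi>"
  have "integrable (lborel \<Otimes>\<^sub>M lborel) (\<lambda>(x, \<xi>). ?h x \<xi>)"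
  proof (rule lborel_pair.Fubini_integrable)
    show "integrable lborel (\<lambda>x. \<integral>\<xi>. norm (case (x, \<xi>) of (x, \<xi>) \<Rightarrow> ?h x \<xi>) \<partial>lborel)"
      using f by (simp add: norm_mult)
    have "integrable lborel (\<lambda>\<xi>. f x * (u \<xi> * cis (\<xi> \<bullet> x)))" for x
      by (intro integrable_mult_right integrable_mult_cis u)
    then show "AE x in lborel. integrable lborel (\<lambda>\<xi>. case (x, \<xi>) of (x, \<xi>) \<Rightarrow> ?h x \<xi>)"
      by (simp add: inner_commute mult_ac)
  qed measurable
  then have "(\<integral>\<xi>. (\<integral>x. ?h x \<xi> \<partial>lborel) \<partial>lborel) = (\<integral>x. (\<integral>\<xi>. ?h x \<xi> \<partial>lborel) \<partial>lborel)"
    by (intro lborel_pair.Fubini_integral) simp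
  moreover have "(\<integral>x. ?h x \<xi> \<partial>lborel) = inv_fourier f \<xi> * u \<xi>" for \<xi>
    by (simp add: inv_fourier_lborel)
  moreover have "(\<integral>\<xi>. ?h x \<xi> \<partial>lborel) = f x * (\<integral>\<xi>. cis (x \<bullet> \<xi>) * u \<xi> \<partial>lborel)" for x
    by (simp add: mult.assoc)
  ultimately show ?thesis by (simp only:)
qed

section \<open>Gaussian regularisation and the Plancherel inequality\<close>

definition gauss :: "real \<Rightarrow> 'a::euclidean_space \<Rightarrow> real" where
  "gauss e x = exp (- (e\<^sup>2 * (x \<bullet> x)) / 2)"

text \<open>The Fourier transform of \<open>gauss e\<close>.\<close>

definition gauss_kernel :: "real \<Rightarrow> 'a::euclidean_space \<Rightarrow> real" where
  "gauss_kernel e x = (sqrt (2 * pi) / e) ^ DIM('a) * gauss (1 / e) x"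

lemma gauss_prod: "gauss e x = (\<Prod>b\<in>Basis. exp (- ((e * (x \<bullet> b))\<^sup>2) / 2))"
proof -
  have "- (e\<^sup>2 * (x \<bullet> x)) / 2 = (\<Sum>b\<in>Basis. - ((e * (x \<bullet> b))\<^sup>2) / 2)"
    by (subst euclidean_inner) (simp add: sum_distrib_left sum_negf sum_divide_distrib power2_eq_square algebra_simps)
  then show ?thesis unfolding gauss_def by (simp only: exp_sum[OF finite_Basis])
qed

lemma gauss_nonneg [simp]: "0 \<le> gauss e x"
  and gauss_le_1: "gauss e x \<le> 1"
  by (auto simp: gauss_def)

lemma borel_measurable_gauss [measurable]: "gauss e \<in> borel_measurable borel"
  unfolding gauss_def[abs_def] by measurable

lemma tendsto_gauss_1: "(\<lambda>n. gauss (1 / real (Suc n)) x) \<longlonglongrightarrow> 1"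
proof -
  have "(\<lambda>n. exp (- ((1 / real (Suc n))\<^sup>2 * (x \<bullet> x)) / 2)) \<longlonglongrightarrow> exp (- (0\<^sup>2 * (x \<bullet> x)) / 2)"
    by (intro tendsto_intros LIMSEQ_Suc[OF lim_1_over_n]) auto
  then show ?thesis by (simp add: gauss_def)
qed

lemma gauss_kernel_nonneg: "0 < e \<Longrightarrow> 0 \<le> gauss_kernel e x"
  by (simp add: gauss_kernel_def)

lemma gauss_kernel_commute: "gauss_kernel e (x - y) = gauss_kernel e (y - x)"
proof -
  have "(x - y) \<bullet> (x - y) = (y - x) \<bullet> (y - x)"
    by (metis inner_minus_left inner_minus_right minus_diff_eq)
  then show ?thesis by (simp add: gauss_kernel_def gauss_def)
qed

lemma borel_measurable_gauss_kernel [measurable]: "gauss_kernel e \<in> borel_measurable borel"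
  unfolding gauss_kernel_def[abs_def] by measurable

lemma fourier_gauss_std_real:
  fixes t :: real
  shows "integrable lborel (\<lambda>x. cis (t * x) * complex_of_real (exp (- (x\<^sup>2) / 2)))"
    and "(\<integral>x. cis (t * x) * complex_of_real (exp (- (x\<^sup>2) / 2)) \<partial>lborel)
      = complex_of_real (sqrt (2 * pi) * exp (- (t\<^sup>2) / 2))"
proof -
  let ?f = "\<lambda>x. cis (t * x) * complex_of_real (exp (- (x\<^sup>2) / 2))"
  have "integrable lborel (\<lambda>x::real. exp (- (x\<^sup>2) / 2))"
    using integrable_mult_right[OF integrable_normal_density[of 1 0], of "sqrt (2 * pi)"]
    by (simp add: std_normal_density_def)
  then show "integrable lborel ?f"
    by (rule Bochner_Integration.integrable_bound) (auto simp: norm_mult)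
  have "char std_normal_distribution t = (\<integral>x. std_normal_density x *\<^sub>R iexp (t * x) \<partial>lborel)"
    unfolding char_def by (subst integral_density) auto
  also have "\<dots> = (\<integral>x. complex_of_real (1 / sqrt (2 * pi)) * ?f x \<partial>lborel)"
    by (intro Bochner_Integration.integral_cong)
       (auto simp: std_normal_density_def scaleR_conv_of_real cis_conv_exp)
  also have "\<dots> = complex_of_real (1 / sqrt (2 * pi)) * (\<integral>x. ?f x \<partial>lborel)"
    by (rule integral_mult_right_zero)
  finally show "(\<integral>x. ?f x \<partial>lborel) = complex_of_real (sqrt (2 * pi) * exp (- (t\<^sup>2) / 2))"
    by (simp add: char_std_normal_distribution field_simps)
qed

lemma fourier_gauss_real:
  fixes e t :: real
  assumes "0 < e"
  shows "integrable lborel (\<lambda>x. cis (t * x) * complex_of_real (exp (- ((e * x)\<^sup>2) / 2)))"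
    and "(\<integral>x. cis (t * x) * complex_of_real (exp (- ((e * x)\<^sup>2) / 2)) \<partial>lborel)
      = complex_of_real (sqrt (2 * pi) / e * exp (- ((1 / e * t)\<^sup>2) / 2))"
proof -
  let ?f = "\<lambda>x. cis (t / e * x) * complex_of_real (exp (- (x\<^sup>2) / 2))"
  have rescaled: "(\<lambda>x. ?f (0 + e * x)) = (\<lambda>x. cis (t * x) * complex_of_real (exp (- ((e * x)\<^sup>2) / 2)))"
    using assms by auto
  show "integrable lborel (\<lambda>x. cis (t * x) * complex_of_real (exp (- ((e * x)\<^sup>2) / 2)))"
    using lborel_integrable_real_affine[OF fourier_gauss_std_real(1)[of "t / e"], of e 0] assms
    unfolding rescaled by simp
  have "complex_of_real (sqrt (2 * pi) * exp (- ((t / e)\<^sup>2) / 2))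
     = e *\<^sub>R (\<integral>x. cis (t * x) * complex_of_real (exp (- ((e * x)\<^sup>2) / 2)) \<partial>lborel)"
    using lborel_integral_real_affine[of e ?f 0] assms unfolding rescaled fourier_gauss_std_real(2) by simp
  then show "(\<integral>x. cis (t * x) * complex_of_real (exp (- ((e * x)\<^sup>2) / 2)) \<partial>lborel)
      = complex_of_real (sqrt (2 * pi) / e * exp (- ((1 / e * t)\<^sup>2) / 2))"
    using assms by (simp add: scaleR_conv_of_real field_simps)
qed

lemma cis_inner_prod:
  fixes z \<xi> :: "'a::euclidean_space"
  shows "cis (z \<bullet> \<xi>) = (\<Prod>b\<in>Basis. cis ((z \<bullet> b) * (\<xi> \<bullet> b)))"
  by (subst euclidean_inner) (simp add: cis_conv_exp exp_sum sum_distrib_left)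

lemma fourier_gauss:
  fixes z :: "'a::euclidean_space"
  assumes "0 < e"
  shows "integrable lborel (\<lambda>\<xi>. cis (z \<bullet> \<xi>) * complex_of_real (gauss e \<xi>))"
    and "(\<integral>\<xi>. cis (z \<bullet> \<xi>) * complex_of_real (gauss e \<xi>) \<partial>lborel) = complex_of_real (gauss_kernel e z)"
proof -
  let ?f = "\<lambda>b t. cis ((z \<bullet> b) * t) * complex_of_real (exp (- ((e * t)\<^sup>2) / 2))"
  have tensor: "(\<lambda>\<xi>. cis (z \<bullet> \<xi>) * complex_of_real (gauss e \<xi>)) = (\<lambda>\<xi>. \<Prod>b\<in>Basis. ?f b (\<xi> \<bullet> b))"
    by (simp add: cis_inner_prod gauss_prod prod.distrib of_real_prod)
  show "integrable lborel (\<lambda>\<xi>. cis (z \<bullet> \<xi>) * complex_of_real (gauss e \<xi>))"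
    unfolding tensor by (intro integral_lborel_prod(2) fourier_gauss_real(1) assms)
  have "(\<integral>\<xi>. cis (z \<bullet> \<xi>) * complex_of_real (gauss e \<xi>) \<partial>lborel)
     = (\<Prod>b\<in>Basis. complex_of_real (sqrt (2 * pi) / e * exp (- ((1 / e * (z \<bullet> b))\<^sup>2) / 2)))"
    unfolding tensor by (subst integral_lborel_prod(1)) (use fourier_gauss_real[OF assms] in auto)
  also have "\<dots> = complex_of_real (\<Prod>b\<in>Basis. sqrt (2 * pi) / e * exp (- ((1 / e * (z \<bullet> b))\<^sup>2) / 2))"
    by (rule of_real_prod[symmetric])
  also have "(\<Prod>b\<in>Basis. sqrt (2 * pi) / e * exp (- ((1 / e * (z \<bullet> b))\<^sup>2) / 2)) = gauss_kernel e z"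
    by (simp only: gauss_kernel_def gauss_prod prod.distrib prod_constant)
  finally show "(\<integral>\<xi>. cis (z \<bullet> \<xi>) * complex_of_real (gauss e \<xi>) \<partial>lborel)
      = complex_of_real (gauss_kernel e z)" .
qed

lemma integrable_gauss:
  assumes "0 < e" shows "integrable lborel (gauss e :: 'a::euclidean_space \<Rightarrow> real)"
  using fourier_gauss(1)[OF assms, of "0::'a"] by (simp add: complex_of_real_integrable_eq)

lemma integral_gauss:
  assumes "0 < e"
  shows "(\<integral>x. gauss e x \<partial>(lborel :: 'a::euclidean_space measure)) = (sqrt (2 * pi) / e) ^ DIM('a)"
proof -
  have "complex_of_real (\<integral>x. gauss e x \<partial>(lborel :: 'a measure))
      = complex_of_real ((sqrt (2 * pi) / e) ^ DIM('a))"
    using fourier_gauss(2)[OF assms, of "0::'a"] by (simp add: gauss_kernel_def gauss_def)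
  then show ?thesis by (simp only: of_real_eq_iff)
qed

lemma nn_integral_gauss_kernel:
  fixes x :: "'a::euclidean_space"
  assumes "0 < e"
  shows "(\<integral>\<^sup>+y. ennreal (gauss_kernel e (y - x)) \<partial>lborel) = ennreal ((2 * pi) ^ DIM('a))"
proof -
  have "(\<integral>\<^sup>+y. ennreal (gauss_kernel e (y - x)) \<partial>lborel)
      = (\<integral>\<^sup>+y. ennreal (gauss_kernel e y) \<partial>(lborel :: 'a measure))"
    using nn_integral_lborel_translate[of "\<lambda>y. ennreal (gauss_kernel e y)" "- x"] by simp
  also have "\<dots> = ennreal (\<integral>y. gauss_kernel e y \<partial>(lborel :: 'a measure))"
    using assms unfolding gauss_kernel_def
    by (intro nn_integral_eq_integral integrable_mult_right integrable_gauss) auto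
  also have "(\<integral>y. gauss_kernel e y \<partial>(lborel :: 'a measure))
      = (sqrt (2 * pi) / e * (sqrt (2 * pi) / (1 / e))) ^ DIM('a)"
    using assms unfolding gauss_kernel_def power_mult_distrib
    by (simp only: integral_mult_right_zero integral_gauss[of "1 / e"] zero_less_divide_1_iff)
  also have "sqrt (2 * pi) / e * (sqrt (2 * pi) / (1 / e)) = 2 * pi" using assms by simp
  finally show ?thesis .
qed

lemma integral_inv_fourier_gauss:
  fixes f :: "'a::euclidean_space \<Rightarrow> complex"
  assumes f: "integrable lborel f" and e: "0 < e"
  shows "(\<integral>\<xi>. inv_fourier f \<xi> * (cis (- (x \<bullet> \<xi>)) * of_real (gauss e \<xi>)) \<partial>lborel)
    = (\<integral>y. f y * of_real (gauss_kernel e (y - x)) \<partial>lborel)"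
proof -
  have "integrable lborel (\<lambda>\<xi>. cis (- (x \<bullet> \<xi>)) * complex_of_real (gauss e \<xi>))"
    using fourier_gauss(1)[OF e, of "- x"] by simp
  then have "(\<integral>\<xi>. inv_fourier f \<xi> * (cis (- (x \<bullet> \<xi>)) * of_real (gauss e \<xi>)) \<partial>lborel)
      = (\<integral>y. f y * (\<integral>\<xi>. cis (y \<bullet> \<xi>) * (cis (- (x \<bullet> \<xi>)) * of_real (gauss e \<xi>)) \<partial>lborel) \<partial>lborel)"
    by (rule integral_inv_fourier_mult[OF f])
  also have "(\<lambda>y \<xi>. cis (y \<bullet> \<xi>) * (cis (- (x \<bullet> \<xi>)) * complex_of_real (gauss e \<xi>)))
      = (\<lambda>y \<xi>. cis ((y - x) \<bullet> \<xi>) * of_real (gauss e \<xi>))"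
    by (simp add: mult.assoc[symmetric] cis_mult inner_diff_left)
  finally show ?thesis by (simp only: fourier_gauss(2)[OF e])
qed

lemma integral_inv_fourier_gauss_rescaled:
  fixes f :: "'a::euclidean_space \<Rightarrow> complex"
  assumes f: "integrable lborel f" and e: "0 < e"
  shows "(\<integral>\<xi>. inv_fourier f \<xi> * of_real (gauss e \<xi>) \<partial>lborel)
    = of_real (sqrt (2 * pi) ^ DIM('a)) * (\<integral>y. f (e *\<^sub>R y) * of_real (gauss 1 y) \<partial>lborel)"
proof -
  have [measurable]: "f \<in> borel_measurable borel" using f by auto
  let ?c = "complex_of_real (sqrt (2 * pi) ^ DIM('a))"
  have "(\<integral>\<xi>. inv_fourier f \<xi> * of_real (gauss e \<xi>) \<partial>lborel)
      = (\<integral>y. f y * of_real (gauss_kernel e y) \<partial>lborel)"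
    using integral_inv_fourier_gauss[OF f e, of 0] by simp
  also have "\<dots> = (\<bar>e\<bar> ^ DIM('a)) *\<^sub>R (\<integral>y. f (0 + e *\<^sub>R y) * of_real (gauss_kernel e (0 + e *\<^sub>R y)) \<partial>lborel)"
    using e by (intro integral_lborel_affine) auto
  also have "\<dots> = (\<integral>y. (\<bar>e\<bar> ^ DIM('a)) *\<^sub>R (f (0 + e *\<^sub>R y) * of_real (gauss_kernel e (0 + e *\<^sub>R y))) \<partial>lborel)"
    by (rule integral_scaleR_right[symmetric])
  also have "\<dots> = (\<integral>y. ?c * (f (e *\<^sub>R y) * of_real (gauss 1 y)) \<partial>lborel)"
    using e
    by (intro Bochner_Integration.integral_cong refl)
       (simp add: gauss_kernel_def gauss_def power_divide power2_eq_square scaleR_conv_of_real)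
  also have "\<dots> = ?c * (\<integral>y. f (e *\<^sub>R y) * of_real (gauss 1 y) \<partial>lborel)"
    by (rule integral_mult_right_zero)
  finally show ?thesis .
qed

lemma fourier_inversion_at_0:
  fixes f :: "'a::euclidean_space \<Rightarrow> complex"
  assumes f: "integrable lborel f" "integrable lborel (inv_fourier f)"
    and cont: "isCont f 0" and bound: "\<And>x. cmod (f x) \<le> B"
  shows "(\<integral>\<xi>. inv_fourier f \<xi> \<partial>lborel) = of_real ((2 * pi) ^ DIM('a)) * f 0"
proof -
  have [measurable]: "f \<in> borel_measurable borel" "inv_fourier f \<in> borel_measurable borel"
    using f by auto
  define e where "e n = 1 / real (Suc n)" for n
  have e: "0 < e n" for n by (simp add: e_def)
  have e_lim: "e \<longlonglongrightarrow> 0" unfolding e_def[abs_def] by (rule LIMSEQ_Suc[OF lim_1_over_n])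
  let ?c = "complex_of_real (sqrt (2 * pi) ^ DIM('a))"
  have "(\<lambda>n. \<integral>\<xi>. inv_fourier f \<xi> * of_real (gauss (e n) \<xi>) \<partial>lborel)
      \<longlonglongrightarrow> (\<integral>\<xi>. inv_fourier f \<xi> * of_real 1 \<partial>lborel)"
  proof (rule integral_dominated_convergence[where w="\<lambda>\<xi>. cmod (inv_fourier f \<xi>)"])
    show "AE \<xi> in lborel. (\<lambda>n. inv_fourier f \<xi> * of_real (gauss (e n) \<xi>)) \<longlonglongrightarrow> inv_fourier f \<xi> * of_real 1"
      unfolding e_def by (intro AE_I2 tendsto_intros tendsto_gauss_1)
    show "AE \<xi> in lborel. norm (inv_fourier f \<xi> * of_real (gauss (e n) \<xi>))
        \<le> cmod (inv_fourier f \<xi>)" for n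
      by (auto simp: norm_mult intro!: AE_I2 mult_left_le gauss_le_1)
  qed (use f in auto)
  moreover have "(\<lambda>n. \<integral>y. f (e n *\<^sub>R y) * of_real (gauss 1 y) \<partial>lborel)
      \<longlonglongrightarrow> (\<integral>y. f 0 * of_real (gauss 1 y) \<partial>(lborel :: 'a measure))"
  proof (rule integral_dominated_convergence[where w="\<lambda>y. B * gauss 1 y"])
    show "integrable lborel (\<lambda>y::'a. B * gauss 1 y)"
      by (intro integrable_mult_right integrable_gauss) simp
    have "(\<lambda>n. f (e n *\<^sub>R y)) \<longlonglongrightarrow> f 0" for y
      using tendsto_scaleR[OF e_lim tendsto_const[of y]] by (intro isCont_tendsto_compose[OF cont]) simp
    then show "AE y in lborel. (\<lambda>n. f (e n *\<^sub>R y) * of_real (gauss 1 y)) \<longlonglongrightarrow> f 0 * of_real (gauss 1 y)"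
      by (intro AE_I2 tendsto_intros)
    show "AE y in lborel. norm (f (e n *\<^sub>R y) * of_real (gauss 1 y)) \<le> B * gauss 1 y" for n
      by (auto simp: norm_mult intro!: AE_I2 mult_right_mono bound)
  qed auto
  ultimately have "(\<integral>\<xi>. inv_fourier f \<xi> \<partial>lborel)
      = ?c * (\<integral>y. f 0 * of_real (gauss 1 y) \<partial>(lborel :: 'a measure))"
    by (auto simp: integral_inv_fourier_gauss_rescaled[OF f(1) e]
          intro: LIMSEQ_unique[OF _ tendsto_mult[OF tendsto_const]])
  also have "\<dots> = ?c * ?c * f 0"
    using integral_gauss[of 1, where 'a='a] by simp
  also have "?c * ?c = of_real ((2 * pi) ^ DIM('a))"
    unfolding of_real_mult[symmetric] power_mult_distrib[symmetric] by simp
  finally show ?thesis .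
qed

lemma Schur_test_symmetric_kernel:
  fixes a :: "'a \<Rightarrow> ennreal" and k :: "'a \<Rightarrow> 'a \<Rightarrow> ennreal"
  assumes M: "sigma_finite_measure M"
    and [measurable]: "a \<in> borel_measurable M" "case_prod k \<in> borel_measurable (M \<Otimes>\<^sub>M M)"
    and symmetric: "\<And>x y. k x y = k y x" and bound: "\<And>x. x \<in> space M \<Longrightarrow> (\<integral>\<^sup>+y. k x y \<partial>M) \<le> c"
  shows "(\<integral>\<^sup>+x. (\<integral>\<^sup>+y. a x * a y * k x y \<partial>M) \<partial>M) \<le> c * (\<integral>\<^sup>+x. (a x)\<^sup>2 \<partial>M)"
proof -
  interpret pair_sigma_finite M M using M by (simp add: pair_sigma_finite_def)
  have am_gm: "2 * (u * v) \<le> u\<^sup>2 + v\<^sup>2" for u v :: ennreal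
  proof (cases u; cases v)
    fix r s :: real assume "u = ennreal r" "0 \<le> r" "v = ennreal s" "0 \<le> s"
    moreover have "2 * (r * s) \<le> r\<^sup>2 + s\<^sup>2" using sum_squares_bound[of r s] by simp
    ultimately show ?thesis
      by (simp add: ennreal_power ennreal_mult'[symmetric] ennreal_plus[symmetric] numeral_mult_ennreal ennreal_leI del: ennreal_plus)
  qed auto
  have diagonal: "(\<integral>\<^sup>+x. (\<integral>\<^sup>+y. (a x)\<^sup>2 * k x y \<partial>M) \<partial>M) \<le> c * (\<integral>\<^sup>+x. (a x)\<^sup>2 \<partial>M)"
  proof -
    have "k x \<in> borel_measurable M" if "x \<in> space M" for x
      using measurable_compose[OF measurable_Pair1'[OF that] assms(3)] by simp
    then have "(\<integral>\<^sup>+x. (\<integral>\<^sup>+y. (a x)\<^sup>2 * k x y \<partial>M) \<partial>M) \<le> (\<integral>\<^sup>+x. (a x)\<^sup>2 * c \<partial>M)"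
      by (intro nn_integral_mono) (simp add: nn_integral_cmult mult_left_mono bound)
    also have "\<dots> = c * (\<integral>\<^sup>+x. (a x)\<^sup>2 \<partial>M)" by (subst nn_integral_multc) (auto simp: mult.commute)
    finally show ?thesis .
  qed
  have "2 * (\<integral>\<^sup>+x. (\<integral>\<^sup>+y. a x * a y * k x y \<partial>M) \<partial>M) = 2 * (\<integral>\<^sup>+(x, y). a x * a y * k x y \<partial>(M \<Otimes>\<^sub>M M))"
    by (simp add: sigma_finite_measure.nn_integral_fst[OF M, symmetric])
  also have "\<dots> = (\<integral>\<^sup>+(x, y). 2 * (a x * a y) * k x y \<partial>(M \<Otimes>\<^sub>M M))"
    unfolding case_prod_beta mult.assoc by (rule nn_integral_cmult[symmetric]) measurable
  also have "\<dots> \<le> (\<integral>\<^sup>+(x, y). (a x)\<^sup>2 * k x y + (a y)\<^sup>2 * k x y \<partial>(M \<Otimes>\<^sub>M M))"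
    by (intro nn_integral_mono) (auto simp: distrib_right[symmetric] intro!: mult_right_mono am_gm)
  also have "\<dots> = (\<integral>\<^sup>+(x, y). (a x)\<^sup>2 * k x y \<partial>(M \<Otimes>\<^sub>M M)) + (\<integral>\<^sup>+(x, y). (a y)\<^sup>2 * k x y \<partial>(M \<Otimes>\<^sub>M M))"
    unfolding case_prod_beta by (rule nn_integral_add) measurable
  also have "(\<integral>\<^sup>+(x, y). (a x)\<^sup>2 * k x y \<partial>(M \<Otimes>\<^sub>M M)) = (\<integral>\<^sup>+x. (\<integral>\<^sup>+y. (a x)\<^sup>2 * k x y \<partial>M) \<partial>M)"
    by (simp add: sigma_finite_measure.nn_integral_fst[OF M, symmetric])
  also have "(\<integral>\<^sup>+(x, y). (a y)\<^sup>2 * k x y \<partial>(M \<Otimes>\<^sub>M M)) = (\<integral>\<^sup>+x. (\<integral>\<^sup>+y. (a x)\<^sup>2 * k x y \<partial>M) \<partial>M)"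
    by (simp add: nn_integral_snd[symmetric] symmetric)
  finally have "2 * (\<integral>\<^sup>+x. (\<integral>\<^sup>+y. a x * a y * k x y \<partial>M) \<partial>M) \<le> 2 * (\<integral>\<^sup>+x. (\<integral>\<^sup>+y. (a x)\<^sup>2 * k x y \<partial>M) \<partial>M)"
    by (simp add: mult_2)
  then show ?thesis using diagonal by (simp add: ennreal_mult_le_mult_iff)
qed

lemma integral_norm_inv_fourier_square_gauss:
  fixes f :: "'a::euclidean_space \<Rightarrow> complex"
  assumes f: "integrable lborel f" and e: "0 < e"
  shows "integrable lborel (\<lambda>\<xi>. (cmod (inv_fourier f \<xi>))\<^sup>2 * gauss e \<xi>)"
    and "complex_of_real (\<integral>\<xi>. (cmod (inv_fourier f \<xi>))\<^sup>2 * gauss e \<xi> \<partial>lborel)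
      = (\<integral>x. f x * cnj (\<integral>y. f y * of_real (gauss_kernel e (y - x)) \<partial>lborel) \<partial>lborel)"
proof -
  let ?F = "inv_fourier f"
  have [measurable]: "f \<in> borel_measurable borel" using f by auto
  have [measurable]: "?F \<in> borel_measurable borel" by (rule borel_measurable_inv_fourier) measurable
  define B where "B = (\<integral>x. cmod (f x) \<partial>lborel)"
  have F_le: "cmod (?F \<xi>) \<le> B" for \<xi> unfolding B_def by (rule norm_inv_fourier_le[OF f])
  have "integrable lborel (\<lambda>\<xi>::'a. B\<^sup>2 * gauss e \<xi>)" by (intro integrable_mult_right integrable_gauss e)
  then show "integrable lborel (\<lambda>\<xi>. (cmod (?F \<xi>))\<^sup>2 * gauss e \<xi>)"
    by (rule Bochner_Integration.integrable_bound)
       (auto simp: abs_mult intro!: AE_I2 mult_right_mono power_mono F_le)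
  have "integrable lborel (\<lambda>\<xi>::'a. B * gauss e \<xi>)" by (intro integrable_mult_right integrable_gauss e)
  then have int: "integrable lborel (\<lambda>\<xi>. cnj (?F \<xi>) * of_real (gauss e \<xi>))"
    by (rule Bochner_Integration.integrable_bound)
       (auto simp: norm_mult intro!: AE_I2 order_trans[OF mult_right_mono[OF F_le] abs_ge_self])
  have "(\<integral>\<xi>. cis (x \<bullet> \<xi>) * (cnj (?F \<xi>) * of_real (gauss e \<xi>)) \<partial>lborel)
      = cnj (\<integral>\<xi>. ?F \<xi> * (cis (- (x \<bullet> \<xi>)) * of_real (gauss e \<xi>)) \<partial>lborel)" for x
    unfolding Bochner_Integration.integral_cnj[symmetric]
    by (intro Bochner_Integration.integral_cong refl) (simp add: cis_cnj)
  then have inner: "(\<integral>\<xi>. cis (x \<bullet> \<xi>) * (cnj (?F \<xi>) * of_real (gauss e \<xi>)) \<partial>lborel)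
      = cnj (\<integral>y. f y * of_real (gauss_kernel e (y - x)) \<partial>lborel)" for x
    by (simp only: integral_inv_fourier_gauss[OF f e])
  have "complex_of_real (\<integral>\<xi>. (cmod (?F \<xi>))\<^sup>2 * gauss e \<xi> \<partial>lborel)
      = (\<integral>\<xi>. ?F \<xi> * (cnj (?F \<xi>) * of_real (gauss e \<xi>)) \<partial>lborel)"
    unfolding integral_complex_of_real[symmetric]
    by (intro Bochner_Integration.integral_cong refl) (simp add: complex_norm_square mult.assoc del: of_real_power)
  then show "complex_of_real (\<integral>\<xi>. (cmod (?F \<xi>))\<^sup>2 * gauss e \<xi> \<partial>lborel)
      = (\<integral>x. f x * cnj (\<integral>y. f y * of_real (gauss_kernel e (y - x)) \<partial>lborel) \<partial>lborel)"
    by (simp only: integral_inv_fourier_mult[OF f int] inner)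
qed

lemma plancherel_gauss_le:
  fixes f :: "'a::euclidean_space \<Rightarrow> complex"
  assumes f: "integrable lborel f" and e: "0 < e"
  shows "(\<integral>\<^sup>+\<xi>. ennreal ((cmod (inv_fourier f \<xi>))\<^sup>2 * gauss e \<xi>) \<partial>lborel)
     \<le> ennreal ((2 * pi) ^ DIM('a)) * (\<integral>\<^sup>+x. ennreal ((cmod (f x))\<^sup>2) \<partial>lborel)"
proof -
  let ?k = "\<lambda>x y :: 'a. ennreal (gauss_kernel e (y - x))"
  have [measurable]: "f \<in> borel_measurable borel" using f by auto
  have "(\<integral>\<^sup>+\<xi>. ennreal ((cmod (inv_fourier f \<xi>))\<^sup>2 * gauss e \<xi>) \<partial>lborel)
      = ennreal (\<integral>\<xi>. (cmod (inv_fourier f \<xi>))\<^sup>2 * gauss e \<xi> \<partial>lborel)"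
    by (intro nn_integral_eq_integral integral_norm_inv_fourier_square_gauss(1) f e) auto
  also have "\<dots> \<le> ennreal (cmod (complex_of_real (\<integral>\<xi>. (cmod (inv_fourier f \<xi>))\<^sup>2 * gauss e \<xi> \<partial>lborel)))"
    by (intro ennreal_leI) simp
  also have "\<dots> \<le> (\<integral>\<^sup>+x. ennreal (cmod (f x * cnj (\<integral>y. f y * of_real (gauss_kernel e (y - x)) \<partial>lborel))) \<partial>lborel)"
    unfolding integral_norm_inv_fourier_square_gauss(2)[OF f e] by (rule norm_integral_le_nn_integral)
  also have "\<dots> \<le> (\<integral>\<^sup>+x. ennreal (cmod (f x)) * (\<integral>\<^sup>+y. ennreal (cmod (f y)) * ?k x y \<partial>lborel) \<partial>lborel)"
  proof (intro nn_integral_mono)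
    fix x
    have "ennreal (cmod (\<integral>y. f y * of_real (gauss_kernel e (y - x)) \<partial>lborel))
        \<le> (\<integral>\<^sup>+y. ennreal (cmod (f y * of_real (gauss_kernel e (y - x)))) \<partial>lborel)"
      by (rule norm_integral_le_nn_integral)
    also have "\<dots> = (\<integral>\<^sup>+y. ennreal (cmod (f y)) * ?k x y \<partial>lborel)"
      using e by (simp add: norm_mult ennreal_mult gauss_kernel_nonneg)
    finally show "ennreal (cmod (f x * cnj (\<integral>y. f y * of_real (gauss_kernel e (y - x)) \<partial>lborel)))
        \<le> ennreal (cmod (f x)) * (\<integral>\<^sup>+y. ennreal (cmod (f y)) * ?k x y \<partial>lborel)"
      by (simp add: norm_mult ennreal_mult mult_left_mono)
  qed
  also have "\<dots> = (\<integral>\<^sup>+x. (\<integral>\<^sup>+y. ennreal (cmod (f x)) * ennreal (cmod (f y)) * ?k x y \<partial>lborel) \<partial>lborel)"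
    by (simp add: nn_integral_cmult mult.assoc)
  also have "\<dots> \<le> ennreal ((2 * pi) ^ DIM('a)) * (\<integral>\<^sup>+x. (ennreal (cmod (f x)))\<^sup>2 \<partial>lborel)"
  proof (rule Schur_test_symmetric_kernel[OF sigma_finite_lborel])
    show "?k x y = ?k y x" for x y by (simp only: gauss_kernel_commute[of e y x])
    show "(\<integral>\<^sup>+y. ?k x y \<partial>lborel) \<le> ennreal ((2 * pi) ^ DIM('a))" for x
      by (simp only: nn_integral_gauss_kernel[OF e])
  qed measurable
  finally show ?thesis by (simp add: ennreal_power)
qed

lemma plancherel_le:
  fixes f :: "'a::euclidean_space \<Rightarrow> complex"
  assumes f: "integrable lborel f"
  shows "(\<integral>\<^sup>+\<xi>. ennreal ((cmod (inv_fourier f \<xi>))\<^sup>2) \<partial>lborel)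
     \<le> ennreal ((2 * pi) ^ DIM('a)) * (\<integral>\<^sup>+x. ennreal ((cmod (f x))\<^sup>2) \<partial>lborel)" (is "_ \<le> ?C")
proof -
  have [measurable]: "inv_fourier f \<in> borel_measurable borel"
    by (rule borel_measurable_inv_fourier) (use f in auto)
  define u where "u n \<xi> = ennreal ((cmod (inv_fourier f \<xi>))\<^sup>2 * gauss (1 / real (Suc n)) \<xi>)" for n \<xi>
  have "(\<lambda>n. u n \<xi>) \<longlonglongrightarrow> ennreal ((cmod (inv_fourier f \<xi>))\<^sup>2 * 1)" for \<xi>
    unfolding u_def by (intro tendsto_ennrealI tendsto_mult tendsto_const tendsto_gauss_1)
  then have "liminf (\<lambda>n. u n \<xi>) = ennreal ((cmod (inv_fourier f \<xi>))\<^sup>2)" for \<xi>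
    by (intro lim_imp_Liminf) auto
  then have "(\<integral>\<^sup>+\<xi>. ennreal ((cmod (inv_fourier f \<xi>))\<^sup>2) \<partial>lborel)
      = (\<integral>\<^sup>+\<xi>. liminf (\<lambda>n. u n \<xi>) \<partial>lborel)" by simp
  also have "\<dots> \<le> liminf (\<lambda>n. \<integral>\<^sup>+\<xi>. u n \<xi> \<partial>lborel)"
    by (rule nn_integral_liminf) (simp add: u_def[abs_def])
  also have "\<dots> \<le> limsup (\<lambda>n. \<integral>\<^sup>+\<xi>. u n \<xi> \<partial>lborel)" by (rule Liminf_le_Limsup) simp
  also have "\<dots> \<le> ?C"
    unfolding u_def by (intro Limsup_bounded always_eventually allI plancherel_gauss_le f) simp
  finally show ?thesis .
qed

section \<open>Pairing a function with the Fourier transform of a test function\<close>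

definition superlevel :: "'a measure \<Rightarrow> ('a \<Rightarrow> complex) \<Rightarrow> real \<Rightarrow> 'a set" where
  "superlevel M g t = {x \<in> space M. t < cmod (g x)}"

definition tail_energy :: "'a measure \<Rightarrow> ('a \<Rightarrow> complex) \<Rightarrow> real \<Rightarrow> ennreal" where
  "tail_energy M g t = (\<integral>\<^sup>+x. ennreal ((cmod (g x))\<^sup>2) * indicator (superlevel M g t) x \<partial>M)"

lemma sets_superlevel [measurable]: "g \<in> borel_measurable M \<Longrightarrow> superlevel M g t \<in> sets M"
  unfolding superlevel_def by measurable

lemma ennreal_le_of_power2_le:
  assumes "x\<^sup>2 \<le> ennreal (y\<^sup>2)" "0 \<le> y"
  shows "x \<le> ennreal y"
proof (cases x)
  case (real r)
  then have "r\<^sup>2 \<le> y\<^sup>2" using assms by (simp add: ennreal_power)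
  then show ?thesis using real assms by (auto intro: ennreal_leI power2_le_imp_le)
qed (use assms in \<open>auto simp: top_unique\<close>)

lemma Cauchy_Schwarz_nn_integral_le:
  assumes [measurable]: "f \<in> borel_measurable M" "g \<in> borel_measurable M"
    and "(\<integral>\<^sup>+x. f x ^ 2 \<partial>M) \<le> ennreal (a\<^sup>2)" "(\<integral>\<^sup>+x. g x ^ 2 \<partial>M) \<le> ennreal (b\<^sup>2)" "0 \<le> a" "0 \<le> b"
  shows "(\<integral>\<^sup>+x. f x * g x \<partial>M) \<le> ennreal (a * b)"
proof (rule ennreal_le_of_power2_le)
  have "(\<integral>\<^sup>+x. f x * g x \<partial>M)\<^sup>2 \<le> (\<integral>\<^sup>+x. f x ^ 2 \<partial>M) * (\<integral>\<^sup>+x. g x ^ 2 \<partial>M)"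
    by (rule Cauchy_Schwarz_nn_integral) auto
  also have "\<dots> \<le> ennreal (a\<^sup>2) * ennreal (b\<^sup>2)" by (intro mult_mono assms) auto
  also have "\<dots> = ennreal ((a * b)\<^sup>2)" by (simp add: ennreal_mult power_mult_distrib)
  finally show "(\<integral>\<^sup>+x. f x * g x \<partial>M)\<^sup>2 \<le> ennreal ((a * b)\<^sup>2)" .
qed (use assms in auto)

lemma plancherel_mixed_deriv_op_le:
  fixes f :: "'a::euclidean_space \<Rightarrow> complex"
  assumes f: "test_fun f" and bs: "distinct bs" "set bs = Basis"
    and V: "(\<integral>\<^sup>+x. ennreal ((cmod (mixed_deriv_op s bs f x))\<^sup>2) \<partial>lborel) \<le> ennreal (V\<^sup>2)"
  shows "(\<integral>\<^sup>+\<xi>. ennreal (sqrt (cauchy_weight s \<xi>) * cmod (inv_fourier f \<xi>)) ^ 2 \<partial>lborel)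
    \<le> ennreal ((sqrt ((2 * pi) ^ DIM('a)) * V)\<^sup>2)"
proof -
  have "(\<integral>\<^sup>+\<xi>. ennreal (sqrt (cauchy_weight s \<xi>) * cmod (inv_fourier f \<xi>)) ^ 2 \<partial>lborel)
      = (\<integral>\<^sup>+\<xi>. ennreal ((cmod (inv_fourier (mixed_deriv_op s bs f) \<xi>))\<^sup>2) \<partial>lborel)"
    unfolding norm_inv_fourier_mixed_deriv_op[OF f bs, symmetric] by (simp add: ennreal_power)
  also have "\<dots> \<le> ennreal ((2 * pi) ^ DIM('a)) * (\<integral>\<^sup>+x. ennreal ((cmod (mixed_deriv_op s bs f x))\<^sup>2) \<partial>lborel)"
    by (intro plancherel_le test_fun_integrable test_fun_mixed_deriv_op f)
  also have "\<dots> \<le> ennreal ((2 * pi) ^ DIM('a)) * ennreal (V\<^sup>2)" by (intro mult_left_mono V) auto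
  also have "\<dots> = ennreal ((sqrt ((2 * pi) ^ DIM('a)) * V)\<^sup>2)"
    by (simp add: ennreal_mult power_mult_distrib)
  finally show ?thesis .
qed

lemma nn_integral_norm_inv_fourier_le:
  fixes f :: "'a::euclidean_space \<Rightarrow> complex"
  assumes f: "test_fun f" and s: "0 < s" and bs: "distinct bs" "set bs = Basis" and V: "0 \<le> V"
    "(\<integral>\<^sup>+x. ennreal ((cmod (mixed_deriv_op s bs f x))\<^sup>2) \<partial>lborel) \<le> ennreal (V\<^sup>2)"
  shows "(\<integral>\<^sup>+\<xi>. ennreal (cmod (inv_fourier f \<xi>)) \<partial>lborel)
    \<le> ennreal (sqrt ((pi / s) ^ DIM('a)) * (sqrt ((2 * pi) ^ DIM('a)) * V))"
proof -
  have [measurable]: "inv_fourier f \<in> borel_measurable borel"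
    using f by (intro borel_measurable_inv_fourier test_fun_borel)
  have "(\<integral>\<^sup>+\<xi>. ennreal (cmod (inv_fourier f \<xi>)) \<partial>lborel)
      = (\<integral>\<^sup>+\<xi>. ennreal (sqrt (1 / cauchy_weight s \<xi>)) * ennreal (sqrt (cauchy_weight s \<xi>) * cmod (inv_fourier f \<xi>)) \<partial>lborel)"
  proof (intro nn_integral_cong)
    fix \<xi> :: 'a
    have "sqrt (1 / cauchy_weight s \<xi>) * sqrt (cauchy_weight s \<xi>) = 1"
      using cauchy_weight_pos[of s \<xi>] by (simp add: real_sqrt_divide)
    then show "ennreal (cmod (inv_fourier f \<xi>))
        = ennreal (sqrt (1 / cauchy_weight s \<xi>)) * ennreal (sqrt (cauchy_weight s \<xi>) * cmod (inv_fourier f \<xi>))"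
      using cauchy_weight_pos[of s \<xi>] by (simp add: ennreal_mult'[symmetric] mult.assoc[symmetric])
  qed
  also have "\<dots> \<le> ennreal (sqrt ((pi / s) ^ DIM('a)) * (sqrt ((2 * pi) ^ DIM('a)) * V))"
  proof (rule Cauchy_Schwarz_nn_integral_le[OF _ _ _ plancherel_mixed_deriv_op_le[OF f bs V(2)]])
    have "(sqrt (1 / cauchy_weight s \<xi>))\<^sup>2 = 1 / cauchy_weight s \<xi>" for \<xi> :: 'a
      using cauchy_weight_pos[of s \<xi>] by simp
    then show "(\<integral>\<^sup>+\<xi>. ennreal (sqrt (1 / cauchy_weight s \<xi>)) ^ 2 \<partial>(lborel :: 'a measure))
        \<le> ennreal ((sqrt ((pi / s) ^ DIM('a)))\<^sup>2)"
      using s less_imp_le[OF cauchy_weight_pos]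
      by (simp add: ennreal_power nn_integral_inverse_cauchy_weight[OF s])
  qed (use s V in auto)
  finally show ?thesis .
qed

lemma nn_integral_mult_split_superlevel_le:
  assumes t: "0 \<le> t" and [measurable]: "g \<in> borel_measurable M" "f \<in> borel_measurable M"
  shows "(\<integral>\<^sup>+x. ennreal (cmod (g x) * cmod (f x)) \<partial>M)
    \<le> (\<integral>\<^sup>+x. (ennreal (cmod (g x)) * indicator (superlevel M g t) x) * ennreal (cmod (f x)) \<partial>M)
      + ennreal t * (\<integral>\<^sup>+x. ennreal (cmod (f x)) \<partial>M)"
proof -
  let ?I = "indicator (superlevel M g t) :: 'a \<Rightarrow> ennreal"
  have "(\<integral>\<^sup>+x. ennreal (cmod (g x) * cmod (f x)) \<partial>M)
      \<le> (\<integral>\<^sup>+x. (ennreal (cmod (g x)) * ?I x) * ennreal (cmod (f x)) + ennreal t * ennreal (cmod (f x)) \<partial>M)"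
  proof (rule nn_integral_mono)
    fix x assume "x \<in> space M"
    then show "ennreal (cmod (g x) * cmod (f x))
        \<le> (ennreal (cmod (g x)) * ?I x) * ennreal (cmod (f x)) + ennreal t * ennreal (cmod (f x))"
      using t by (cases "t < cmod (g x)")
        (auto simp: superlevel_def ennreal_mult'[symmetric] not_less intro!: add_increasing2 ennreal_leI mult_right_mono)
  qed
  also have "\<dots> = (\<integral>\<^sup>+x. (ennreal (cmod (g x)) * ?I x) * ennreal (cmod (f x)) \<partial>M)
      + ennreal t * (\<integral>\<^sup>+x. ennreal (cmod (f x)) \<partial>M)"
    by (simp add: nn_integral_add nn_integral_cmult)
  finally show ?thesis .
qed

text \<open>Where g is large, use the Plancherel inequality; where it is small, the bound on the
  integral of the Fourier transform.\<close>

lemma inv_fourier_pairing_le: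
  fixes g f :: "'a::euclidean_space \<Rightarrow> complex"
  assumes g [measurable]: "g \<in> borel_measurable borel" and f: "test_fun f"
    and s: "0 < s" and t: "0 \<le> t" and G: "0 \<le> G" "tail_energy lborel g t \<le> ennreal (G\<^sup>2)"
    and bs: "distinct bs" "set bs = Basis" and V: "0 \<le> V"
    "(\<integral>\<^sup>+x. ennreal ((cmod (mixed_deriv_op s bs f x))\<^sup>2) \<partial>lborel) \<le> ennreal (V\<^sup>2)"
  shows "(\<integral>\<^sup>+\<xi>. ennreal (cmod (g \<xi>) * cmod (inv_fourier f \<xi>)) \<partial>lborel)
    \<le> ennreal (sqrt ((2 * pi) ^ DIM('a)) * (G + t * sqrt ((pi / s) ^ DIM('a))) * V)"
proof -
  let ?F = "inv_fourier f" and ?I = "indicator (superlevel lborel g t) :: 'a \<Rightarrow> ennreal"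
  let ?c = "sqrt ((2 * pi) ^ DIM('a))" and ?r = "sqrt ((pi / s) ^ DIM('a))"
  have [measurable]: "?F \<in> borel_measurable borel"
    using f by (intro borel_measurable_inv_fourier test_fun_borel)
  have large: "(\<integral>\<^sup>+\<xi>. (ennreal (cmod (g \<xi>)) * ?I \<xi>) * ennreal (cmod (?F \<xi>)) \<partial>lborel)
      \<le> ennreal (G * (?c * V))"
  proof (rule Cauchy_Schwarz_nn_integral_le)
    have "(ennreal (cmod (g \<xi>)) * ?I \<xi>) ^ 2 = ennreal ((cmod (g \<xi>))\<^sup>2) * ?I \<xi>" for \<xi>
      by (auto simp: power_mult_distrib ennreal_power indicator_def)
    then show "(\<integral>\<^sup>+\<xi>. (ennreal (cmod (g \<xi>)) * ?I \<xi>) ^ 2 \<partial>lborel) \<le> ennreal (G\<^sup>2)"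
      using G(2) by (simp add: tail_energy_def)
    have "cmod (?F \<xi>) \<le> sqrt (cauchy_weight s \<xi>) * cmod (?F \<xi>)" for \<xi>
      using mult_right_mono[of 1 "sqrt (cauchy_weight s \<xi>)" "cmod (?F \<xi>)"] cauchy_weight_ge_1[of s \<xi>] by simp
    then have "(\<integral>\<^sup>+\<xi>. ennreal (cmod (?F \<xi>)) ^ 2 \<partial>lborel)
        \<le> (\<integral>\<^sup>+\<xi>. ennreal (sqrt (cauchy_weight s \<xi>) * cmod (?F \<xi>)) ^ 2 \<partial>lborel)"
      by (intro nn_integral_mono power_mono ennreal_leI) auto
    then show "(\<integral>\<^sup>+\<xi>. ennreal (cmod (?F \<xi>)) ^ 2 \<partial>lborel) \<le> ennreal ((?c * V)\<^sup>2)"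
      using plancherel_mixed_deriv_op_le[OF f bs V(2)] by (rule order_trans)
  qed (use G V in auto)
  have "ennreal t * (\<integral>\<^sup>+\<xi>. ennreal (cmod (?F \<xi>)) \<partial>lborel) \<le> ennreal t * ennreal (?r * (?c * V))"
    by (intro mult_left_mono nn_integral_norm_inv_fourier_le[OF f s bs V]) auto
  then have small: "ennreal t * (\<integral>\<^sup>+\<xi>. ennreal (cmod (?F \<xi>)) \<partial>lborel) \<le> ennreal (t * (?r * (?c * V)))"
    using t s V by (simp add: ennreal_mult')
  have "(\<integral>\<^sup>+\<xi>. ennreal (cmod (g \<xi>) * cmod (?F \<xi>)) \<partial>lborel)
      \<le> (\<integral>\<^sup>+\<xi>. (ennreal (cmod (g \<xi>)) * ?I \<xi>) * ennreal (cmod (?F \<xi>)) \<partial>lborel)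
        + ennreal t * (\<integral>\<^sup>+\<xi>. ennreal (cmod (?F \<xi>)) \<partial>lborel)"
    by (intro nn_integral_mult_split_superlevel_le t) auto
  also have "\<dots> \<le> ennreal (G * (?c * V)) + ennreal (t * (?r * (?c * V)))"
    by (intro add_mono large small)
  also have "\<dots> = ennreal (?c * (G + t * ?r) * V)"
    using G V t s by (simp add: ennreal_plus[symmetric] algebra_simps del: ennreal_plus)
  finally show ?thesis .
qed

lemma test_fun_square_integrable:
  assumes "test_fun f"
  obtains V where "0 \<le> V" "(\<integral>\<^sup>+x. ennreal ((cmod (f x))\<^sup>2) \<partial>lborel) = ennreal (V\<^sup>2)"
proof
  let ?A = "\<integral>x. (cmod (f x))\<^sup>2 \<partial>lborel"
  have "integrable lborel (\<lambda>x. (cmod (f x))\<^sup>2)"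
    using assms
    by (intro integrable_continuous_bounded_support continuous_intros test_fun_continuous_on)
       (simp_all add: test_fun_def)
  then have "(\<integral>\<^sup>+x. ennreal ((cmod (f x))\<^sup>2) \<partial>lborel) = ennreal ?A"
    by (intro nn_integral_eq_integral) auto
  moreover have "0 \<le> ?A" by (intro integral_nonneg_AE) auto
  ultimately show "(\<integral>\<^sup>+x. ennreal ((cmod (f x))\<^sup>2) \<partial>lborel) = ennreal ((sqrt ?A)\<^sup>2)"
    "0 \<le> sqrt ?A" by auto
qed

lemma integrable_inv_fourier_test_fun:
  fixes f :: "'a::euclidean_space \<Rightarrow> complex"
  assumes f: "test_fun f"
  shows "integrable lborel (inv_fourier f)"
proof (rule integrableI_bounded)
  obtain bs :: "'a list" where bs: "distinct bs" "set bs = Basis"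
    using finite_distinct_list[of Basis] by auto
  obtain V where "0 \<le> V" "(\<integral>\<^sup>+x. ennreal ((cmod (mixed_deriv_op 1 bs f x))\<^sup>2) \<partial>lborel) = ennreal (V\<^sup>2)"
    using test_fun_square_integrable[OF test_fun_mixed_deriv_op[OF f]] by blast
  from nn_integral_norm_inv_fourier_le[OF f zero_less_one bs this(1) eq_refl[OF this(2)]]
  show "(\<integral>\<^sup>+\<xi>. ennreal (cmod (inv_fourier f \<xi>)) \<partial>lborel) < \<infinity>"
    by (rule le_less_trans) simp
  show "inv_fourier f \<in> borel_measurable lborel"
    using f by (simp add: borel_measurable_inv_fourier test_fun_borel)
qed

lemma integrable_mult_inv_fourier:
  fixes g f :: "'a::euclidean_space \<Rightarrow> complex"
  assumes g [measurable]: "g \<in> borel_measurable borel" and f: "test_fun f"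
    and t: "0 \<le> t" "tail_energy lborel g t < \<infinity>"
  shows "integrable lborel (\<lambda>\<xi>. g \<xi> * inv_fourier f \<xi>)"
proof (rule integrableI_bounded)
  obtain E where E: "0 \<le> E" "tail_energy lborel g t = ennreal E"
    using t(2) by (cases "tail_energy lborel g t") auto
  then have G: "0 \<le> sqrt E" "tail_energy lborel g t \<le> ennreal ((sqrt E)\<^sup>2)" by auto
  obtain bs :: "'a list" where bs: "distinct bs" "set bs = Basis"
    using finite_distinct_list[of Basis] by auto
  obtain V where V: "0 \<le> V"
    "(\<integral>\<^sup>+x. ennreal ((cmod (mixed_deriv_op 1 bs f x))\<^sup>2) \<partial>lborel) = ennreal (V\<^sup>2)"
    using test_fun_square_integrable[OF test_fun_mixed_deriv_op[OF f]] by blast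
  from inv_fourier_pairing_le[OF g f zero_less_one t(1) G bs V(1) eq_refl[OF V(2)]]
  show "(\<integral>\<^sup>+\<xi>. ennreal (norm (g \<xi> * inv_fourier f \<xi>)) \<partial>lborel) < \<infinity>"
    unfolding norm_mult by (rule le_less_trans) simp
  have [measurable]: "inv_fourier f \<in> borel_measurable borel"
    by (intro borel_measurable_inv_fourier test_fun_borel f)
  show "(\<lambda>\<xi>. g \<xi> * inv_fourier f \<xi>) \<in> borel_measurable lborel" by measurable
qed

section \<open>Functions annihilating all Fourier transforms of test functions\<close>

definition uniformly_locally_integrable :: "('a::euclidean_space \<Rightarrow> complex) \<Rightarrow> bool" where
  "uniformly_locally_integrable g \<longleftrightarrow> g \<in> borel_measurable borel \<and>
    (\<forall>A\<in>sets borel. bounded A \<longrightarrow>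
      (\<exists>m\<ge>0. \<forall>z. (\<integral>\<^sup>+x. ennreal (norm (indicator A x *\<^sub>R g (x + z))) \<partial>lborel) \<le> ennreal m))"

lemma uniformly_locally_integrable_borel: "uniformly_locally_integrable g \<Longrightarrow> g \<in> borel_measurable borel"
  by (simp add: uniformly_locally_integrable_def)

lemma norm_le_add_superlevel_square:
  assumes "0 \<le> t" "x \<in> space M"
  shows "ennreal (cmod (g x)) \<le> ennreal (t + 1) + ennreal ((cmod (g x))\<^sup>2) * indicator (superlevel M g t) x"
proof (cases "t < cmod (g x)")
  case True
  have "2 * cmod (g x) \<le> (cmod (g x))\<^sup>2 + 1" using sum_squares_bound[of "cmod (g x)" 1] by simp
  then have "cmod (g x) \<le> t + 1 + (cmod (g x))\<^sup>2"
    using assms(1) zero_le_power2[of "cmod (g x)"] by linarith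
  then show ?thesis
    using True assms by (simp add: superlevel_def ennreal_plus[symmetric] ennreal_leI del: ennreal_plus)
next
  case False
  then have "cmod (g x) \<le> t + 1" by simp
  then show ?thesis by (rule add_increasing2[OF zero_le ennreal_leI])
qed

lemma uniformly_locally_integrable_tail_energy:
  fixes g :: "'a::euclidean_space \<Rightarrow> complex"
  assumes g [measurable]: "g \<in> borel_measurable borel" and t: "0 \<le> t" "tail_energy lborel g t < \<infinity>"
  shows "uniformly_locally_integrable g"
  unfolding uniformly_locally_integrable_def
proof (intro conjI ballI impI g)
  fix A :: "'a set" assume [measurable]: "A \<in> sets borel" and "bounded A"
  then have finite: "emeasure lborel A < \<infinity>" by (intro emeasure_bounded_finite)
  let ?h = "\<lambda>\<xi>. ennreal ((cmod (g \<xi>))\<^sup>2) * indicator (superlevel lborel g t) \<xi>"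
  obtain E where E: "0 \<le> E" "tail_energy lborel g t = ennreal E"
    using t(2) by (cases "tail_energy lborel g t") auto
  have "(\<integral>\<^sup>+x. ennreal (norm (indicator A x *\<^sub>R g (x + z))) \<partial>lborel)
      \<le> ennreal ((t + 1) * measure lborel A + E)" for z
  proof -
    have "(\<integral>\<^sup>+x. ennreal (norm (indicator A x *\<^sub>R g (x + z))) \<partial>lborel)
        \<le> (\<integral>\<^sup>+x. ennreal (t + 1) * indicator A x + ?h (x + z) \<partial>lborel)"
    proof (intro nn_integral_mono)
      show "ennreal (norm (indicator A x *\<^sub>R g (x + z)))
          \<le> ennreal (t + 1) * indicator A x + ?h (x + z)" for x
        using norm_le_add_superlevel_square[OF t(1), of "x + z" lborel g] by (cases "x \<in> A") simp_all
    qed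
    also have "\<dots> = ennreal (t + 1) * emeasure lborel A + (\<integral>\<^sup>+x. ?h (x + z) \<partial>lborel)"
      by (simp add: nn_integral_add nn_integral_cmult_indicator)
    also have "(\<integral>\<^sup>+x. ?h (x + z) \<partial>lborel) = ennreal E"
      using nn_integral_lborel_translate[of ?h z] E by (simp add: tail_energy_def)
    also have "ennreal (t + 1) * emeasure lborel A + ennreal E
        = ennreal ((t + 1) * measure lborel A + E)"
      using finite t E by (simp add: emeasure_eq_ennreal_measure ennreal_mult ennreal_plus)
    finally show ?thesis .
  qed
  then show "\<exists>m\<ge>0. \<forall>z. (\<integral>\<^sup>+x. ennreal (norm (indicator A x *\<^sub>R g (x + z))) \<partial>lborel) \<le> ennreal m"
    using t E by (intro exI[of _ "(t + 1) * measure lborel A + E"]) auto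
qed

lemma set_integrable_translate:
  assumes g: "uniformly_locally_integrable g" and [measurable]: "A \<in> sets borel" and "bounded A"
  shows "set_integrable lborel A (\<lambda>x. g (x + z))"
  unfolding set_integrable_def
proof (rule integrableI_bounded)
  obtain m where "(\<integral>\<^sup>+x. ennreal (norm (indicator A x *\<^sub>R g (x + z))) \<partial>lborel) \<le> ennreal m"
    using assms unfolding uniformly_locally_integrable_def by blast
  then show "(\<integral>\<^sup>+x. ennreal (norm (indicator A x *\<^sub>R g (x + z))) \<partial>lborel) < \<infinity>"
    by (rule le_less_trans) simp
  have [measurable]: "g \<in> borel_measurable borel" by (rule uniformly_locally_integrable_borel[OF g])
  show "(\<lambda>x. indicator A x *\<^sub>R g (x + z)) \<in> borel_measurable lborel" by measurable
qed

lemma set_integral_norm_translate_bounded: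
  assumes g: "uniformly_locally_integrable g" and A: "A \<in> sets borel" "bounded A"
  obtains m where "0 \<le> m" "\<And>z. (\<integral>x. norm (indicator A x *\<^sub>R g (x + z)) \<partial>lborel) \<le> m"
proof -
  obtain m where m: "0 \<le> m"
    "\<And>z. (\<integral>\<^sup>+x. ennreal (norm (indicator A x *\<^sub>R g (x + z))) \<partial>lborel) \<le> ennreal m"
    using assms unfolding uniformly_locally_integrable_def by blast
  have "(\<integral>x. norm (indicator A x *\<^sub>R g (x + z)) \<partial>lborel) \<le> m" for z
  proof -
    have "ennreal (\<integral>x. norm (indicator A x *\<^sub>R g (x + z)) \<partial>lborel)
        = (\<integral>\<^sup>+x. ennreal (norm (indicator A x *\<^sub>R g (x + z))) \<partial>lborel)"
      using set_integrable_translate[OF g A, of z] unfolding set_integrable_def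
      by (intro nn_integral_eq_integral[symmetric] integrable_norm) auto
    also have "\<dots> \<le> ennreal m" by (rule m)
    finally show ?thesis using m(1) by simp
  qed
  then show ?thesis using m(1) by (rule that[rotated])
qed

lemma integral_mult_set_integral_translate:
  fixes g K :: "'a::euclidean_space \<Rightarrow> complex"
  assumes g: "uniformly_locally_integrable g" and K: "integrable lborel K"
    and A: "A \<in> sets borel" "bounded A"
  shows "(\<integral>u. K u * (LINT \<eta>:A|lborel. g (\<eta> + e *\<^sub>R u)) \<partial>lborel)
    = (LINT \<eta>:A|lborel. (\<integral>u. g (\<eta> + e *\<^sub>R u) * K u \<partial>lborel))"
proof -
  have [measurable]: "g \<in> borel_measurable borel" "K \<in> borel_measurable borel" "A \<in> sets borel"
    using uniformly_locally_integrable_borel[OF g] K A by auto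
  obtain m where m: "0 \<le> m" "\<And>z. (\<integral>x. norm (indicator A x *\<^sub>R g (x + z)) \<partial>lborel) \<le> m"
    using set_integral_norm_translate_bounded[OF g A] by blast
  let ?h = "\<lambda>u \<eta>. K u * (indicator A \<eta> *\<^sub>R g (\<eta> + e *\<^sub>R u))"
  have "integrable (lborel \<Otimes>\<^sub>M lborel) (\<lambda>(u, \<eta>). ?h u \<eta>)"
  proof (rule lborel_pair.Fubini_integrable)
    show "integrable lborel (\<lambda>u. \<integral>\<eta>. norm (case (u, \<eta>) of (u, \<eta>) \<Rightarrow> ?h u \<eta>) \<partial>lborel)"
    proof (rule Bochner_Integration.integrable_bound)
      show "integrable lborel (\<lambda>u. cmod (K u) * m)" using K by simp
      show "AE u in lborel. norm (\<integral>\<eta>. norm (case (u, \<eta>) of (u, \<eta>) \<Rightarrow> ?h u \<eta>) \<partial>lborel)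
          \<le> norm (cmod (K u) * m)"
      proof (rule AE_I2)
        fix u
        have "(\<integral>\<eta>. norm (?h u \<eta>) \<partial>lborel)
            = cmod (K u) * (\<integral>\<eta>. norm (indicator A \<eta> *\<^sub>R g (\<eta> + e *\<^sub>R u)) \<partial>lborel)"
          unfolding norm_mult by (rule integral_mult_right_zero)
        also have "\<dots> \<le> cmod (K u) * m" by (intro mult_left_mono m) auto
        finally show "norm (\<integral>\<eta>. norm (case (u, \<eta>) of (u, \<eta>) \<Rightarrow> ?h u \<eta>) \<partial>lborel) \<le> norm (cmod (K u) * m)"
          using m(1) by simp
      qed
    qed measurable
    show "AE u in lborel. integrable lborel (\<lambda>\<eta>. case (u, \<eta>) of (u, \<eta>) \<Rightarrow> ?h u \<eta>)"
      using set_integrable_translate[OF g A] unfolding set_integrable_def prod.case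
      by (intro AE_I2 integrable_mult_right)
  qed measurable
  from lborel_pair.Fubini_integral[OF this]
  have "(\<integral>\<eta>. (\<integral>u. ?h u \<eta> \<partial>lborel) \<partial>lborel) = (\<integral>u. (\<integral>\<eta>. ?h u \<eta> \<partial>lborel) \<partial>lborel)" .
  moreover have "(\<integral>\<eta>. ?h u \<eta> \<partial>lborel) = K u * (LINT \<eta>:A|lborel. g (\<eta> + e *\<^sub>R u))" for u
    unfolding set_lebesgue_integral_def by (rule integral_mult_right_zero)
  moreover have "(\<integral>u. ?h u \<eta> \<partial>lborel) = indicator A \<eta> *\<^sub>R (\<integral>u. g (\<eta> + e *\<^sub>R u) * K u \<partial>lborel)" for \<eta>
    by (simp add: mult.commute)
  ultimately show ?thesis by (simp only: set_lebesgue_integral_def)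
qed

lemma AE_tendsto_indicator_box_translate:
  fixes z :: "nat \<Rightarrow> 'a::euclidean_space"
  assumes z: "z \<longlonglongrightarrow> 0"
  shows "AE \<xi> in lborel. (\<lambda>n. indicator (box a b) (\<xi> - z n)) \<longlonglongrightarrow> (indicator (box a b) \<xi> :: real)"
proof -
  have "cbox a b - box a b \<in> null_sets lborel"
    using emeasure_lborel_cbox_eq[of a b] emeasure_lborel_box_eq[of a b] box_subset_cbox[of a b]
    by (auto simp: null_sets_def emeasure_Diff)
  then have "AE \<xi> in lborel. \<xi> \<notin> cbox a b - box a b" by (rule AE_not_in)
  then show ?thesis
  proof eventually_elim
    case (elim \<xi>)
    have lim: "(\<lambda>n. \<xi> - z n) \<longlonglongrightarrow> \<xi>" using tendsto_diff[OF tendsto_const z, of \<xi>] by simp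
    have "\<forall>\<^sub>F n in sequentially. \<xi> - z n \<in> box a b \<longleftrightarrow> \<xi> \<in> box a b"
    proof (cases "\<xi> \<in> box a b")
      case True
      from topological_tendstoD[OF lim open_box this] show ?thesis by eventually_elim (simp add: True)
    next
      case False
      then have "\<xi> \<in> - cbox a b" using elim by auto
      from topological_tendstoD[OF lim _ this] show ?thesis
        using False box_subset_cbox by (auto simp: open_Compl closed_cbox elim!: eventually_mono)
    qed
    then have "\<forall>\<^sub>F n in sequentially. indicator (box a b) (\<xi> - z n) = (indicator (box a b) \<xi> :: real)"
      by eventually_elim (simp add: indicator_def)
    then show ?case by (rule tendsto_eventually)
  qed
qed

lemma tendsto_box_integral_translate:
  fixes g :: "'a::euclidean_space \<Rightarrow> complex"
  assumes g: "uniformly_locally_integrable g" and z: "z \<longlonglongrightarrow> 0"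
  shows "(\<lambda>n. LINT \<eta>:box a b|lborel. g (\<eta> + z n)) \<longlonglongrightarrow> (LINT \<eta>:box a b|lborel. g \<eta>)"
proof -
  have [measurable]: "g \<in> borel_measurable borel" by (rule uniformly_locally_integrable_borel[OF g])
  obtain R where R: "\<And>x. x \<in> box a b \<Longrightarrow> norm x \<le> R"
    using bounded_box[of a b] by (auto simp: bounded_iff)
  obtain r where r: "\<And>n. norm (z n) \<le> r"
    using convergent_imp_bounded[OF z] by (auto simp: bounded_iff)
  let ?C = "cball (0::'a) (R + r)"
  have "(\<lambda>n. \<integral>\<xi>. indicator (box a b) (\<xi> - z n) *\<^sub>R g \<xi> \<partial>lborel)
      \<longlonglongrightarrow> (\<integral>\<xi>. indicator (box a b) \<xi> *\<^sub>R g \<xi> \<partial>lborel)"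
  proof (rule integral_dominated_convergence)
    have "integrable lborel (\<lambda>\<xi>. indicator ?C \<xi> *\<^sub>R g (\<xi> + 0))"
      using set_integrable_translate[OF g, of ?C 0] unfolding set_integrable_def by simp
    then show "integrable lborel (\<lambda>\<xi>. norm (indicator ?C \<xi> *\<^sub>R g \<xi>))"
      by (simp only: add_0_right integrable_norm)
    show "AE \<xi> in lborel. norm (indicator (box a b) (\<xi> - z n) *\<^sub>R g \<xi>)
        \<le> norm (indicator ?C \<xi> *\<^sub>R g \<xi>)" for n
    proof (rule AE_I2)
      fix \<xi>
      have "norm \<xi> \<le> R + r" if "\<xi> - z n \<in> box a b"
        using norm_triangle_ineq[of "\<xi> - z n" "z n"] R[OF that] r[of n] by simp
      then show "norm (indicator (box a b) (\<xi> - z n) *\<^sub>R g \<xi>) \<le> norm (indicator ?C \<xi> *\<^sub>R g \<xi>)"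
        by (cases "\<xi> - z n \<in> box a b") auto
    qed
    show "AE \<xi> in lborel. (\<lambda>n. indicator (box a b) (\<xi> - z n) *\<^sub>R g \<xi>) \<longlonglongrightarrow> indicator (box a b) \<xi> *\<^sub>R g \<xi>"
      using AE_tendsto_indicator_box_translate[OF z, of a b]
      by eventually_elim (intro tendsto_scaleR tendsto_const)
  qed measurable
  moreover have "(\<integral>\<xi>. indicator (box a b) (\<xi> - z n) *\<^sub>R g \<xi> \<partial>lborel)
      = (LINT \<eta>:box a b|lborel. g (\<eta> + z n))" for n
    using integral_lborel_translate[of "\<lambda>\<xi>. indicator (box a b) (\<xi> - z n) *\<^sub>R g \<xi>" "z n"]
    by (simp add: set_lebesgue_integral_def)
  ultimately show ?thesis by (simp only: set_lebesgue_integral_def)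
qed

lemma AE_zero_of_dilated_averages:
  fixes g K :: "'a::euclidean_space \<Rightarrow> complex"
  assumes g: "uniformly_locally_integrable g" and K: "integrable lborel K" "(\<integral>u. K u \<partial>lborel) \<noteq> 0"
    and zero: "\<And>e \<eta>. 0 < e \<Longrightarrow> (\<integral>u. g (\<eta> + e *\<^sub>R u) * K u \<partial>lborel) = 0"
  shows "AE x in lborel. g x = 0"
proof (rule AE_zero_of_box_integrals)
  fix a b :: 'a
  show "set_integrable lborel (box a b) g"
    using set_integrable_translate[OF g, of "box a b" 0] by simp
  have [measurable]: "g \<in> borel_measurable borel" "K \<in> borel_measurable borel"
    using uniformly_locally_integrable_borel[OF g] K by auto
  define e where "e n = 1 / real (Suc n)" for n
  have e: "0 < e n" for n by (simp add: e_def)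
  have e_lim: "e \<longlonglongrightarrow> 0" unfolding e_def[abs_def] by (rule LIMSEQ_Suc[OF lim_1_over_n])
  define A where "A n u = (LINT \<eta>:box a b|lborel. g (\<eta> + e n *\<^sub>R u))" for n u
  obtain m where m: "\<And>z. (\<integral>x. norm (indicator (box a b) x *\<^sub>R g (x + z)) \<partial>lborel) \<le> m"
    using set_integral_norm_translate_bounded[OF g, of "box a b"] by auto
  have A_le: "cmod (A n u) \<le> m" for n u
    unfolding A_def set_lebesgue_integral_def by (rule order_trans[OF integral_norm_bound m])
  have [measurable]: "A n \<in> borel_measurable borel" for n
    unfolding A_def[abs_def] set_lebesgue_integral_def by measurable
  have "(\<integral>u. K u * A n u \<partial>lborel) = 0" for n
    using integral_mult_set_integral_translate[OF g K(1), of "box a b" "e n"] zero[OF e]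
    by (simp add: A_def set_lebesgue_integral_def)
  moreover have "(\<lambda>n. \<integral>u. K u * A n u \<partial>lborel) \<longlonglongrightarrow> (\<integral>u. K u * (LINT x:box a b|lborel. g x) \<partial>lborel)"
  proof (rule integral_dominated_convergence)
    show "integrable lborel (\<lambda>u. cmod (K u) * m)" using K by simp
    show "AE u in lborel. norm (K u * A n u) \<le> cmod (K u) * m" for n
      using A_le by (auto simp: norm_mult intro!: AE_I2 mult_left_mono)
    have "(\<lambda>n. e n *\<^sub>R u) \<longlonglongrightarrow> 0" for u :: 'a
      using tendsto_scaleR[OF e_lim tendsto_const[of u]] by simp
    then show "AE u in lborel. (\<lambda>n. K u * A n u) \<longlonglongrightarrow> K u * (LINT x:box a b|lborel. g x)"
      unfolding A_def by (intro AE_I2 tendsto_intros tendsto_box_integral_translate g)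
  qed measurable
  ultimately have "(\<integral>u. K u * (LINT x:box a b|lborel. g x) \<partial>lborel) = 0"
    by (simp add: LIMSEQ_const_iff)
  then have "(\<integral>u. K u \<partial>lborel) * (LINT x:box a b|lborel. g x)
      = 0" by (simp only: integral_mult_left_zero)
  then show "(LINT x:box a b|lborel. g x) = 0" using K(2) by simp
qed

lemma integral_inv_fourier_box_bump: "(\<integral>\<xi>. inv_fourier (box_bump 1 (\<lambda>_. 0)) \<xi> \<partial>(lborel :: 'a::euclidean_space measure)) \<noteq> 0"
proof -
  let ?\<chi> = "box_bump 1 (\<lambda>_. 0) :: 'a \<Rightarrow> complex"
  have test: "test_fun ?\<chi>" by (rule test_fun_box_bump) simp
  have "isCont ?\<chi> 0"
    using test_fun_continuous_on[OF test, of UNIV] by (simp add: continuous_on_eq_continuous_at)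
  then have "(\<integral>\<xi>. inv_fourier ?\<chi> \<xi> \<partial>lborel) = of_real ((2 * pi) ^ DIM('a)) * ?\<chi> 0"
    using test_fun_integrable[OF test] integrable_inv_fourier_test_fun[OF test]
    by (intro fourier_inversion_at_0[OF _ _ _ norm_box_bump_le_1])
  then show ?thesis by (simp add: box_bump_def)
qed

lemma inv_fourier_modulated_box_bump:
  fixes \<eta> \<xi> :: "'a::euclidean_space"
  assumes "0 < e"
  shows "test_fun (\<lambda>x::'a. box_bump e (\<lambda>_. 0) x * cis (- (x \<bullet> \<eta>)))"
    and "inv_fourier (\<lambda>x. box_bump e (\<lambda>_. 0) x * cis (- (x \<bullet> \<eta>))) (\<eta> + e *\<^sub>R \<xi>)
      = of_real ((1 / e) ^ DIM('a)) * inv_fourier (box_bump 1 (\<lambda>_. 0)) \<xi>"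
proof -
  have "smooth_fun (\<lambda>x. cis (- (x \<bullet> \<eta>)))"
    using smooth_fun_affine[OF bounded_linear_inner_left smooth_fun_cis, of "- \<eta>" 0] by simp
  then show test: "test_fun (\<lambda>x::'a. box_bump e (\<lambda>_. 0) x * cis (- (x \<bullet> \<eta>)))"
    by (intro test_fun_mult test_fun_box_bump assms)
  have [measurable]: "(box_bump 1 (\<lambda>_. 0) :: 'a \<Rightarrow> complex) \<in> borel_measurable borel"
    by (intro test_fun_borel test_fun_box_bump) simp
  let ?f = "\<lambda>x::'a. box_bump 1 (\<lambda>_. 0) x * cis (x \<bullet> \<xi>)"
  have "inv_fourier (\<lambda>x. box_bump e (\<lambda>_. 0) x * cis (- (x \<bullet> \<eta>))) (\<eta> + e *\<^sub>R \<xi>)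
      = (\<integral>x. ?f (0 + e *\<^sub>R x) \<partial>lborel)"
    unfolding inv_fourier_lborel[OF test_fun_borel[OF test]]
    by (intro Bochner_Integration.integral_cong refl)
       (simp add: box_bump_def cis_mult inner_add_right mult.assoc)
  moreover have "inv_fourier (box_bump 1 (\<lambda>_. 0)) \<xi> = (\<integral>x. ?f x \<partial>lborel)"
    by (rule inv_fourier_lborel) measurable
  moreover have "(\<integral>x. ?f x \<partial>lborel) = (\<bar>e\<bar> ^ DIM('a)) *\<^sub>R (\<integral>x. ?f (0 + e *\<^sub>R x) \<partial>lborel)"
    using assms by (intro integral_lborel_affine) auto
  ultimately show "inv_fourier (\<lambda>x. box_bump e (\<lambda>_. 0) x * cis (- (x \<bullet> \<eta>))) (\<eta> + e *\<^sub>R \<xi>)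
      = of_real ((1 / e) ^ DIM('a)) * inv_fourier (box_bump 1 (\<lambda>_. 0)) \<xi>"
    using assms by (simp add: scaleR_conv_of_real power_divide)
qed

text \<open>Modulated and dilated bumps turn the hypothesis into the vanishing of the averages of g
  against the dilates of an integrable kernel of nonzero mass.\<close>

lemma AE_zero_of_inv_fourier_pairings:
  fixes g :: "'a::euclidean_space \<Rightarrow> complex"
  assumes g: "uniformly_locally_integrable g"
    and zero: "\<And>\<psi>. test_fun \<psi> \<Longrightarrow> (\<integral>\<xi>. g \<xi> * inv_fourier \<psi> \<xi> \<partial>lborel) = 0"
  shows "AE \<xi> in lborel. g \<xi> = 0"
proof (rule AE_zero_of_dilated_averages[OF g integrable_inv_fourier_test_fun integral_inv_fourier_box_bump])
  show "test_fun (box_bump 1 (\<lambda>_. 0) :: 'a \<Rightarrow> complex)" by (rule test_fun_box_bump) simp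
  let ?K = "inv_fourier (box_bump 1 (\<lambda>_. 0)) :: 'a \<Rightarrow> complex"
  fix e :: real and \<eta> :: 'a assume e: "0 < e"
  let ?\<psi> = "\<lambda>x::'a. box_bump e (\<lambda>_. 0) x * cis (- (x \<bullet> \<eta>))"
  have test: "test_fun ?\<psi>" by (rule inv_fourier_modulated_box_bump(1)[OF e])
  have borel: "g \<in> borel_measurable borel" "inv_fourier ?\<psi> \<in> borel_measurable borel"
    using uniformly_locally_integrable_borel[OF g] borel_measurable_inv_fourier[OF test_fun_borel[OF test]] by auto
  have "0 = (\<integral>\<xi>. g \<xi> * inv_fourier ?\<psi> \<xi> \<partial>lborel)" by (rule zero[OF test, symmetric])
  also have "\<dots> = (\<bar>e\<bar> ^ DIM('a)) *\<^sub>R (\<integral>u. g (\<eta> + e *\<^sub>R u) * inv_fourier ?\<psi> (\<eta> + e *\<^sub>R u) \<partial>lborel)"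
    using e by (intro integral_lborel_affine borel_measurable_times borel) simp
  also have "\<dots> = (\<bar>e\<bar> ^ DIM('a)) *\<^sub>R (\<integral>u. of_real ((1 / e) ^ DIM('a)) * (g (\<eta> + e *\<^sub>R u) * ?K u) \<partial>lborel)"
    unfolding inv_fourier_modulated_box_bump(2)[OF e] by (simp only: mult.left_commute)
  also have "\<dots> = (\<integral>u. g (\<eta> + e *\<^sub>R u) * ?K u \<partial>lborel)"
    unfolding integral_mult_right_zero using e by (simp add: scaleR_conv_of_real power_divide)
  finally show "(\<integral>u. g (\<eta> + e *\<^sub>R u) * ?K u \<partial>lborel) = 0" by simp
qed

section \<open>Decreasing rearrangements of functions in Lorentz spaces\<close>

lemma epow_mono: "x \<le> y \<Longrightarrow> 0 \<le> b \<Longrightarrow> epow x b \<le> epow y b"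
  by (auto simp: epow_def top_unique less_top[symmetric] intro!: ennreal_leI powr_mono2 enn2real_mono)

lemma epow_ennreal: "0 \<le> x \<Longrightarrow> epow (ennreal x) b = ennreal (x powr b)"
  by (simp add: epow_def)

lemma epow_mult_ennreal:
  assumes "0 < c" shows "epow (x * ennreal c) b = epow x b * ennreal (c powr b)"
proof (cases x)
  case (real r)
  then show ?thesis using assms by (simp add: ennreal_mult[symmetric] epow_ennreal powr_mult)
next
  case top
  then show ?thesis using assms by (simp add: epow_def ennreal_top_mult)
qed

lemma le_of_epow_le:
  assumes "epow x b \<le> ennreal y" "0 < b" "0 \<le> y"
  shows "x \<le> ennreal (y powr (1 / b))"
proof (cases x)
  case (real r)
  then have "r powr b \<le> y" using assms by (simp add: epow_ennreal)
  then have "(r powr b) powr (1 / b) \<le> y powr (1 / b)" using assms by (intro powr_mono2) auto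
  then show ?thesis using real assms by (simp add: powr_powr)
qed (use assms in \<open>simp add: epow_def top_unique\<close>)

lemma nn_integral_le_cmultI:
  assumes [measurable]: "f \<in> borel_measurable M" and "c > 0" "\<And>x. f x \<le> ennreal c * h x"
  shows "(\<integral>\<^sup>+x. f x \<partial>M) \<le> ennreal c * (\<integral>\<^sup>+x. h x \<partial>M)"
proof -
  have inverse: "ennreal c * ennreal (1 / c) = 1" using assms(2) by (simp add: ennreal_mult[symmetric])
  have "(\<integral>\<^sup>+x. f x \<partial>M) = ennreal c * (ennreal (1 / c) * (\<integral>\<^sup>+x. f x \<partial>M))"
    by (simp only: mult.assoc[symmetric] inverse mult_1)
  also have "ennreal (1 / c) * (\<integral>\<^sup>+x. f x \<partial>M) = (\<integral>\<^sup>+x. ennreal (1 / c) * f x \<partial>M)"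
    by (rule nn_integral_cmult[symmetric]) measurable
  also have "\<dots> \<le> (\<integral>\<^sup>+x. h x \<partial>M)"
  proof (rule nn_integral_mono)
    fix x
    have "ennreal (1 / c) * f x \<le> ennreal (1 / c) * (ennreal c * h x)"
      by (intro mult_left_mono assms) auto
    also have "\<dots> = h x"
      by (simp only: mult.assoc[symmetric] mult.commute[of "ennreal (1 / c)"] inverse mult_1)
    finally show "ennreal (1 / c) * f x \<le> h x" .
  qed
  finally show ?thesis by (simp add: mult_left_mono)
qed

lemma sum_powr_int_le:
  fixes r :: real and F :: "int set"
  assumes "r > 1" "finite F" "\<And>k. k \<in> F \<Longrightarrow> k \<le> m"
  shows "(\<Sum>k\<in>F. r powr real_of_int k) \<le> r powr real_of_int m * (1 / (1 - 1 / r))"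
proof -
  have inj: "inj_on (\<lambda>k. nat (m - k)) F" by (rule inj_onI) (use assms(3) in \<open>simp add: eq_nat_nat_iff\<close>)
  have "r powr real_of_int k = r powr real_of_int m * (1 / r) ^ nat (m - k)" if "k \<in> F" for k
  proof -
    have "(1 / r) ^ n = r powr - real n" for n
      using assms(1) by (simp add: powr_minus powr_realpow power_one_over inverse_eq_divide)
    from this[of "nat (m - k)"] have "(1 / r) ^ nat (m - k) = r powr (real_of_int k - real_of_int m)"
      using assms(3)[OF that] by simp
    then show ?thesis using assms(1) by (simp add: powr_add[symmetric])
  qed
  then have "(\<Sum>k\<in>F. r powr real_of_int k) = r powr real_of_int m * (\<Sum>k\<in>F. (1 / r) ^ nat (m - k))"
    by (simp add: sum_distrib_left)
  also have "(\<Sum>k\<in>F. (1 / r) ^ nat (m - k)) = (\<Sum>i\<in>(\<lambda>k. nat (m - k)) ` F. (1 / r) ^ i)"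
    by (simp add: sum.reindex[OF inj])
  also have "\<dots> \<le> (\<Sum>i. (1 / r) ^ i)"
    using assms by (intro sum_le_suminf summable_geometric) auto
  also have "\<dots> = 1 / (1 - 1 / r)" using assms(1) by (intro suminf_geometric) auto
  finally show ?thesis by (simp add: mult_left_mono)
qed

lemma geometric_convolution_summable:
  fixes \<mu> :: "int \<Rightarrow> real"
  assumes nonneg: "\<And>k. 0 \<le> \<mu> k" and sum_le: "\<And>F. finite F \<Longrightarrow> (\<Sum>k\<in>F. \<mu> k) \<le> C" and r: "0 \<le> r" "r < 1"
  shows "summable (\<lambda>i. r ^ i * \<mu> (int k - int i))" and "summable (\<lambda>k. \<Sum>i. r ^ i * \<mu> (int k - int i))"
proof -
  have geometric: "summable (\<lambda>i. C * r ^ i)"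
    using r by (intro summable_mult summable_geometric) auto
  show convolution: "summable (\<lambda>i. r ^ i * \<mu> (int k - int i))" for k
  proof (rule summable_comparison_test'[OF geometric])
    show "norm (r ^ i * \<mu> (int k - int i)) \<le> C * r ^ i" for i
      using mult_right_mono[OF sum_le[of "{int k - int i}"], of "r ^ i"] r nonneg
      by (simp add: mult.commute)
  qed
  show "summable (\<lambda>k. \<Sum>i. r ^ i * \<mu> (int k - int i))"
  proof (rule summableI_nonneg_bounded)
    fix N
    have "(\<Sum>k<N. \<Sum>i. r ^ i * \<mu> (int k - int i)) = (\<Sum>i. \<Sum>k<N. r ^ i * \<mu> (int k - int i))"
      by (rule suminf_sum[symmetric]) (rule convolution)
    also have "\<dots> \<le> (\<Sum>i. C * r ^ i)"
    proof (intro suminf_le summable_sum convolution geometric)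
      fix i
      have "(\<Sum>k<N. \<mu> (int k - int i)) = (\<Sum>k\<in>(\<lambda>k. int k - int i) ` {..<N}. \<mu> k)"
        by (subst sum.reindex) (auto simp: inj_on_def)
      also have "\<dots> \<le> C" by (rule sum_le) auto
      finally show "(\<Sum>k<N. r ^ i * \<mu> (int k - int i)) \<le> C * r ^ i"
        unfolding sum_distrib_left[symmetric] mult.commute[of C] using r by (intro mult_left_mono) auto
    qed
    finally show "(\<Sum>k<N. \<Sum>i. r ^ i * \<mu> (int k - int i)) \<le> (\<Sum>i. C * r ^ i)" .
  qed (intro suminf_nonneg convolution mult_nonneg_nonneg nonneg zero_le_power r)
qed

text \<open>The majorant is the q-norm of the convolution with a geometric sequence; this replaces an
  appeal to Young's convolution inequality.\<close>

lemma geometric_majorant: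
  fixes \<nu> :: "int \<Rightarrow> real"
  assumes nonneg: "\<And>k. 0 \<le> \<nu> k" and sum_le: "\<And>F. finite F \<Longrightarrow> (\<Sum>k\<in>F. \<nu> k powr q) \<le> C"
    and q: "0 < q" and \<sigma>: "0 < \<sigma>" "\<sigma> < 1"
  obtains \<epsilon> :: "nat \<Rightarrow> real" where "\<And>k. 0 \<le> \<epsilon> k" "summable (\<lambda>k. \<epsilon> k powr q)"
    "\<And>k i. \<sigma> ^ i * \<nu> (int k - int i) \<le> \<epsilon> k"
proof
  define \<mu> where "\<mu> k i = (\<sigma> powr q) ^ i * \<nu> (int k - int i) powr q" for k i :: nat
  define E where "E k = (\<Sum>i. \<mu> k i)" for k
  have "0 \<le> \<sigma> powr q" "\<sigma> powr q < 1" using \<sigma> q powr_less_mono2[of q \<sigma> 1] by auto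
  note convolution = geometric_convolution_summable[of "\<lambda>k. \<nu> k powr q", OF powr_ge_zero sum_le this]
  have \<mu>_nonneg: "0 \<le> \<mu> k i" for k i by (simp add: \<mu>_def)
  have \<mu>_summable: "summable (\<mu> k)" for k using convolution(1) unfolding \<mu>_def[abs_def] .
  have E_summable: "summable E" using convolution(2) unfolding E_def[abs_def] \<mu>_def[abs_def] .
  have E_nonneg: "0 \<le> E k" for k unfolding E_def by (intro suminf_nonneg \<mu>_summable \<mu>_nonneg)
  show "0 \<le> E k powr (1 / q)" for k by simp
  show "summable (\<lambda>k. (E k powr (1 / q)) powr q)"
    using E_summable E_nonneg q by (simp add: powr_powr)
  show "\<sigma> ^ i * \<nu> (int k - int i) \<le> E k powr (1 / q)" for k i
  proof -
    have "(\<sigma> ^ i * \<nu> (int k - int i)) powr q = \<mu> k i"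
      using \<sigma> nonneg by (simp add: \<mu>_def powr_mult powr_realpow[symmetric] powr_powr mult.commute)
    also have "\<dots> \<le> E k"
      unfolding E_def using sum_le_suminf[OF \<mu>_summable, of "{i}" k] \<mu>_nonneg by simp
    finally have "((\<sigma> ^ i * \<nu> (int k - int i)) powr q) powr (1 / q) \<le> E k powr (1 / q)"
      using q by (intro powr_mono2) auto
    then show ?thesis using q \<sigma> nonneg[of "int k - int i"] by (simp add: powr_powr)
  qed
qed

lemma powr_le_nn_integral:
  assumes "0 \<le> a" "1 \<le> q"
  shows "ennreal (a powr q) \<le> ennreal (2 powr q) * (\<integral>\<^sup>+t. ennreal (t powr (q - 1)) * indicator {0<..<a} t \<partial>lborel)"
proof -
  have "ennreal ((a / 2) powr q) = (\<integral>\<^sup>+t. ennreal ((a / 2) powr (q - 1)) * indicator {a / 2<..<a} t \<partial>lborel)"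
    using assms by (cases "a = 0") (auto simp: nn_integral_cmult_indicator ennreal_mult[symmetric] powr_diff)
  also have "\<dots> \<le> (\<integral>\<^sup>+t. ennreal (t powr (q - 1)) * indicator {0<..<a} t \<partial>lborel)"
  proof (rule nn_integral_mono)
    fix t
    show "ennreal ((a / 2) powr (q - 1)) * indicator {a / 2<..<a} t
        \<le> ennreal (t powr (q - 1)) * indicator {0<..<a} t"
      using assms by (cases "t \<in> {a / 2<..<a}") (auto intro!: ennreal_leI powr_mono2)
  qed
  finally have "ennreal (2 powr q) * ennreal ((a / 2) powr q)
      \<le> ennreal (2 powr q) * (\<integral>\<^sup>+t. ennreal (t powr (q - 1)) * indicator {0<..<a} t \<partial>lborel)"
    by (rule mult_left_mono) simp
  then show ?thesis using assms by (simp add: ennreal_mult'[symmetric] powr_mult[symmetric])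
qed

definition rearrangement :: "'a measure \<Rightarrow> ('a \<Rightarrow> complex) \<Rightarrow> real \<Rightarrow> real" where
  "rearrangement M g s = Inf {t. 0 \<le> t \<and> emeasure M (superlevel M g t) \<le> ennreal s}"

lemma superlevel_antimono: "s \<le> t \<Longrightarrow> superlevel M g t \<subseteq> superlevel M g s"
  by (auto simp: superlevel_def)

lemma distrib_fun_antimono:
  assumes "g \<in> borel_measurable M" "s \<le> t"
  shows "distrib_fun M g t \<le> distrib_fun M g s"
  unfolding distrib_fun_def using assms by (intro emeasure_mono) auto

lemma emeasure_superlevel_le_distrib_fun:
  assumes "g \<in> borel_measurable M"
  shows "emeasure M (superlevel M g t) \<le> distrib_fun M g t"
  unfolding distrib_fun_def superlevel_def using assms by (intro emeasure_mono) auto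

lemma emeasure_superlevel_gt:
  assumes "0 \<le> t" "t < rearrangement M g s" shows "ennreal s < emeasure M (superlevel M g t)"
proof (rule ccontr)
  assume "\<not> ?thesis"
  then have "rearrangement M g s \<le> t"
    unfolding rearrangement_def using assms(1) by (intro cInf_lower) (auto simp: bdd_below_def)
  then show False using assms by simp
qed

lemma dyadic_step_eq:
  fixes D p a :: real and k :: int and i :: nat
  defines "\<sigma> \<equiv> 2 powr (- D * (1 - 2 / p) / 4)"
  shows "a\<^sup>2 * 2 powr (D * (of_int k - real i)) = 2 powr D * 2 powr (D * (1 - 2 / p) * k)
    * (\<sigma> ^ Suc i * (a * 2 powr (D * of_int (k - int (Suc i)) / p)))\<^sup>2 * (\<sigma>\<^sup>2) ^ Suc i"
proof -
  define \<theta> where "\<theta> = 1 - 2 / p"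
  define j where "j = k - int (Suc i)"
  define \<nu> where "\<nu> = a * 2 powr (D * of_int j / p)"
  have \<sigma>_power: "2 powr (- D * \<theta>) = \<sigma> ^ 4" by (simp add: \<sigma>_def \<theta>_def powr_power)
  have "a\<^sup>2 * 2 powr (D * (of_int k - real i))
      = \<nu>\<^sup>2 * (2 powr (- (2 * D * j / p)) * 2 powr (D * (of_int k - real i)))"
    by (simp add: \<nu>_def power_mult_distrib powr_power powr_add[symmetric] mult_ac)
  also have "2 powr (- (2 * D * j / p)) * 2 powr (D * (of_int k - real i))
      = 2 powr D * 2 powr (D * \<theta> * k) * 2 powr (- D * \<theta> * Suc i)"
    unfolding powr_add[symmetric]
    by (rule arg_cong[where f="(powr) 2"]) (simp add: j_def \<theta>_def algebra_simps add_divide_distrib diff_divide_distrib)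
  also have "2 powr (- D * \<theta> * Suc i) = (\<sigma> ^ 4) ^ Suc i"
    unfolding \<sigma>_power[symmetric] by (simp add: powr_power mult.commute del: power_Suc of_nat_Suc)
  also have "\<dots> = (\<sigma> ^ Suc i)\<^sup>2 * (\<sigma>\<^sup>2) ^ Suc i"
    unfolding power_mult[symmetric] power_add[symmetric] by (rule arg_cong[where f="(^) \<sigma>"]) simp
  finally show ?thesis by (simp add: \<nu>_def j_def \<theta>_def power_mult_distrib mult_ac)
qed

locale lorentz_function =
  fixes M :: "'a measure" and g :: "'a \<Rightarrow> complex" and p q :: real
  assumes p: "0 < p" and q: "1 \<le> q" and in_lorentz: "in_lorentz p q M g"
begin

lemma measurable_g [measurable]: "g \<in> borel_measurable M"
  using in_lorentz by (simp add: in_lorentz_def)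

definition lorentz_energy :: ennreal where
  "lorentz_energy = (\<integral>\<^sup>+t. indicator {0<..} t * (epow (distrib_fun M g t) (q / p) * ennreal (t powr (q - 1))) \<partial>lborel)"

lemma lorentz_energy_finite: "lorentz_energy < top"
proof -
  have "indicator {0<..} t * epow (distrib_fun M g t * ennreal (t powr p)) (q / p) * ennreal (1 / t)
      = indicator {0<..} t * (epow (distrib_fun M g t) (q / p) * ennreal (t powr (q - 1)))" for t :: real
    using p by (cases "0 < t")
      (auto simp: epow_mult_ennreal powr_powr powr_diff mult.assoc ennreal_mult'[symmetric])
  then have "lorentz_qnorm_pow p q M g = ennreal q * lorentz_energy"
    unfolding lorentz_qnorm_pow_def lorentz_energy_def by simp
  then show ?thesis
    using in_lorentz q by (auto simp: in_lorentz_def ennreal_mult_less_top)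
qed

lemma weak_type: "\<exists>C>0. \<forall>t>0. distrib_fun M g t \<le> ennreal (C * t powr - p)"
proof -
  obtain E where E: "lorentz_energy = ennreal E" "0 \<le> E"
    using lorentz_energy_finite by (cases lorentz_energy) auto
  have "distrib_fun M g t \<le> ennreal ((2 powr q * E) powr (p / q) * t powr - p)" if t: "0 < t" for t
  proof -
    let ?d = "epow (distrib_fun M g t) (q / p)"
    have "?d * ennreal (t powr q)
        \<le> ?d * (ennreal (2 powr q) * (\<integral>\<^sup>+s. ennreal (s powr (q - 1)) * indicator {0<..<t} s \<partial>lborel))"
      using t q by (intro mult_left_mono powr_le_nn_integral) auto
    also have "\<dots> = ennreal (2 powr q) * (\<integral>\<^sup>+s. ?d * (ennreal (s powr (q - 1)) * indicator {0<..<t} s) \<partial>lborel)"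
      by (subst nn_integral_cmult) (auto simp: mult.left_commute)
    also have "\<dots> \<le> ennreal (2 powr q) * lorentz_energy"
      unfolding lorentz_energy_def
    proof (intro mult_left_mono nn_integral_mono)
      fix s
      show "?d * (ennreal (s powr (q - 1)) * indicator {0<..<t} s)
          \<le> indicator {0<..} s * (epow (distrib_fun M g s) (q / p) * ennreal (s powr (q - 1)))"
        using p q by (cases "s \<in> {0<..<t}")
          (auto intro!: mult_right_mono epow_mono distrib_fun_antimono[OF measurable_g])
    qed auto
    finally have "epow (distrib_fun M g t * ennreal (t powr p)) (q / p) \<le> ennreal (2 powr q * E)"
      using t p E by (simp add: epow_mult_ennreal powr_powr ennreal_mult)
    then have "distrib_fun M g t * ennreal (t powr p) \<le> ennreal ((2 powr q * E) powr (p / q))"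
      using le_of_epow_le[of _ "q / p"] p q E by simp
    from mult_right_mono[OF this, of "ennreal (t powr - p)"] show ?thesis
      using t by (simp add: mult.assoc ennreal_mult'[symmetric] powr_add[symmetric])
  qed
  then have "distrib_fun M g t \<le> ennreal (((2 powr q * E) powr (p / q) + 1) * t powr - p)" if "0 < t"
    for t
    using that by (fastforce intro: order_trans ennreal_leI mult_right_mono)
  then show ?thesis
    by (intro exI[of _ "(2 powr q * E) powr (p / q) + 1"]) (simp add: add_nonneg_pos)
qed

lemma rearrangement_set_nonempty:
  assumes "0 < s" shows "{t. 0 \<le> t \<and> emeasure M (superlevel M g t) \<le> ennreal s} \<noteq> {}"
proof -
  obtain C where C: "0 < C" "\<And>t. 0 < t \<Longrightarrow> distrib_fun M g t \<le> ennreal (C * t powr - p)"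
    using weak_type by blast
  let ?t = "(C / s) powr (1 / p)"
  have "emeasure M (superlevel M g ?t) \<le> distrib_fun M g ?t"
    by (rule emeasure_superlevel_le_distrib_fun[OF measurable_g])
  also have "\<dots> \<le> ennreal (C * ?t powr - p)" using C assms by (intro C(2)) auto
  also have "C * ?t powr - p = s" using C assms p by (simp add: powr_powr powr_minus)
  finally show ?thesis using powr_ge_zero by blast
qed

lemma rearrangement_nonneg: "0 < s \<Longrightarrow> 0 \<le> rearrangement M g s"
  unfolding rearrangement_def by (rule cInf_greatest[OF rearrangement_set_nonempty]) auto

lemma emeasure_superlevel_rearrangement_le:
  assumes s: "0 < s"
  shows "emeasure M (superlevel M g (rearrangement M g s)) \<le> ennreal s"
proof -
  let ?t = "rearrangement M g s"
  let ?A = "\<lambda>n. superlevel M g (?t + 1 / real (Suc n))"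
  have union: "superlevel M g ?t = (\<Union>n. ?A n)"
  proof (intro equalityI subsetI)
    fix x assume x: "x \<in> superlevel M g ?t"
    then have "0 < cmod (g x) - ?t" by (simp add: superlevel_def)
    then obtain n where "inverse (real (Suc n)) < cmod (g x) - ?t" using reals_Archimedean by blast
    then show "x \<in> (\<Union>n. ?A n)"
      using x by (auto simp: superlevel_def inverse_eq_divide intro!: exI[of _ n])
  next
    fix x assume "x \<in> (\<Union>n. ?A n)"
    then obtain n where "x \<in> ?A n" by blast
    then show "x \<in> superlevel M g ?t" by (rule set_mp[OF superlevel_antimono, rotated]) simp
  qed
  have approx: "emeasure M (?A n) \<le> ennreal s" for n
  proof -
    have "Inf {t. 0 \<le> t \<and> emeasure M (superlevel M g t) \<le> ennreal s} < ?t + 1 / real (Suc n)"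
      unfolding rearrangement_def by simp
    then obtain t where t: "emeasure M (superlevel M g t) \<le> ennreal s" "t < ?t + 1 / real (Suc n)"
      using cInf_lessD[OF rearrangement_set_nonempty[OF s]] by blast
    have "emeasure M (?A n) \<le> emeasure M (superlevel M g t)"
      using t(2) by (intro emeasure_mono superlevel_antimono) auto
    then show ?thesis using t(1) by (rule order_trans)
  qed
  have "incseq ?A" by (intro incseq_SucI superlevel_antimono) (simp add: field_simps)
  then have "emeasure M (superlevel M g ?t) = (SUP n. emeasure M (?A n))"
    unfolding union by (intro SUP_emeasure_incseq[symmetric]) auto
  then show ?thesis using approx by (auto intro: SUP_least)
qed

lemma sum_powr_superlevel_le:
  fixes F :: "int set"
  assumes D: "0 < D" and F: "finite F" and t: "0 < t"
  defines "r \<equiv> 2 powr (D * q / p)"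
  shows "(\<Sum>k\<in>{k\<in>F. t < rearrangement M g (2 powr (D * k))}. ennreal (r powr k))
    \<le> ennreal (1 / (1 - 1 / r)) * epow (distrib_fun M g t) (q / p)"
proof -
  let ?F = "{k\<in>F. t < rearrangement M g (2 powr (D * k))}"
  show ?thesis
  proof (cases "?F = {}")
    case True
    show ?thesis unfolding True by simp
  next
    case False
    have r: "1 < r" using D p q unfolding r_def by (intro gr_one_powr) auto
    have finite: "finite ?F" using F by simp
    define m where "m = Max ?F"
    have m: "m \<in> ?F" "\<And>k. k \<in> ?F \<Longrightarrow> k \<le> m" using Max_in[OF finite False] finite by (auto simp: m_def)
    have "(\<Sum>k\<in>?F. ennreal (r powr k)) = ennreal (\<Sum>k\<in>?F. r powr k)" by (simp add: sum_ennreal)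
    also have "\<dots> \<le> ennreal (r powr m * (1 / (1 - 1 / r)))"
      by (intro ennreal_leI sum_powr_int_le r finite m(2))
    also have "\<dots> = ennreal (1 / (1 - 1 / r)) * epow (ennreal (2 powr (D * m))) (q / p)"
      using r by (simp add: epow_ennreal r_def powr_powr ennreal_mult'[symmetric] mult_ac)
    also have "\<dots> \<le> ennreal (1 / (1 - 1 / r)) * epow (distrib_fun M g t) (q / p)"
    proof (intro mult_left_mono epow_mono)
      have "ennreal (2 powr (D * m)) \<le> emeasure M (superlevel M g t)"
        using m(1) t by (intro less_imp_le emeasure_superlevel_gt) auto
      also have "\<dots> \<le> distrib_fun M g t" by (rule emeasure_superlevel_le_distrib_fun[OF measurable_g])
      finally show "ennreal (2 powr (D * m)) \<le> distrib_fun M g t" .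
    qed (use p q in auto)
    finally show ?thesis .
  qed
qed

lemma sum_powr_indicator_rearrangement_le:
  fixes F :: "int set" and D t :: real
  assumes D: "0 < D" and F: "finite F"
  defines "r \<equiv> 2 powr (D * q / p)"
  shows "(\<Sum>k\<in>F. ennreal (r powr k) * (ennreal (t powr (q - 1)) * indicator {0<..<rearrangement M g (2 powr (D * k))} t))
    \<le> ennreal (1 / (1 - 1 / r)) * (indicator {0<..} t * (epow (distrib_fun M g t) (q / p) * ennreal (t powr (q - 1))))"
proof (cases "0 < t")
  case True
  have "(\<Sum>k\<in>F. ennreal (r powr k) * (ennreal (t powr (q - 1)) * indicator {0<..<rearrangement M g (2 powr (D * k))} t))
      = (\<Sum>k\<in>{k\<in>F. t < rearrangement M g (2 powr (D * k))}. ennreal (r powr k)) * ennreal (t powr (q - 1))"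
    using F True
    by (auto simp: sum_distrib_right indicator_def sum.inter_filter simp del: sum_ennreal intro!: sum.cong)
  also have "\<dots> \<le> ennreal (1 / (1 - 1 / r)) * epow (distrib_fun M g t) (q / p) * ennreal (t powr (q - 1))"
    unfolding r_def by (intro mult_right_mono sum_powr_superlevel_le D F True) simp
  finally show ?thesis using True by (simp add: mult_ac)
qed (auto simp: indicator_def intro!: sum.neutral)

lemma sum_rearrangement_bounded:
  assumes D: "0 < D"
  obtains C where "\<And>F. finite F \<Longrightarrow>
    (\<Sum>k\<in>F. (rearrangement M g (2 powr (D * of_int k)) * 2 powr (D * of_int k / p)) powr q) \<le> C"
proof -
  define level where "level k = rearrangement M g (2 powr (D * of_int k))" for k :: int
  have level_nonneg: "0 \<le> level k" for k by (simp add: level_def rearrangement_nonneg)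
  define r where "r = 2 powr (D * q / p)"
  define c where "c = 1 / (1 - 1 / r)"
  have "1 < r" using D p q unfolding r_def by (intro gr_one_powr) auto
  then have c: "0 < c" by (simp add: c_def)
  obtain E where E: "lorentz_energy = ennreal E" "0 \<le> E"
    using lorentz_energy_finite by (cases lorentz_energy) auto
  have "(\<Sum>k\<in>F. (level k * 2 powr (D * of_int k / p)) powr q)
      \<le> 2 powr q * (c * E)" if F: "finite F" for F
  proof -
    let ?I = "\<lambda>k t. ennreal (t powr (q - 1)) * indicator {0<..<level k} t"
    have "ennreal (\<Sum>k\<in>F. (level k * 2 powr (D * of_int k / p)) powr q)
        = (\<Sum>k\<in>F. ennreal (r powr k) * ennreal (level k powr q))"
      using level_nonneg
      by (subst sum_ennreal[symmetric])
         (auto simp: powr_mult powr_powr r_def ennreal_mult'[symmetric] mult_ac intro!: sum.cong)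
    also have "\<dots> \<le> (\<Sum>k\<in>F. ennreal (r powr k) * (ennreal (2 powr q) * (\<integral>\<^sup>+t. ?I k t \<partial>lborel)))"
      by (intro sum_mono mult_left_mono powr_le_nn_integral level_nonneg q) auto
    also have "\<dots> = ennreal (2 powr q) * (\<integral>\<^sup>+t. (\<Sum>k\<in>F. ennreal (r powr k) * ?I k t) \<partial>lborel)"
      by (simp add: nn_integral_sum nn_integral_cmult sum_distrib_left mult.left_commute)
    also have "(\<integral>\<^sup>+t. (\<Sum>k\<in>F. ennreal (r powr k) * ?I k t) \<partial>lborel) \<le> ennreal c * lorentz_energy"
      unfolding lorentz_energy_def level_def c_def r_def
      using sum_powr_indicator_rearrangement_le[OF D F] c[unfolded c_def r_def]
      by (intro nn_integral_le_cmultI) (auto simp only:, measurable)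
    finally have "ennreal (\<Sum>k\<in>F. (level k * 2 powr (D * of_int k / p)) powr q)
        \<le> ennreal (2 powr q * (c * E))"
      using c E by (simp add: ennreal_mult mult_left_mono)
    then show ?thesis using c E by simp
  qed
  then show ?thesis by (rule that[unfolded level_def[symmetric]])
qed

lemma AE_le_rearrangement:
  assumes s: "\<And>n. 0 < s n" "s \<longlonglongrightarrow> 0"
  shows "AE x in M. \<exists>n. cmod (g x) \<le> rearrangement M g (s n)"
proof (rule AE_I')
  let ?N = "\<Inter>n. superlevel M g (rearrangement M g (s n))"
  have "emeasure M ?N \<le> ennreal (s n)" for n
  proof -
    have "emeasure M ?N \<le> emeasure M (superlevel M g (rearrangement M g (s n)))"
      by (intro emeasure_mono) auto
    also have "\<dots> \<le> ennreal (s n)" by (rule emeasure_superlevel_rearrangement_le[OF s(1)])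
    finally show ?thesis .
  qed
  moreover have "(\<lambda>n. ennreal (s n)) \<longlonglongrightarrow> ennreal 0" by (intro tendsto_ennrealI s)
  ultimately have "emeasure M ?N \<le> ennreal 0" by (intro LIMSEQ_le_const) auto
  moreover have "?N \<in> sets M" by (intro sets.countable_INT) auto
  ultimately show "?N \<in> null_sets M" by (simp add: null_sets_def)
  show "{x \<in> space M. \<not> (\<exists>n. cmod (g x) \<le> rearrangement M g (s n))} \<subseteq> ?N"
    by (auto simp: superlevel_def not_le)
qed

lemma tail_energy_rearrangement_le:
  assumes s: "\<And>n. 0 < s n" "s \<longlonglongrightarrow> 0"
  shows "tail_energy M g (rearrangement M g (s 0))
      \<le> (\<Sum>i. ennreal ((rearrangement M g (s (Suc i)))\<^sup>2 * s i))"
proof -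
  define height where "height i = rearrangement M g (s i)" for i
  let ?A = "\<lambda>i. superlevel M g (height i)"
  let ?b = "\<lambda>i x. ennreal ((height (Suc i))\<^sup>2) * indicator (?A i) x"
  have "ennreal ((cmod (g x))\<^sup>2) * indicator (?A 0) x \<le> (\<Sum>i. ?b i x)"
    if x: "x \<in> space M" and ex: "\<exists>n. cmod (g x) \<le> height n" for x
  proof (cases "x \<in> ?A 0")
    case True
    define m where "m = (LEAST n. cmod (g x) \<le> height n)"
    have m: "cmod (g x) \<le> height m" unfolding m_def using ex by (rule LeastI_ex)
    have "m \<noteq> 0" using True m by (intro notI) (simp add: superlevel_def)
    then obtain i where i: "m = Suc i" by (cases m) auto
    have "\<not> cmod (g x) \<le> height i"
      using not_less_Least[of i "\<lambda>n. cmod (g x) \<le> height n"] i by (simp add: m_def[symmetric])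
    then have "x \<in> ?A i" using x by (simp add: superlevel_def)
    then have "ennreal ((cmod (g x))\<^sup>2) \<le> (\<Sum>j\<in>{i}. ?b j x)"
      using m by (auto simp: i intro!: ennreal_leI power_mono)
    also have "\<dots> \<le> (\<Sum>j. ?b j x)" by (rule sum_le_suminf) auto
    finally show ?thesis using True by simp
  qed simp
  then have "tail_energy M g (height 0) \<le> (\<integral>\<^sup>+x. (\<Sum>i. ?b i x) \<partial>M)"
    unfolding tail_energy_def using AE_le_rearrangement[OF s]
    by (intro nn_integral_mono_AE) (auto simp: height_def)
  also have "\<dots> = (\<Sum>i. ennreal ((height (Suc i))\<^sup>2) * emeasure M (?A i))"
    by (subst nn_integral_suminf) (auto simp: nn_integral_cmult_indicator)
  also have "\<dots> \<le> (\<Sum>i. ennreal ((height (Suc i))\<^sup>2 * s i))"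
  proof (intro suminf_le)
    show "ennreal ((height (Suc i))\<^sup>2) * emeasure M (?A i) \<le> ennreal ((height (Suc i))\<^sup>2 * s i)" for i
      unfolding height_def using emeasure_superlevel_rearrangement_le[OF s(1), of i]
      by (simp add: ennreal_mult' mult_left_mono)
  qed auto
  finally show ?thesis unfolding height_def .
qed

lemma tail_energy_dyadic_le:
  fixes k :: int and D e :: real
  defines "level \<equiv> \<lambda>k. rearrangement M g (2 powr (D * real_of_int k))" and "\<sigma> \<equiv> 2 powr (- D * (1 - 2 / p) / 4)"
  assumes D: "0 < D" and p2: "2 < p"
    and majorant: "\<And>i. \<sigma> ^ i * (level (k - int i) * 2 powr (D * real_of_int (k - int i) / p)) \<le> e"
  shows "tail_energy M g (level k) \<le> ennreal ((2 powr (D * (1 / 2 - 1 / p) * k) * (sqrt (2 powr D * (1 / (1 - \<sigma>\<^sup>2))) * e))\<^sup>2)"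
proof -
  have "0 < 1 - 2 / p" using p2 by simp
  then have \<sigma>: "0 < \<sigma>" "\<sigma> < 1" using D unfolding \<sigma>_def by (auto intro!: powr_less_one)
  then have \<sigma>_square: "\<sigma>\<^sup>2 < 1" by (simp add: power_less_one_iff)
  define s where "s i = 2 powr (D * (of_int k - real i))" for i
  define C where "C = 2 powr D * 2 powr (D * (1 - 2 / p) * k) * e\<^sup>2"
  have summand: "(level (k - int (Suc i)))\<^sup>2 * s i \<le> C * (\<sigma>\<^sup>2) ^ i" for i
    unfolding s_def C_def dyadic_step_eq[where D = D and p = p, folded \<sigma>_def]
    using majorant[of "Suc i"] \<sigma> \<sigma>_square
    by (intro mult_mono power_mono power_decreasing) (auto simp: level_def rearrangement_nonneg)
  have rearrangement_s: "rearrangement M g (s i)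
      = level (k - int i)" for i by (simp add: s_def level_def)
  have "s = (\<lambda>i. 2 powr (D * k) * (2 powr - D) ^ i)"
    by (simp add: s_def fun_eq_iff powr_power powr_add[symmetric] algebra_simps)
  moreover have "2 powr - D < 1" using D by (intro powr_less_one) auto
  ultimately have s_lim: "s \<longlonglongrightarrow> 0" by (auto intro!: tendsto_mult_right_zero LIMSEQ_realpow_zero)
  have "0 < s i" for i by (simp add: s_def)
  from tail_energy_rearrangement_le[OF this s_lim]
  have "tail_energy M g (level k) \<le> (\<Sum>i. ennreal ((level (k - int (Suc i)))\<^sup>2 * s i))"
    by (simp only: rearrangement_s of_nat_0 diff_0_right)
  also have "\<dots> \<le> (\<Sum>i. ennreal (C * (\<sigma>\<^sup>2) ^ i))"
    by (intro suminf_le ennreal_leI summand) auto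
  also have "\<dots> = ennreal (C * (1 / (1 - \<sigma>\<^sup>2)))"
    using \<sigma>_square sums_mult[OF geometric_sums, of "\<sigma>\<^sup>2" C] by (intro suminf_ennreal_eq) (auto simp: C_def)
  also have "C * (1 / (1 - \<sigma>\<^sup>2)) = (2 powr (D * (1 / 2 - 1 / p) * k) * (sqrt (2 powr D * (1 / (1 - \<sigma>\<^sup>2))) * e))\<^sup>2"
    using \<sigma>_square by (simp add: C_def power_mult_distrib powr_power algebra_simps)
  finally show ?thesis .
qed

lemma dyadic_truncation:
  assumes D: "0 < D" and p2: "2 < p"
  obtains lam w :: "nat \<Rightarrow> real" where "\<And>k. 0 \<le> lam k" "\<And>k. 0 \<le> w k" "summable (\<lambda>k. w k powr q)"
    "\<And>k. tail_energy M g (lam k) \<le> ennreal ((2 powr (D * (1 / 2 - 1 / p) * k) * w k)\<^sup>2)"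
    "\<And>k. lam k * 2 powr (D * k / p) \<le> w k"
proof -
  define level where "level k = rearrangement M g (2 powr (D * real_of_int k))" for k
  have level_nonneg: "0 \<le> level k" for k by (simp add: level_def rearrangement_nonneg)
  define \<sigma> where "\<sigma> = 2 powr (- D * (1 - 2 / p) / 4)"
  have \<sigma>: "0 < \<sigma>" "\<sigma> < 1" unfolding \<sigma>_def using D p2 by (auto intro!: powr_less_one)
  obtain C where "\<And>F. finite F \<Longrightarrow> (\<Sum>k\<in>F. (level k * 2 powr (D * real_of_int k / p)) powr q) \<le> C"
    using sum_rearrangement_bounded[OF D] unfolding level_def by blast
  then obtain \<epsilon> where \<epsilon>: "\<And>k. 0 \<le> \<epsilon> k" "summable (\<lambda>k. \<epsilon> k powr q)"
    and majorant: "\<And>k i. \<sigma> ^ i * (level (int k - int i) * 2 powr (D * real_of_int (int k - int i) / p)) \<le> \<epsilon> k"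
    using geometric_majorant[of "\<lambda>k. level k * 2 powr (D * real_of_int k / p)" q C \<sigma>] level_nonneg q \<sigma> by auto
  define c where "c = sqrt (2 powr D * (1 / (1 - \<sigma>\<^sup>2)))"
  have "\<sigma>\<^sup>2 < 1" using \<sigma> by (simp add: power_less_one_iff)
  then have "1 * 1 \<le> 2 powr D * (1 / (1 - \<sigma>\<^sup>2))"
    using D by (intro mult_mono ge_one_powr_ge_zero) (auto simp: field_simps)
  then have c: "1 \<le> c" by (simp add: c_def)
  show ?thesis
  proof
    show "0 \<le> level (int k)" for k by (rule level_nonneg)
    show "0 \<le> c * \<epsilon> k" for k using c \<epsilon>(1) by simp
    show "summable (\<lambda>k. (c * \<epsilon> k) powr q)" using c \<epsilon> by (simp add: powr_mult summable_mult)
    show "level (int k) * 2 powr (D * k / p) \<le> c * \<epsilon> k" for k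
      using majorant[of 0 k] mult_right_mono[OF c \<epsilon>(1), of k] by simp
    show "tail_energy M g (level (int k))
        \<le> ennreal ((2 powr (D * (1 / 2 - 1 / p) * k) * (c * \<epsilon> k))\<^sup>2)" for k
      using tail_energy_dyadic_le[OF D p2, of "int k" "\<epsilon> k"] majorant
      by (simp add: c_def level_def \<sigma>_def)
  qed
qed

end

section \<open>Coverings adapted to a weight sequence\<close>

lemma sum_le_nnsum: "finite F \<Longrightarrow> sum f F \<le> nnsum f"
  unfolding nnsum_def by (rule SUP_upper) simp

lemma le_nnsum: "f k \<le> nnsum f"
  using sum_le_nnsum[of "{k}" f] by simp

lemma sqrt_sum_le:
  assumes "\<And>i. i \<in> I \<Longrightarrow> 0 \<le> f i"
  shows "sqrt (\<Sum>i\<in>I. f i) \<le> (\<Sum>i\<in>I. sqrt (f i))"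
  using assms
proof (induction I rule: infinite_finite_induct)
  case (insert i I)
  have "sqrt (f i + (\<Sum>i\<in>I. f i)) \<le> sqrt (f i) + sqrt (\<Sum>i\<in>I. f i)"
    using insert by (intro sqrt_add_le_add_sqrt sum_nonneg) auto
  then show ?case using insert by fastforce
qed simp_all

lemma summable_tail_le:
  fixes f :: "nat \<Rightarrow> real"
  assumes "summable f" "\<And>k. 0 \<le> f k" "0 < \<epsilon>"
  obtains K where "\<And>m n. K \<le> m \<Longrightarrow> (\<Sum>k=m..<n. f k) \<le> \<epsilon>"
proof -
  obtain K where K: "\<And>m n. K \<le> m \<Longrightarrow> norm (\<Sum>k=m..<n. f k) < \<epsilon>"
    using assms(1,3) unfolding summable_Cauchy by blast
  have "(\<Sum>k=m..<n. f k) \<le> \<epsilon>" if "K \<le> m" for m n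
    using K[OF that, of n] by simp
  then show ?thesis by (rule that)
qed

text \<open>A bound on the norm of a in the dual of the space of q-summable sequences; for \<open>q > 1\<close> it
  bounds the power of the norm.\<close>

definition dual_bounded :: "real \<Rightarrow> real \<Rightarrow> (nat \<Rightarrow> real) \<Rightarrow> bool" where
  "dual_bounded q H a \<longleftrightarrow> (if q = 1 then \<forall>k. a k \<le> H else \<forall>N. (\<Sum>k<N. a k powr (q / (q - 1))) \<le> H)"

lemma bounded_pairing_tail_small:
  fixes w :: "nat \<Rightarrow> real" and H \<epsilon> :: real
  assumes w: "\<And>k. 0 \<le> w k" "summable w" and H: "0 \<le> H" and \<epsilon>: "0 < \<epsilon>"
  obtains K where "\<And>m n a. K \<le> m \<Longrightarrow> (\<And>k. a k \<le> H) \<Longrightarrow> (\<Sum>k=m..<n. w k * a k) \<le> \<epsilon>"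
proof -
  have "0 < \<epsilon> / (H + 1)" using \<epsilon> H by simp
  then obtain K where K: "\<And>m n. K \<le> m \<Longrightarrow> (\<Sum>k=m..<n. w k) \<le> \<epsilon> / (H + 1)"
    using summable_tail_le[of w] w by blast
  have "(\<Sum>k=m..<n. w k * a k) \<le> \<epsilon>" if "K \<le> m" "\<And>k. a k \<le> H" for m n a
  proof -
    have "a k \<le> H + 1" for k using that(2)[of k] by simp
    then have "(\<Sum>k=m..<n. w k * a k) \<le> (\<Sum>k=m..<n. w k) * (H + 1)"
      unfolding sum_distrib_right using w by (intro sum_mono mult_left_mono)
    also have "\<dots> \<le> \<epsilon> / (H + 1) * (H + 1)" using H by (intro mult_right_mono K that) auto
    finally show ?thesis using H by (simp add: add_nonneg_eq_0_iff)
  qed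
  then show ?thesis by (rule that)
qed

lemma mult_le_weighted_powr_sum:
  fixes x y \<tau> q q' :: real
  assumes "0 \<le> x" "0 \<le> y" and \<tau>: "0 < \<tau>" and q: "1 < q" "1 < q'" "1 / q + 1 / q' = 1"
  shows "x * y \<le> (1 / \<tau> * x) powr q + \<tau> powr q' * y powr q'"
proof -
  have "x * y = (1 / \<tau> * x) * (\<tau> * y)" using \<tau> by simp
  also have "\<dots> \<le> (1 / \<tau> * x) powr q / q + (\<tau> * y) powr q' / q'"
    using assms by (intro Youngs_inequality) auto
  also have "\<dots> \<le> (1 / \<tau> * x) powr q / 1 + (\<tau> * y) powr q' / 1"
    using q by (intro add_mono divide_left_mono) auto
  finally show ?thesis using \<tau> assms(2) by (simp add: powr_mult)
qed

lemma powr_pairing_tail_small: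
  fixes w :: "nat \<Rightarrow> real" and q H \<epsilon> :: real
  defines "q' \<equiv> q / (q - 1)"
  assumes q: "1 < q" and w: "\<And>k. 0 \<le> w k" "summable (\<lambda>k. w k powr q)" and H: "0 \<le> H" and \<epsilon>: "0 < \<epsilon>"
  obtains K where "\<And>m n a. K \<le> m \<Longrightarrow> (\<And>k. 0 \<le> a k) \<Longrightarrow> (\<And>N. (\<Sum>k<N. a k powr q') \<le> H) \<Longrightarrow>
    (\<Sum>k=m..<n. w k * a k) \<le> \<epsilon>"
proof -
  have q': "1 < q'" "1 / q + 1 / q' = 1" using q by (auto simp: q'_def field_simps)
  define \<tau> where "\<tau> = (\<epsilon> / (2 * (H + 1))) powr (1 / q')"
  have \<tau>: "0 < \<tau>" using \<epsilon> H by (simp add: \<tau>_def)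
  have \<tau>_H: "\<tau> powr q' * H \<le> \<epsilon> / 2"
  proof -
    have "\<tau> powr q' * H = \<epsilon> / 2 * (H / (H + 1))" using q' \<epsilon> H by (simp add: \<tau>_def powr_powr field_simps)
    also have "\<dots> \<le> \<epsilon> / 2 * 1" using H \<epsilon> by (intro mult_left_mono) auto
    finally show ?thesis by simp
  qed
  have "summable (\<lambda>k. (1 / \<tau> * w k) powr q)"
    using w \<tau> by (simp add: powr_mult powr_divide summable_mult)
  then obtain K where K: "\<And>m n. K \<le> m \<Longrightarrow> (\<Sum>k=m..<n. (1 / \<tau> * w k) powr q) \<le> \<epsilon> / 2"
    using summable_tail_le[of "\<lambda>k. (1 / \<tau> * w k) powr q" "\<epsilon> / 2"] \<epsilon> by auto
  have "(\<Sum>k=m..<n. w k * a k) \<le> \<epsilon>"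
    if "K \<le> m" and a: "\<And>k. 0 \<le> a k" "\<And>N. (\<Sum>k<N. a k powr q') \<le> H" for m n a
  proof -
    have "(\<Sum>k=m..<n. w k * a k) \<le> (\<Sum>k=m..<n. (1 / \<tau> * w k) powr q) + \<tau> powr q' * (\<Sum>k=m..<n. a k powr q')"
      unfolding sum_distrib_left sum.distrib[symmetric]
      by (intro sum_mono mult_le_weighted_powr_sum w a \<tau> q q')
    also have "\<dots> \<le> \<epsilon> / 2 + \<tau> powr q' * H"
    proof (intro add_mono K that(1) mult_left_mono)
      have "(\<Sum>k=m..<n. a k powr q') \<le> (\<Sum>k<n. a k powr q')" by (rule sum_mono2) auto
      also have "\<dots> \<le> H" by (rule a)
      finally show "(\<Sum>k=m..<n. a k powr q') \<le> H" .
    qed simp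
    finally show ?thesis using \<tau>_H by simp
  qed
  then show ?thesis by (rule that)
qed

lemma dual_pairing_tail_small:
  fixes w :: "nat \<Rightarrow> real" and q H \<epsilon> :: real
  assumes q: "1 \<le> q" and w: "\<And>k. 0 \<le> w k" "summable (\<lambda>k. w k powr q)" and H: "0 \<le> H" and \<epsilon>: "0 < \<epsilon>"
  obtains K where "\<And>m n a. K \<le> m \<Longrightarrow> (\<And>k. 0 \<le> a k) \<Longrightarrow> dual_bounded q H a \<Longrightarrow> (\<Sum>k=m..<n. w k * a k) \<le> \<epsilon>"
proof (cases "q = 1")
  case True
  then have "summable w" using w by simp
  from bounded_pairing_tail_small[OF w(1) this H \<epsilon>]
  obtain K where "\<And>m n a. K \<le> m \<Longrightarrow> (\<And>k. a k \<le> H) \<Longrightarrow> (\<Sum>k=m..<n. w k * a k) \<le> \<epsilon>"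
    by blast
  then show ?thesis by (rule that) (simp_all add: True dual_bounded_def)
next
  case False
  then have "1 < q" using q by simp
  from powr_pairing_tail_small[OF this w H \<epsilon>]
  obtain K where "\<And>m n a. K \<le> m \<Longrightarrow> (\<And>k. 0 \<le> a k) \<Longrightarrow> (\<And>N. (\<Sum>k<N. a k powr (q / (q - 1))) \<le> H) \<Longrightarrow>
      (\<Sum>k=m..<n. w k * a k) \<le> \<epsilon>"
    by blast
  then show ?thesis by (rule that) (simp_all add: False dual_bounded_def)
qed

definition band_mass :: "real \<Rightarrow> (nat \<Rightarrow> 'a::metric_space set) \<Rightarrow> int \<Rightarrow> ennreal" where
  "band_mass \<alpha> B k = nnsum (\<lambda>j. if diameter (B j) \<in> dyadic_band k then ennreal (diameter (B j) powr \<alpha>) else 0)"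

lemma cover_cost_dual_exp:
  "cover_cost \<alpha> (dual_exp q / 2) B
    = (if q = 1 then (SUP k. band_mass \<alpha> B k) else nnsum (\<lambda>k. epow (band_mass \<alpha> B k) (q / (q - 1) / 2)))"
  by (auto simp: cover_cost_def Let_def band_mass_def[abs_def] dual_exp_def)

lemma band_mass_finite:
  assumes "cover_cost \<alpha> (dual_exp q / 2) B < top"
  shows "band_mass \<alpha> B k < top"
proof (cases "q = 1")
  case True
  have "band_mass \<alpha> B k \<le> (SUP k. band_mass \<alpha> B k)" by (rule SUP_upper) simp
  then show ?thesis using assms True unfolding cover_cost_dual_exp by (simp add: le_less_trans)
next
  case False
  then have "epow (band_mass \<alpha> B k) (q / (q - 1) / 2) < top"
    using le_nnsum[of "\<lambda>k. epow (band_mass \<alpha> B k) (q / (q - 1) / 2)" k] assms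
    unfolding cover_cost_dual_exp by (simp add: le_less_trans)
  then show ?thesis by (cases "band_mass \<alpha> B k = top") (auto simp: epow_def less_top)
qed

lemma dual_bounded_sqrt_band_mass:
  assumes q: "1 \<le> q" and cost: "cover_cost \<alpha> (dual_exp q / 2) B \<le> ennreal H" and H: "1 \<le> H"
  shows "dual_bounded q H (\<lambda>k. sqrt (enn2real (band_mass \<alpha> B (int k))))"
proof -
  define A where "A k = enn2real (band_mass \<alpha> B (int k))" for k
  have A: "0 \<le> A k" "band_mass \<alpha> B (int k) = ennreal (A k)" for k
    using band_mass_finite[of \<alpha> q B "int k"] cost by (auto simp: A_def top.not_eq_extremum le_less_trans)
  show ?thesis
  proof (cases "q = 1")
    case True
    have "sqrt (A k) \<le> H" for k
    proof -
      have "ennreal (A k) \<le> (SUP k. band_mass \<alpha> B k)" unfolding A(2)[symmetric] by (rule SUP_upper) simp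
      also have "\<dots> \<le> ennreal H" using cost True unfolding cover_cost_dual_exp by simp
      finally have "A k \<le> H" using H by simp
      also have "H \<le> H\<^sup>2" using H by (simp add: self_le_power)
      finally show ?thesis using H by (intro real_le_lsqrt) auto
    qed
    then show ?thesis using True by (simp add: dual_bounded_def A_def)
  next
    case False
    have "(\<Sum>k<N. sqrt (A k) powr (q / (q - 1))) \<le> H" for N
    proof -
      have "sqrt (A k) powr (q / (q - 1)) = A k powr (q / (q - 1) / 2)" for k
        using A(1) by (simp add: powr_half_sqrt[symmetric] powr_powr algebra_simps)
      then have "ennreal (\<Sum>k<N. sqrt (A k) powr (q / (q - 1)))
          = (\<Sum>k<N. epow (band_mass \<alpha> B (int k)) (q / (q - 1) / 2))"
        unfolding A(2) by (subst sum_ennreal[symmetric]) (auto simp: epow_ennreal A(1))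
      also have "\<dots> = (\<Sum>k\<in>int ` {..<N}. epow (band_mass \<alpha> B k) (q / (q - 1) / 2))"
        by (subst sum.reindex) auto
      also have "\<dots> \<le> nnsum (\<lambda>k. epow (band_mass \<alpha> B k) (q / (q - 1) / 2))" by (rule sum_le_nnsum) auto
      also have "\<dots> \<le> ennreal H" using cost False unfolding cover_cost_dual_exp by simp
      finally show ?thesis using H by simp
    qed
    then show ?thesis using False by (simp add: dual_bounded_def A_def)
  qed
qed

lemma card_band_le:
  assumes \<alpha>: "0 < \<alpha>" and J: "finite J" "\<And>j. j \<in> J \<Longrightarrow> diameter (B j) \<in> dyadic_band (int k)"
    and finite: "band_mass \<alpha> B (int k) < top"
  shows "real (card J) * 2 powr (- \<alpha> * k) \<le> 2 powr \<alpha> * enn2real (band_mass \<alpha> B (int k))"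
proof -
  have lower: "2 powr (- \<alpha> * k) \<le> 2 powr \<alpha> * diameter (B j) powr \<alpha>" if "j \<in> J" for j
  proof -
    have "2 powr (- real k - 1) \<le> diameter (B j)" using J(2)[OF that] by (auto simp: dyadic_band_def)
    then have "(2 powr (- real k - 1)) powr \<alpha>
        \<le> diameter (B j) powr \<alpha>" using \<alpha> by (intro powr_mono2) auto
    then have "2 powr \<alpha> * 2 powr ((- real k - 1) * \<alpha>) \<le> 2 powr \<alpha> * diameter (B j) powr \<alpha>"
      unfolding powr_powr by (intro mult_left_mono) auto
    then show ?thesis by (simp add: powr_add[symmetric] algebra_simps)
  qed
  have "ennreal (\<Sum>j\<in>J. diameter (B j) powr \<alpha>)
      = (\<Sum>j\<in>J. if diameter (B j) \<in> dyadic_band (int k) then ennreal (diameter (B j) powr \<alpha>) else 0)"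
    using J(2) by (subst sum_ennreal[symmetric]) (auto intro: sum.cong)
  also have "\<dots> \<le> band_mass \<alpha> B (int k)" unfolding band_mass_def by (rule sum_le_nnsum[OF J(1)])
  also have "\<dots> = ennreal (enn2real (band_mass \<alpha> B (int k)))" using finite by simp
  finally have "(\<Sum>j\<in>J. diameter (B j) powr \<alpha>) \<le> enn2real (band_mass \<alpha> B (int k))" by simp
  then have "(\<Sum>j\<in>J. 2 powr \<alpha> * diameter (B j) powr \<alpha>) \<le> 2 powr \<alpha> * enn2real (band_mass \<alpha> B (int k))"
    unfolding sum_distrib_left[symmetric] by (rule mult_left_mono) simp
  moreover have "(\<Sum>j\<in>J. 2 powr (- \<alpha> * k)) \<le> (\<Sum>j\<in>J. 2 powr \<alpha> * diameter (B j) powr \<alpha>)"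
    by (intro sum_mono lower)
  ultimately show ?thesis by simp
qed

lemma dyadic_band_exists:
  assumes "0 < x" shows "\<exists>k. x \<in> dyadic_band k"
proof -
  define k where "k = \<lceil>- log 2 x\<rceil> - 1"
  have k: "- real_of_int k - 1 \<le> log 2 x" "log 2 x < - real_of_int k"
    unfolding k_def using ceiling_correct[of "- log 2 x"] by (simp_all, linarith+)
  have "2 powr (- real_of_int k - 1) \<le> 2 powr log 2 x" "2 powr log 2 x < 2 powr (- real_of_int k)"
    using k by (auto intro: powr_mono powr_less_mono)
  then show ?thesis using assms by (auto simp: dyadic_band_def)
qed

text \<open>Sets of diameter zero lie in no dyadic band, so they are given pairwise distinct scales.\<close>

lemma cover_scales_exist:
  fixes B :: "nat \<Rightarrow> 'a::metric_space set"
  assumes B: "\<And>j. bounded (B j)" "\<And>j. diameter (B j) < 1 / 2 ^ K"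
  obtains \<kappa> :: "nat \<Rightarrow> nat" where "\<And>j. K \<le> \<kappa> j" "\<And>j. diameter (B j) \<le> 1 / 2 ^ \<kappa> j"
    "\<And>j. diameter (B j) = 0 \<Longrightarrow> \<kappa> j = K + j"
    "\<And>j. diameter (B j) \<noteq> 0 \<Longrightarrow> diameter (B j) \<in> dyadic_band (int (\<kappa> j))"
proof -
  have "\<exists>k\<ge>K. diameter (B j) \<le> 1 / 2 ^ k \<and> (diameter (B j) = 0 \<longrightarrow> k = K + j) \<and>
      (diameter (B j) \<noteq> 0 \<longrightarrow> diameter (B j) \<in> dyadic_band (int k))" for j
  proof (cases "diameter (B j) = 0")
    case True
    then show ?thesis by (intro exI[of _ "K + j"]) auto
  next
    case False
    then have "0 < diameter (B j)" using diameter_ge_0[OF B(1)[of j]] by simp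
    then obtain m where m: "diameter (B j) \<in> dyadic_band m" using dyadic_band_exists by blast
    then have "2 powr (- real_of_int m - 1) < 1 / 2 ^ K"
      using B(2)[of j] by (auto simp: dyadic_band_def)
    also have "1 / 2 ^ K = 2 powr (- real K)" by (simp add: powr_minus powr_realpow inverse_eq_divide)
    finally have "int K \<le> m" by simp
    then obtain k where k: "m = int k" "K \<le> k"
      by (metis nat_0_le nat_int of_nat_0_le_iff order_trans zle_int)
    then have "diameter (B j) < 2 powr (- real k)" using m by (simp add: dyadic_band_def)
    then show ?thesis
      using False m k by (intro exI[of _ k]) (simp add: powr_minus powr_realpow inverse_eq_divide)
  qed
  then show ?thesis using that by metis
qed

definition scale_cost :: "real \<Rightarrow> (nat \<Rightarrow> real) \<Rightarrow> ('i \<Rightarrow> nat) \<Rightarrow> 'i set \<Rightarrow> real" where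
  "scale_cost \<alpha> w \<kappa> J = (\<Sum>k\<in>\<kappa> ` J. w k * sqrt (real (card {j\<in>J. \<kappa> j = k}) * 2 powr (- \<alpha> * k)))"

lemma scale_cost_eq_sum:
  assumes "finite F" "\<kappa> ` J \<subseteq> F"
  shows "scale_cost \<alpha> w \<kappa> J = (\<Sum>k\<in>F. w k * sqrt (real (card {j\<in>J. \<kappa> j = k}) * 2 powr (- \<alpha> * k)))"
  unfolding scale_cost_def
proof (rule sum.mono_neutral_left[OF assms], rule ballI)
  fix k assume "k \<in> F - \<kappa> ` J"
  then have "{j\<in>J. \<kappa> j = k} = {}" by auto
  then show "w k * sqrt (real (card {j\<in>J. \<kappa> j = k}) * 2 powr (- \<alpha> * k))
      = 0" by (simp only: card.empty) simp
qed

lemma scale_cost_image: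
  assumes "inj_on f J"
  shows "scale_cost \<alpha> w \<kappa> (f ` J) = scale_cost \<alpha> w (\<kappa> \<circ> f) J"
proof -
  have "card {j \<in> f ` J. \<kappa> j = k} = card {j\<in>J. (\<kappa> \<circ> f) j = k}" for k
  proof -
    have "{j \<in> f ` J. \<kappa> j = k} = f ` {j\<in>J. (\<kappa> \<circ> f) j = k}" by auto
    then show ?thesis using assms by (simp add: card_image inj_on_subset)
  qed
  then show ?thesis by (simp add: scale_cost_def image_comp)
qed

lemma scale_cost_UN_le:
  assumes w: "\<And>k. 0 \<le> w k" and I: "finite I" "\<And>i. i \<in> I \<Longrightarrow> finite (J i)"
  shows "scale_cost \<alpha> w \<kappa> (\<Union>i\<in>I. J i) \<le> (\<Sum>i\<in>I. scale_cost \<alpha> w \<kappa> (J i))"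
proof -
  let ?F = "\<kappa> ` (\<Union>i\<in>I. J i)"
  have F: "finite ?F" using I by auto
  have "scale_cost \<alpha> w \<kappa> (\<Union>i\<in>I. J i)
      \<le> (\<Sum>k\<in>?F. \<Sum>i\<in>I. w k * sqrt (real (card {j\<in>J i. \<kappa> j = k}) * 2 powr (- \<alpha> * k)))"
    unfolding scale_cost_def
  proof (rule sum_mono)
    fix k
    have "{j \<in> (\<Union>i\<in>I. J i). \<kappa> j = k} = (\<Union>i\<in>I. {j\<in>J i. \<kappa> j = k})" by auto
    then have "card {j \<in> (\<Union>i\<in>I. J i). \<kappa> j = k} \<le> (\<Sum>i\<in>I. card {j\<in>J i. \<kappa> j = k})"
      using card_UN_le[OF I(1), of "\<lambda>i. {j\<in>J i. \<kappa> j = k}"] by simp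
    then have "sqrt (real (card {j \<in> (\<Union>i\<in>I. J i). \<kappa> j = k}) * 2 powr (- \<alpha> * k))
        \<le> sqrt (real (\<Sum>i\<in>I. card {j\<in>J i. \<kappa> j = k}) * 2 powr (- \<alpha> * k))"
      by (intro real_sqrt_le_mono mult_right_mono) (simp_all only: of_nat_le_iff powr_ge_zero)
    also have "\<dots> \<le> (\<Sum>i\<in>I. sqrt (real (card {j\<in>J i. \<kappa> j = k}) * 2 powr (- \<alpha> * k)))"
      unfolding of_nat_sum sum_distrib_right by (rule sqrt_sum_le) simp
    finally show "w k * sqrt (real (card {j \<in> (\<Union>i\<in>I. J i). \<kappa> j = k}) * 2 powr (- \<alpha> * k))
        \<le> (\<Sum>i\<in>I. w k * sqrt (real (card {j\<in>J i. \<kappa> j = k}) * 2 powr (- \<alpha> * k)))"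
      unfolding sum_distrib_left[symmetric] by (intro mult_left_mono w)
  qed
  also have "\<dots> = (\<Sum>i\<in>I. \<Sum>k\<in>?F. w k * sqrt (real (card {j\<in>J i. \<kappa> j = k}) * 2 powr (- \<alpha> * k)))"
    by (rule sum.swap)
  also have "\<dots> = (\<Sum>i\<in>I. scale_cost \<alpha> w \<kappa> (J i))"
    by (intro sum.cong refl scale_cost_eq_sum[symmetric] F) auto
  finally show ?thesis .
qed

lemma card_scale_le:
  fixes B :: "nat \<Rightarrow> 'a::metric_space set"
  assumes \<alpha>: "0 < \<alpha>" and "finite J" and mass: "band_mass \<alpha> B (int k) < top"
    and zero: "\<And>j. diameter (B j) = 0 \<Longrightarrow> \<kappa> j = K + j"
    and band: "\<And>j. diameter (B j) \<noteq> 0 \<Longrightarrow> diameter (B j) \<in> dyadic_band (int (\<kappa> j))"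
  shows "real (card {j\<in>J. \<kappa> j = k}) * 2 powr (- \<alpha> * k)
    \<le> 2 powr (- \<alpha> * k) + 2 powr \<alpha> * enn2real (band_mass \<alpha> B (int k))"
proof -
  let ?Z = "{j\<in>J. \<kappa> j = k \<and> diameter (B j) = 0}" and ?P = "{j\<in>J. \<kappa> j = k \<and> diameter (B j) \<noteq> 0}"
  have "?Z \<subseteq> {k - K}" using zero by auto
  then have "card ?Z \<le> 1" using card_mono[of "{k - K}" ?Z] by simp
  moreover have "{j\<in>J. \<kappa> j = k} = ?Z \<union> ?P" by auto
  ultimately have "real (card {j\<in>J. \<kappa> j = k}) \<le> 1 + real (card ?P)"
    using card_Un_le[of ?Z ?P] by simp
  then have "real (card {j\<in>J. \<kappa> j = k}) * 2 powr (- \<alpha> * k) \<le> (1 + real (card ?P)) * 2 powr (- \<alpha> * k)"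
    by (intro mult_right_mono) auto
  moreover have "real (card ?P) * 2 powr (- \<alpha> * k) \<le> 2 powr \<alpha> * enn2real (band_mass \<alpha> B (int k))"
    using band \<open>finite J\<close> by (intro card_band_le \<alpha> mass) auto
  ultimately show ?thesis by (simp add: algebra_simps)
qed

lemma scale_cost_cover_le:
  fixes B :: "nat \<Rightarrow> 'a::metric_space set"
  assumes \<alpha>: "0 < \<alpha>" and w: "\<And>k. 0 \<le> w k" "\<And>k. K \<le> k \<Longrightarrow> w k \<le> 1"
    and J: "finite J" "\<kappa> ` J \<subseteq> {K..<N}" and mass: "\<And>k. band_mass \<alpha> B k < top"
    and zero: "\<And>j. diameter (B j) = 0 \<Longrightarrow> \<kappa> j = K + j"
    and band: "\<And>j. diameter (B j) \<noteq> 0 \<Longrightarrow> diameter (B j) \<in> dyadic_band (int (\<kappa> j))"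
  shows "scale_cost \<alpha> w \<kappa> J \<le> (\<Sum>k=K..<N. (2 powr (- \<alpha> / 2)) ^ k)
    + sqrt (2 powr \<alpha>) * (\<Sum>k=K..<N. w k * sqrt (enn2real (band_mass \<alpha> B (int k))))"
proof -
  let ?A = "\<lambda>k. enn2real (band_mass \<alpha> B (int k))" and ?r = "2 powr (- \<alpha> / 2)" and ?c = "sqrt (2 powr \<alpha>)"
  have "scale_cost \<alpha> w \<kappa> J = (\<Sum>k=K..<N. w k * sqrt (real (card {j\<in>J. \<kappa> j = k}) * 2 powr (- \<alpha> * k)))"
    by (intro scale_cost_eq_sum J(2)) simp
  also have "\<dots> \<le> (\<Sum>k=K..<N. ?r ^ k + ?c * (w k * sqrt (?A k)))"
  proof (rule sum_mono)
    fix k assume k: "k \<in> {K..<N}"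
    have "w k * sqrt (real (card {j\<in>J. \<kappa> j = k}) * 2 powr (- \<alpha> * k))
        \<le> w k * (?r ^ k + ?c * sqrt (?A k))"
    proof (intro mult_left_mono w)
      have "sqrt (real (card {j\<in>J. \<kappa> j = k}) * 2 powr (- \<alpha> * k))
          \<le> sqrt (2 powr (- \<alpha> * k) + 2 powr \<alpha> * ?A k)"
        by (intro real_sqrt_le_mono card_scale_le[OF \<alpha> J(1) mass zero band])
      also have "\<dots> \<le> sqrt (2 powr (- \<alpha> * k)) + sqrt (2 powr \<alpha> * ?A k)"
        by (intro sqrt_add_le_add_sqrt) auto
      also have "sqrt (2 powr (- \<alpha> * k)) = ?r ^ k"
        by (simp add: powr_half_sqrt[symmetric] powr_powr powr_power mult_ac)
      finally show "sqrt (real (card {j\<in>J. \<kappa> j = k}) * 2 powr (- \<alpha> * k)) \<le> ?r ^ k + ?c * sqrt (?A k)"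
        by (simp add: real_sqrt_mult)
    qed
    also have "\<dots> = w k * ?r ^ k + ?c * (w k * sqrt (?A k))" by (simp add: algebra_simps)
    also have "w k * ?r ^ k \<le> 1 * ?r ^ k" using w(2) k by (intro mult_right_mono) auto
    finally show "w k * sqrt (real (card {j\<in>J. \<kappa> j = k}) * 2 powr (- \<alpha> * k))
        \<le> ?r ^ k + ?c * (w k * sqrt (?A k))"
      by simp
  qed
  finally show ?thesis by (simp add: sum.distrib sum_distrib_left)
qed

lemma NH_cap_cover:
  assumes "NH_cap \<alpha> \<beta> F < ennreal H" "0 < \<delta>"
  obtains B where "F \<subseteq> (\<Union>j. B j)" "\<And>j. bounded (B j)" "\<And>j. diameter (B j) < \<delta>" "cover_cost \<alpha> \<beta> B < ennreal H"
proof -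
  have "NH_cap_delta \<alpha> \<beta> F \<delta> \<le> NH_cap \<alpha> \<beta> F"
    unfolding NH_cap_def using assms(2) by (intro SUP_upper) simp
  also have "\<dots> < ennreal H" by (rule assms(1))
  finally show ?thesis unfolding NH_cap_delta_def INF_less_iff using that by blast
qed

lemma cover_subset_UN_ball:
  fixes B :: "nat \<Rightarrow> 'a::metric_space set"
  assumes "F \<subseteq> (\<Union>j. B j)" and B: "\<And>j. bounded (B j)" "\<And>j. diameter (B j) < r j"
  shows "F \<subseteq> (\<Union>j. ball (SOME x. x \<in> B j) (r j))"
proof
  fix x assume "x \<in> F"
  then obtain j where j: "x \<in> B j" using assms(1) by blast
  have "dist (SOME x. x \<in> B j) x \<le> diameter (B j)"
    using someI[of "\<lambda>x. x \<in> B j", OF j] j by (intro diameter_bounded_bound B(1))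
  also have "\<dots> < r j" by (rule B(2))
  finally show "x \<in> (\<Union>j. ball (SOME x. x \<in> B j) (r j))" by auto
qed

lemma summable_powr_eventually_le_1:
  fixes w :: "nat \<Rightarrow> real"
  assumes "summable (\<lambda>k. w k powr q)" "0 \<le> q"
  shows "\<forall>\<^sub>F k in sequentially. w k \<le> 1"
proof -
  have "\<forall>\<^sub>F k in sequentially. w k powr q < 1"
    by (rule order_tendstoD(2)[OF summable_LIMSEQ_zero[OF assms(1)] zero_less_one])
  then show ?thesis
  proof eventually_elim
    case (elim k)
    then show ?case using ge_one_powr_ge_zero[of "w k" q] assms(2) by (cases "1 \<le> w k") auto
  qed
qed

lemma scale_threshold_exists:
  fixes w :: "nat \<Rightarrow> real" and q \<alpha> H \<epsilon> :: real
  assumes \<alpha>: "0 < \<alpha>" and q: "1 \<le> q" and w: "\<And>k. 0 \<le> w k" "summable (\<lambda>k. w k powr q)"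
    and H: "0 \<le> H" and \<epsilon>: "0 < \<epsilon>"
  obtains K where "\<And>k. K \<le> k \<Longrightarrow> w k \<le> 1"
    "\<And>n a. (\<And>k. 0 \<le> a k) \<Longrightarrow> dual_bounded q H a \<Longrightarrow>
      (\<Sum>k=K..<n. (2 powr (- \<alpha> / 2)) ^ k) + sqrt (2 powr \<alpha>) * (\<Sum>k=K..<n. w k * a k) \<le> \<epsilon>"
proof -
  let ?c = "sqrt (2 powr \<alpha>)" and ?r = "2 powr (- \<alpha> / 2)"
  have "0 < \<epsilon> / (2 * ?c)" using \<epsilon> by auto
  then obtain K1 where pairing: "\<And>m n a. K1 \<le> m \<Longrightarrow> (\<And>k. 0 \<le> a k) \<Longrightarrow> dual_bounded q H a \<Longrightarrow>
      (\<Sum>k=m..<n. w k * a k) \<le> \<epsilon> / (2 * ?c)"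
    using dual_pairing_tail_small[OF q w H] by blast
  have "summable (\<lambda>k. ?r ^ k)" using \<alpha> by (intro summable_geometric) (simp add: powr_less_one)
  then obtain K2 where geometric: "\<And>m n. K2 \<le> m \<Longrightarrow> (\<Sum>k=m..<n. ?r ^ k) \<le> \<epsilon> / 2"
    using summable_tail_le[of "\<lambda>k. ?r ^ k" "\<epsilon> / 2"] \<epsilon> by auto
  obtain K3 where w_le_1: "\<And>k. K3 \<le> k \<Longrightarrow> w k \<le> 1"
    using summable_powr_eventually_le_1[OF w(2)] q unfolding eventually_sequentially by auto
  show ?thesis
  proof
    show "w k \<le> 1" if "max K1 (max K2 K3) \<le> k" for k using w_le_1 that by simp
    fix n and a :: "nat \<Rightarrow> real" assume a: "\<And>k. 0 \<le> a k" "dual_bounded q H a"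
    have "(\<Sum>k=max K1 (max K2 K3)..<n. ?r ^ k) + ?c * (\<Sum>k=max K1 (max K2 K3)..<n. w k * a k)
        \<le> \<epsilon> / 2 + ?c * (\<epsilon> / (2 * ?c))"
      by (intro add_mono geometric mult_left_mono pairing a) auto
    then show "(\<Sum>k=max K1 (max K2 K3)..<n. ?r ^ k) + ?c * (\<Sum>k=max K1 (max K2 K3)..<n. w k * a k)
        \<le> \<epsilon>" by simp
  qed
qed

lemma NH_cap_weighted_cover:
  fixes F :: "'a::metric_space set" and w :: "nat \<Rightarrow> real" and q \<alpha> \<epsilon> :: real
  assumes \<alpha>: "0 < \<alpha>" and q: "1 \<le> q" and cap: "NH_cap \<alpha> (dual_exp q / 2) F < top"
    and w: "\<And>k. 0 \<le> w k" "summable (\<lambda>k. w k powr q)" and \<epsilon>: "0 < \<epsilon>"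
  shows "\<exists>(y :: nat \<Rightarrow> 'a) (\<kappa> :: nat \<Rightarrow> nat).
    F \<subseteq> (\<Union>j. ball (y j) (2 / 2 ^ \<kappa> j)) \<and> (\<forall>J. finite J \<longrightarrow> scale_cost \<alpha> w \<kappa> J \<le> \<epsilon>)"
proof -
  obtain H where H: "1 \<le> H" "NH_cap \<alpha> (dual_exp q / 2) F < ennreal H"
  proof -
    obtain H where "NH_cap \<alpha> (dual_exp q / 2) F = ennreal H" "0 \<le> H"
      using cap by (cases "NH_cap \<alpha> (dual_exp q / 2) F") auto
    then show ?thesis by (intro that[of "H + 1"]) (auto simp: ennreal_less_iff)
  qed
  then have "0 \<le> H" by simp
  from scale_threshold_exists[OF \<alpha> q w this \<epsilon>] obtain K where w_le_1: "\<And>k. K \<le> k \<Longrightarrow> w k \<le> 1"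
    and tail_le: "\<And>n a. (\<And>k. 0 \<le> a k) \<Longrightarrow> dual_bounded q H a \<Longrightarrow>
      (\<Sum>k=K..<n. (2 powr (- \<alpha> / 2)) ^ k) + sqrt (2 powr \<alpha>) * (\<Sum>k=K..<n. w k * a k) \<le> \<epsilon>"
    by blast
  obtain B where B: "F \<subseteq> (\<Union>j. B j)" "\<And>j. bounded (B j)" "\<And>j. diameter (B j) < 1 / 2 ^ K"
    and cost: "cover_cost \<alpha> (dual_exp q / 2) B < ennreal H"
    using NH_cap_cover[OF H(2), of "1 / 2 ^ K"] by auto
  obtain \<kappa> where \<kappa>: "\<And>j. K \<le> \<kappa> j" "\<And>j. diameter (B j) \<le> 1 / 2 ^ \<kappa> j"
    "\<And>j. diameter (B j) = 0 \<Longrightarrow> \<kappa> j = K + j"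
    "\<And>j. diameter (B j) \<noteq> 0 \<Longrightarrow> diameter (B j) \<in> dyadic_band (int (\<kappa> j))"
    by (rule cover_scales_exist[OF B(2,3)], rule that)
  have mass: "band_mass \<alpha> B k < top" for k
    using cost by (intro band_mass_finite[of \<alpha> q]) (auto intro: less_trans)
  have "diameter (B j) < 2 / 2 ^ \<kappa> j" for j
    using \<kappa>(2)[of j] by (rule le_less_trans) (simp add: divide_strict_right_mono)
  then have "F \<subseteq> (\<Union>j. ball (SOME x. x \<in> B j) (2 / 2 ^ \<kappa> j))" by (rule cover_subset_UN_ball[OF B(1,2)])
  moreover have "scale_cost \<alpha> w \<kappa> J \<le> \<epsilon>" if J: "finite J" for J
  proof -
    obtain N where "\<kappa> ` J \<subseteq> {..<N}" using finite_nat_bounded[of "\<kappa> ` J"] J by auto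
    then have "\<kappa> ` J \<subseteq> {K..<N}" using \<kappa>(1) by fastforce
    then have "scale_cost \<alpha> w \<kappa> J \<le> (\<Sum>k=K..<N. (2 powr (- \<alpha> / 2)) ^ k)
        + sqrt (2 powr \<alpha>) * (\<Sum>k=K..<N. w k * sqrt (enn2real (band_mass \<alpha> B (int k))))"
      using \<kappa> w_le_1 by (intro scale_cost_cover_le \<alpha> w J mass)
    also have "\<dots> \<le> \<epsilon>"
      by (intro tail_le dual_bounded_sqrt_band_mass[OF q less_imp_le[OF cost] H(1)]) simp
    finally show ?thesis .
  qed
  ultimately show ?thesis by (intro exI conjI allI impI)
qed

lemma sigma_finite_weighted_cover:
  fixes S :: "'a::metric_space set" and w :: "nat \<Rightarrow> real" and q \<alpha> \<epsilon> :: real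
  assumes \<alpha>: "0 < \<alpha>" and q: "1 \<le> q" and S: "compact S" "sigma_finite_NH \<alpha> (dual_exp q / 2) S"
    and w: "\<And>k. 0 \<le> w k" "summable (\<lambda>k. w k powr q)" and \<epsilon>: "0 < \<epsilon>"
  obtains P :: "(nat \<times> nat) set" and y :: "nat \<times> nat \<Rightarrow> 'a" and \<kappa> :: "nat \<times> nat \<Rightarrow> nat"
  where "finite P" "S \<subseteq> (\<Union>p\<in>P. ball (y p) (2 / 2 ^ \<kappa> p))" "scale_cost \<alpha> w \<kappa> P \<le> \<epsilon>"
proof -
  obtain Si :: "nat \<Rightarrow> 'a set" where Si: "S = (\<Union>i. Si i)" "\<And>i. NH_cap \<alpha> (dual_exp q / 2) (Si i) < top"
    using S(2) unfolding sigma_finite_NH_def by blast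
  define good where "good i y \<kappa> \<longleftrightarrow> Si i \<subseteq> (\<Union>j. ball (y j) (2 / 2 ^ \<kappa> j)) \<and>
      (\<forall>J. finite J \<longrightarrow> scale_cost \<alpha> w \<kappa> J \<le> \<epsilon> * (1 / 2) ^ Suc i)"
    for i and y :: "nat \<Rightarrow> 'a" and \<kappa> :: "nat \<Rightarrow> nat"
  have "\<exists>y \<kappa>. good i y \<kappa>" for i
  proof -
    have "0 < \<epsilon> * (1 / 2) ^ Suc i" using \<epsilon> by simp
    then show ?thesis unfolding good_def by (rule NH_cap_weighted_cover[OF \<alpha> q Si(2) w])
  qed
  then obtain y \<kappa> where good: "\<And>i. good i (y i) (\<kappa> i)" by metis
  have y: "Si i \<subseteq> (\<Union>j. ball (y i j) (2 / 2 ^ \<kappa> i j))"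
    and \<kappa>: "finite J \<Longrightarrow> scale_cost \<alpha> w (\<kappa> i) J \<le> \<epsilon> * (1 / 2) ^ Suc i" for i J
    using good[of i] by (simp_all add: good_def)
  let ?y = "\<lambda>(i, j). y i j" and ?\<kappa> = "\<lambda>(i, j). \<kappa> i j"
  have "S \<subseteq> (\<Union>p. ball (?y p) (2 / 2 ^ ?\<kappa> p))" using Si(1) y by fastforce
  then obtain P where P: "finite P" "S \<subseteq> (\<Union>p\<in>P. ball (?y p) (2 / 2 ^ ?\<kappa> p))"
    using compactE_image[OF S(1), of UNIV "\<lambda>p. ball (?y p) (2 / 2 ^ ?\<kappa> p)"] by auto
  define J where "J i = {j. (i, j) \<in> P}" for i
  have J: "finite (J i)" for i
    using finite_subset[of "J i" "snd ` P"] P(1) by (force simp: J_def)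
  have "P = (\<Union>i\<in>fst ` P. Pair i ` J i)" by (force simp: J_def)
  then have "scale_cost \<alpha> w ?\<kappa> P \<le> (\<Sum>i\<in>fst ` P. scale_cost \<alpha> w ?\<kappa> (Pair i ` J i))"
    using scale_cost_UN_le[of w "fst ` P" "\<lambda>i. Pair i ` J i" \<alpha> ?\<kappa>] w(1) P(1) J by simp
  also have "\<dots> = (\<Sum>i\<in>fst ` P. scale_cost \<alpha> w (\<kappa> i) (J i))"
    by (intro sum.cong refl) (simp add: scale_cost_image inj_on_def o_def)
  also have "\<dots> \<le> (\<Sum>i\<in>fst ` P. \<epsilon> * (1 / 2) ^ Suc i)" by (intro sum_mono \<kappa> J)
  also have "\<dots> \<le> (\<Sum>i. \<epsilon> * (1 / 2) ^ Suc i)"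
    using \<epsilon> P(1) power_half_series by (intro sum_le_suminf summable_mult sums_summable) auto
  also have "\<dots> = \<epsilon>"
    using sums_unique[OF sums_mult[OF power_half_series, of \<epsilon>]] by simp
  finally show ?thesis using P by (intro that)
qed

section \<open>Localisation of test functions to the covering\<close>

definition near_cubes :: "real \<Rightarrow> 'a::euclidean_space \<Rightarrow> ('a \<Rightarrow> int) set" where
  "near_cubes r y = {n \<in> extensional Basis. \<forall>b\<in>Basis. \<bar>r * (y \<bullet> b) - of_int (n b)\<bar> \<le> 3}"

lemma near_cubes_card:
  fixes y :: "'a::euclidean_space"
  shows "finite (near_cubes r y)" and "card (near_cubes r y) \<le> 7 ^ DIM('a)"
proof -
  define F where "F b = {\<lceil>r * (y \<bullet> b) - 3\<rceil>..\<lfloor>r * (y \<bullet> b) + 3\<rfloor>}" for b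
  have sub: "near_cubes r y \<subseteq> PiE Basis F"
  proof
    fix n assume n: "n \<in> near_cubes r y"
    have "n b \<in> F b" if "b \<in> Basis" for b
    proof -
      have "\<bar>r * (y \<bullet> b) - of_int (n b)\<bar> \<le> 3" using n that by (simp add: near_cubes_def)
      then have "r * (y \<bullet> b) - 3 \<le> of_int (n b)" "of_int (n b) \<le> r * (y \<bullet> b) + 3" by linarith+
      then show ?thesis unfolding F_def atLeastAtMost_iff ceiling_le_iff le_floor_iff by blast
    qed
    then show "n \<in> PiE Basis F" using n by (simp add: near_cubes_def PiE_def Pi_def)
  qed
  have fin: "finite (PiE Basis F)" by (intro finite_PiE) (auto simp: F_def)
  show "finite (near_cubes r y)" by (rule finite_subset[OF sub fin])
  have "card (F b) \<le> 7" for b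
  proof -
    have "\<lfloor>r * (y \<bullet> b) + 3\<rfloor> - \<lceil>r * (y \<bullet> b) - 3\<rceil> \<le> 6" by linarith
    then show ?thesis unfolding F_def card_atLeastAtMost_int nat_le_iff by linarith
  qed
  then have "card (PiE Basis F) \<le> 7 ^ DIM('a)"
    unfolding card_PiE[OF finite_Basis] using prod_mono[of Basis "\<lambda>b. card (F b)" "\<lambda>_. 7"] by simp
  then show "card (near_cubes r y) \<le> 7 ^ DIM('a)" using card_mono[OF fin sub] by simp
qed

lemma near_cubes_mem:
  fixes x y :: "'a::euclidean_space"
  assumes r: "0 < r" and x: "x \<in> ball y (2 / r)" "x \<in> grid_cube r n" and n: "n \<in> extensional Basis"
  shows "n \<in> near_cubes r y"
proof -
  have "\<bar>r * (y \<bullet> b) - of_int (n b)\<bar> \<le> 3" if "b \<in> Basis" for b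
  proof -
    have "\<bar>(y - x) \<bullet> b\<bar> \<le> norm (y - x)" using that by (rule Basis_le_norm)
    also have "\<dots> \<le> 2 / r" using x(1) by (simp add: dist_norm)
    finally have "\<bar>r * ((y - x) \<bullet> b)\<bar> \<le> 2" using r by (simp add: abs_mult field_simps)
    moreover have "r * (y \<bullet> b) - of_int (n b) = r * ((y - x) \<bullet> b) + (r * (x \<bullet> b) - of_int (n b))"
      by (simp add: algebra_simps)
    moreover have "\<bar>r * (x \<bullet> b) - of_int (n b)\<bar> \<le> 1" using x(2) that by (simp add: grid_cube_def)
    ultimately show ?thesis by linarith
  qed
  then show ?thesis using n by (simp add: near_cubes_def)
qed

definition cover_cubes :: "'i set \<Rightarrow> ('i \<Rightarrow> 'a::euclidean_space) \<Rightarrow> ('i \<Rightarrow> nat) \<Rightarrow> nat \<Rightarrow> ('a \<Rightarrow> int) set" where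
  "cover_cubes P y \<kappa> k = (\<Union>p\<in>{p\<in>P. \<kappa> p = k}. near_cubes (2 ^ k) (y p))"

lemma grid_indices_cover_cubes: "finite P \<Longrightarrow> grid_indices (cover_cubes P y \<kappa> k)"
  using near_cubes_card(1) by (auto simp: grid_indices_def cover_cubes_def near_cubes_def)

lemma card_cover_cubes_le:
  fixes y :: "'i \<Rightarrow> 'a::euclidean_space"
  assumes "finite P"
  shows "card (cover_cubes P y \<kappa> k) \<le> card {p\<in>P. \<kappa> p = k} * 7 ^ DIM('a)"
proof -
  have "card (cover_cubes P y \<kappa> k) \<le> (\<Sum>p\<in>{p\<in>P. \<kappa> p = k}. card (near_cubes (2 ^ k) (y p)))"
    unfolding cover_cubes_def using assms by (intro card_UN_le) auto
  also have "\<dots> \<le> (\<Sum>p\<in>{p\<in>P. \<kappa> p = k}. 7 ^ DIM('a))" by (intro sum_mono near_cubes_card(2))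
  finally show ?thesis by simp
qed

lemma cube_cutoff_cover_cubes_eq_1:
  assumes "finite P" "p \<in> P" "x \<in> ball (y p) (2 / 2 ^ \<kappa> p)"
  shows "cube_cutoff (2 ^ \<kappa> p) (cover_cubes P y \<kappa> (\<kappa> p)) x = 1"
proof (rule cube_cutoff_eq_1[OF grid_indices_cover_cubes[OF assms(1)]])
  fix n assume "n \<in> extensional Basis" "x \<in> grid_cube (2 ^ \<kappa> p) n"
  then have "n \<in> near_cubes (2 ^ \<kappa> p) (y p)" using assms(3) by (intro near_cubes_mem) auto
  then show "n \<in> cover_cubes P y \<kappa> (\<kappa> p)" using assms(2) by (auto simp: cover_cubes_def)
qed

definition cutoff_remainder :: "(nat \<Rightarrow> ('a::euclidean_space \<Rightarrow> int) set) \<Rightarrow> nat \<Rightarrow> 'a \<Rightarrow> complex" where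
  "cutoff_remainder Q N x = (\<Prod>l<N. 1 - cube_cutoff (2 ^ l) (Q l) x)"

lemma smooth_cutoff_remainder: "smooth_fun (cutoff_remainder Q N)"
  unfolding cutoff_remainder_def[abs_def]
  by (intro smooth_fun_prod smooth_fun_diff smooth_cube_cutoff smooth_fun_const)

lemma test_fun_off_cutoff_remainder:
  assumes \<psi>: "test_fun \<psi>" and P: "finite P" "S \<subseteq> (\<Union>p\<in>P. ball (y p) (2 / 2 ^ \<kappa> p))" "\<kappa> ` P \<subseteq> {..<N}"
  shows "test_fun_off S (\<lambda>x. \<psi> x * cutoff_remainder (cover_cubes P y \<kappa>) N x)"
proof (rule test_fun_offI[OF _ _ P(2)])
  show "test_fun (\<lambda>x. \<psi> x * cutoff_remainder (cover_cubes P y \<kappa>) N x)"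
    by (intro test_fun_mult \<psi> smooth_cutoff_remainder)
  fix x assume "x \<in> (\<Union>p\<in>P. ball (y p) (2 / 2 ^ \<kappa> p))"
  then obtain p where p: "p \<in> P" "x \<in> ball (y p) (2 / 2 ^ \<kappa> p)" by blast
  then have "cutoff_remainder (cover_cubes P y \<kappa>) N x = 0"
    unfolding cutoff_remainder_def
    using P(3) cube_cutoff_cover_cubes_eq_1[of P p x y \<kappa>] P(1)
    by (intro prod_zero bexI[of _ "\<kappa> p"]) auto
  then show "\<psi> x * cutoff_remainder (cover_cubes P y \<kappa>) N x = 0" by simp
qed auto

lemma inv_fourier_layer_decomposition:
  assumes \<psi>: "test_fun \<psi>"
  shows "inv_fourier \<psi> \<xi> = inv_fourier (\<lambda>x. \<psi> x * cutoff_remainder Q N x) \<xi>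
    + (\<Sum>k<N. inv_fourier (\<lambda>x. \<psi> x * cutoff_layer Q k x) \<xi>)"
proof -
  have remainder: "integrable lborel (\<lambda>x. \<psi> x * cutoff_remainder Q N x)"
    by (intro test_fun_integrable test_fun_mult \<psi> smooth_cutoff_remainder)
  have layer: "integrable lborel (\<lambda>x. \<psi> x * cutoff_layer Q k x)" for k
    by (intro test_fun_integrable test_fun_mult \<psi> smooth_cutoff_layer)
  have "\<psi> = (\<lambda>x. \<psi> x * cutoff_remainder Q N x + (\<Sum>k<N. \<psi> x * cutoff_layer Q k x))"
    unfolding sum_distrib_left[symmetric] sum_cutoff_layer
    by (simp add: cutoff_remainder_def fun_eq_iff algebra_simps)
  then have "inv_fourier \<psi> \<xi> = inv_fourier (\<lambda>x. \<psi> x * cutoff_remainder Q N x + (\<Sum>k<N. \<psi> x * cutoff_layer Q k x)) \<xi>"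
    by (rule arg_cong)
  also have "\<dots> = inv_fourier (\<lambda>x. \<psi> x * cutoff_remainder Q N x) \<xi> + (\<Sum>k<N. inv_fourier (\<lambda>x. \<psi> x * cutoff_layer Q k x) \<xi>)"
    by (simp add: inv_fourier_add inv_fourier_sum remainder layer Bochner_Integration.integrable_sum)
  finally show ?thesis .
qed

lemma norm_pairing_le_sum_layers:
  fixes g \<psi> :: "'a::euclidean_space \<Rightarrow> complex"
  assumes g: "g \<in> borel_measurable borel" "0 \<le> t" "tail_energy lborel g t < \<infinity>" and \<psi>: "test_fun \<psi>"
    and remainder: "(\<integral>\<xi>. g \<xi> * inv_fourier (\<lambda>x. \<psi> x * cutoff_remainder Q N x) \<xi> \<partial>lborel) = 0"
  shows "cmod (\<integral>\<xi>. g \<xi> * inv_fourier \<psi> \<xi> \<partial>lborel)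
    \<le> (\<Sum>k<N. cmod (\<integral>\<xi>. g \<xi> * inv_fourier (\<lambda>x. \<psi> x * cutoff_layer Q k x) \<xi> \<partial>lborel))"
proof -
  let ?R = "\<lambda>\<xi>. g \<xi> * inv_fourier (\<lambda>x. \<psi> x * cutoff_remainder Q N x) \<xi>"
  let ?L = "\<lambda>k \<xi>. g \<xi> * inv_fourier (\<lambda>x. \<psi> x * cutoff_layer Q k x) \<xi>"
  have int: "integrable lborel ?R" "integrable lborel (?L k)" for k
    by (intro integrable_mult_inv_fourier[OF g(1) _ g(2,3)] test_fun_mult \<psi> smooth_cutoff_remainder smooth_cutoff_layer)+
  have "(\<integral>\<xi>. g \<xi> * inv_fourier \<psi> \<xi> \<partial>lborel) = (\<integral>\<xi>. ?R \<xi> + (\<Sum>k<N. ?L k \<xi>) \<partial>lborel)"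
    unfolding inv_fourier_layer_decomposition[OF \<psi>, of _ Q N] by (simp only: distrib_left sum_distrib_left)
  also have "\<dots> = (\<Sum>k<N. \<integral>\<xi>. ?L k \<xi> \<partial>lborel)"
    using int remainder by (simp add: Bochner_Integration.integral_add Bochner_Integration.integral_sum)
  finally show ?thesis by (simp add: norm_sum)
qed

lemma norm_mixed_deriv_op_layer_le:
  fixes \<psi> :: "'a::euclidean_space \<Rightarrow> complex"
  assumes \<psi>: "test_fun \<psi>" "\<And>x. mixed_deriv_norm 1 bs \<psi> x \<le> B" and B: "0 \<le> B"
    and Q: "\<And>l. grid_indices (Q l)" and bs: "set bs \<subseteq> Basis" "distinct bs"
  shows "cmod (mixed_deriv_op (1 / 2 ^ k) bs (\<lambda>x. \<psi> x * cutoff_layer Q k x) x)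
    \<le> B * layer_bound DIM('a) * indicator (\<Union>n\<in>Q k. grid_cube (2 ^ k) n) x"
proof -
  let ?f = "\<lambda>x. \<psi> x * cutoff_layer Q k x" and ?s = "1 / 2 ^ k :: real"
  let ?Z = "\<Union>n\<in>Q k. grid_cube (2 ^ k) n :: 'a set"
  have f: "smooth_fun ?f" by (intro smooth_fun_mult test_fun_smooth \<psi> smooth_cutoff_layer)
  have closed: "closed ?Z" using Q by (intro closed_UN) (auto simp: grid_indices_def grid_cube_eq_cbox)
  show ?thesis
  proof (cases "x \<in> ?Z")
    case True
    have "cmod (mixed_deriv_op ?s bs ?f x) \<le> mixed_deriv_norm ?s bs ?f x"
      by (intro norm_mixed_deriv_op_le f) simp
    also have "\<dots> \<le> mixed_deriv_norm ?s bs \<psi> x * mixed_deriv_norm ?s bs (cutoff_layer Q k) x"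
      by (intro mixed_deriv_norm_mult_le test_fun_smooth \<psi> smooth_cutoff_layer) simp
    also have "\<dots> \<le> B * layer_bound DIM('a)"
      using order_trans[OF mixed_deriv_norm_mono \<psi>(2), of ?s] B
      by (intro mult_mono mixed_deriv_norm_cutoff_layer_le Q bs mixed_deriv_norm_nonneg) auto
    finally show ?thesis using True by simp
  next
    case False
    have "mixed_deriv_norm ?s bs ?f x = 0"
    proof (rule mixed_deriv_norm_zero_on[of "- ?Z"])
      show "?f z = 0" if "z \<in> - ?Z" for z
        using that cube_cutoff_eq_0[of z "2 ^ k" "Q k"] by (simp add: cutoff_layer_def)
    qed (use open_Compl[OF closed] False in auto)
    then show ?thesis using norm_mixed_deriv_op_le[of ?s ?f bs x] f False by simp
  qed
qed

lemma emeasure_UN_grid_cube_le: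
  assumes "finite N" "0 < r"
  shows "emeasure lborel (\<Union>n\<in>N. grid_cube r n :: 'a::euclidean_space set)
      \<le> ennreal (real (card N) * (2 / r) ^ DIM('a))"
proof -
  have "emeasure lborel (\<Union>n\<in>N. grid_cube r n :: 'a set)
      \<le> (\<Sum>n\<in>N. emeasure lborel (grid_cube r n :: 'a set))"
    using assms by (intro emeasure_subadditive_finite) (auto simp: grid_cube_eq_cbox)
  then show ?thesis
    using assms by (simp add: emeasure_grid_cube ennreal_mult ennreal_of_nat_eq_real_of_nat)
qed

lemma nn_integral_mixed_deriv_op_layer_le:
  fixes \<psi> :: "'a::euclidean_space \<Rightarrow> complex"
  assumes \<psi>: "test_fun \<psi>" "\<And>x. mixed_deriv_norm 1 bs \<psi> x \<le> B" and B: "0 \<le> B"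
    and Q: "\<And>l. grid_indices (Q l)" and bs: "set bs \<subseteq> Basis" "distinct bs"
  shows "(\<integral>\<^sup>+x. ennreal ((cmod (mixed_deriv_op (1 / 2 ^ k) bs (\<lambda>x. \<psi> x * cutoff_layer Q k x) x))\<^sup>2) \<partial>lborel)
    \<le> ennreal ((B * layer_bound DIM('a) * sqrt (real (card (Q k)) * (2 / 2 ^ k) ^ DIM('a)))\<^sup>2)"
proof -
  let ?Df = "mixed_deriv_op (1 / 2 ^ k) bs (\<lambda>x. \<psi> x * cutoff_layer Q k x)" and ?L = "layer_bound DIM('a)"
  let ?Z = "\<Union>n\<in>Q k. grid_cube (2 ^ k) n :: 'a set"
  have finite: "finite (Q k)" using Q by (simp add: grid_indices_def)
  have "(\<integral>\<^sup>+x. ennreal ((cmod (?Df x))\<^sup>2) \<partial>lborel)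
      \<le> (\<integral>\<^sup>+x. ennreal ((B * ?L)\<^sup>2) * indicator ?Z x \<partial>lborel)"
  proof (rule nn_integral_mono)
    fix x
    have "(cmod (?Df x))\<^sup>2 \<le> ((B * ?L) * indicator ?Z x)\<^sup>2"
      by (intro power_mono norm_mixed_deriv_op_layer_le \<psi> B Q bs) simp
    then show "ennreal ((cmod (?Df x))\<^sup>2) \<le> ennreal ((B * ?L)\<^sup>2) * indicator ?Z x"
      by (cases "x \<in> ?Z") (simp_all add: ennreal_leI)
  qed
  also have "\<dots> = ennreal ((B * ?L)\<^sup>2) * emeasure lborel ?Z"
    using finite by (intro nn_integral_cmult_indicator) (auto simp: grid_cube_eq_cbox)
  also have "\<dots> \<le> ennreal ((B * ?L)\<^sup>2) * ennreal (real (card (Q k)) * (2 / 2 ^ k) ^ DIM('a))"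
    by (intro mult_left_mono emeasure_UN_grid_cube_le finite) auto
  also have "\<dots> = ennreal ((B * ?L * sqrt (real (card (Q k)) * (2 / 2 ^ k) ^ DIM('a)))\<^sup>2)"
    by (simp add: ennreal_mult'[symmetric] power_mult_distrib)
  finally show ?thesis .
qed

lemma layer_weight_le:
  fixes t w p :: real and c n k d :: nat
  assumes c: "c \<le> n * 7 ^ d" and "0 \<le> t" "0 \<le> w" and t: "t * 2 powr (real d * k / p) \<le> w"
  shows "(2 powr (real d * (1 / 2 - 1 / p) * k) * w + t * sqrt ((pi * 2 ^ k) ^ d)) * sqrt (c * (2 / 2 ^ k) ^ d)
     \<le> (1 + sqrt (pi ^ d)) * sqrt (14 ^ d) * (w * sqrt (n * 2 powr (- (2 * real d / p) * k)))"
proof -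
  define E where "E = 2 powr (real d * (1 / 2 - 1 / p) * k)"
  define a where "a = sqrt (n * 2 powr (- (2 * real d / p) * k))"
  have dyadic: "(2 ^ k) ^ d = 2 powr (real d * k)"
    by (simp add: powr_realpow[symmetric] powr_powr mult.commute powr_power)
  have E: "0 < E" "2 powr (real d * k / 2) = 2 powr (real d * k / p) * E"
    unfolding E_def powr_add[symmetric] by (simp_all add: algebra_simps)
  have "t * sqrt ((pi * 2 ^ k) ^ d) = sqrt (pi ^ d) * (t * 2 powr (real d * k / p)) * E"
    using E(2) by (simp add: power_mult_distrib real_sqrt_mult dyadic powr_half_sqrt[symmetric] powr_powr)
  also have "\<dots> \<le> sqrt (pi ^ d) * w * E" using t E(1) by (intro mult_right_mono mult_left_mono) auto
  finally have first: "E * w + t * sqrt ((pi * 2 ^ k) ^ d) \<le> (1 + sqrt (pi ^ d)) * w * E"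
    by (simp add: algebra_simps)
  have "2 powr (- (2 * real d / p) * k) = 2 powr - (real d * k) * E\<^sup>2"
    unfolding E_def power2_eq_square powr_add[symmetric] by (simp add: algebra_simps)
  then have second: "E * sqrt (14 ^ d * (n * 2 powr - (real d * k))) = sqrt (14 ^ d) * a"
    using E(1) by (simp add: a_def real_sqrt_mult)
  have cube: "(2 / 2 ^ k) ^ d = 2 ^ d * 2 powr - (real d * k)"
    unfolding power_divide dyadic powr_minus by (rule divide_inverse)
  have "real c * (2 / 2 ^ k) ^ d \<le> (real n * 7 ^ d) * (2 ^ d * 2 powr - (real d * k))"
    unfolding cube
  proof (rule mult_mono)
    show "real c \<le> real n * 7 ^ d" using of_nat_mono[OF c, where 'a=real] by simp
  qed auto
  also have "\<dots> = 14 ^ d * (n * 2 powr - (real d * k))"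
    using power_mult_distrib[of 7 "2::real" d] by simp
  finally have "sqrt (c * (2 / 2 ^ k) ^ d) \<le> sqrt (14 ^ d * (n * 2 powr - (real d * k)))" by simp
  then have "(E * w + t * sqrt ((pi * 2 ^ k) ^ d)) * sqrt (c * (2 / 2 ^ k) ^ d)
      \<le> ((1 + sqrt (pi ^ d)) * w * E) * sqrt (14 ^ d * (n * 2 powr - (real d * k)))"
    using assms E(1) by (intro mult_mono first) auto
  also have "\<dots> = (1 + sqrt (pi ^ d)) * w * (E * sqrt (14 ^ d * (n * 2 powr - (real d * k))))"
    by (rule mult.assoc)
  also have "\<dots> = (1 + sqrt (pi ^ d)) * sqrt (14 ^ d) * (w * a)" unfolding second by (simp only: mult_ac)
  finally show ?thesis unfolding E_def a_def .
qed

definition pairing_const :: "nat \<Rightarrow> real" where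
  "pairing_const d = sqrt ((2 * pi) ^ d) * (1 + sqrt (pi ^ d)) * layer_bound d * sqrt (14 ^ d)"

lemma pairing_const_nonneg: "0 \<le> pairing_const d"
  by (simp add: pairing_const_def layer_bound_nonneg)

lemma norm_pairing_layer_le:
  fixes g \<psi> :: "'a::euclidean_space \<Rightarrow> complex" and w t p :: real
  assumes g: "g \<in> borel_measurable borel" and \<psi>: "test_fun \<psi>"
    "\<And>x. mixed_deriv_norm 1 bs \<psi> x \<le> B" and B: "0 \<le> B"
    and bs: "set bs = Basis" "distinct bs"
    and Q: "\<And>l. grid_indices (Q l)" "card (Q k) \<le> n * 7 ^ DIM('a)"
    and t: "0 \<le> t" "t * 2 powr (real DIM('a) * k / p) \<le> w" and w: "0 \<le> w"
    and tail: "tail_energy lborel g t \<le> ennreal ((2 powr (real DIM('a) * (1 / 2 - 1 / p) * k) * w)\<^sup>2)"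
  shows "cmod (\<integral>\<xi>. g \<xi> * inv_fourier (\<lambda>x. \<psi> x * cutoff_layer Q k x) \<xi> \<partial>lborel)
    \<le> pairing_const DIM('a) * B * (w * sqrt (n * 2 powr (- (2 * real DIM('a) / p) * k)))"
proof -
  let ?f = "\<lambda>x. \<psi> x * cutoff_layer Q k x"
  let ?d = "DIM('a)" and ?c = "sqrt ((2 * pi) ^ DIM('a))"
  let ?G = "2 powr (real DIM('a) * (1 / 2 - 1 / p) * k) * w" and ?v = "sqrt (card (Q k) * (2 / 2 ^ k) ^ DIM('a))"
  have "ennreal (cmod (\<integral>\<xi>. g \<xi> * inv_fourier ?f \<xi> \<partial>lborel))
      \<le> (\<integral>\<^sup>+\<xi>. ennreal (cmod (g \<xi>) * cmod (inv_fourier ?f \<xi>)) \<partial>lborel)"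
    unfolding norm_mult[symmetric] by (rule norm_integral_le_nn_integral)
  also have "\<dots> \<le> ennreal (?c * (?G + t * sqrt ((pi / (1 / 2 ^ k)) ^ ?d)) * (B * layer_bound ?d * ?v))"
    using w B bs
    by (intro inv_fourier_pairing_le[OF g _ _ t(1) _ tail] nn_integral_mixed_deriv_op_layer_le \<psi> Q
          test_fun_mult smooth_cutoff_layer) (auto simp: layer_bound_nonneg \<psi>(2))
  finally have "cmod (\<integral>\<xi>. g \<xi> * inv_fourier ?f \<xi> \<partial>lborel)
      \<le> ?c * (?G + t * sqrt ((pi / (1 / 2 ^ k)) ^ ?d)) * (B * layer_bound ?d * ?v)"
    using w B t(1) by (simp add: layer_bound_nonneg)
  also have "\<dots> = (?c * layer_bound ?d * B) * ((?G + t * sqrt ((pi * 2 ^ k) ^ ?d)) * ?v)" by simp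
  also have "\<dots> \<le> (?c * layer_bound ?d * B) *
      ((1 + sqrt (pi ^ ?d)) * sqrt (14 ^ ?d) * (w * sqrt (n * 2 powr (- (2 * real ?d / p) * k))))"
    using B by (intro mult_left_mono layer_weight_le Q(2) t w) (auto simp: layer_bound_nonneg)
  finally show ?thesis by (simp only: pairing_const_def mult_ac)
qed

lemma norm_pairing_le_scale_cost:
  fixes g \<psi> :: "'a::euclidean_space \<Rightarrow> complex" and lam w :: "nat \<Rightarrow> real" and P :: "'i set"
  assumes g: "g \<in> borel_measurable borel" and \<psi>: "test_fun \<psi>"
    "\<And>x. mixed_deriv_norm 1 bs \<psi> x \<le> B" and B: "0 \<le> B"
    and bs: "set bs = Basis" "distinct bs"
    and lam: "\<And>k. 0 \<le> lam k" "\<And>k. lam k * 2 powr (real DIM('a) * k / p) \<le> w k" and w: "\<And>k. 0 \<le> w k"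
    and tail: "\<And>k. tail_energy lborel g (lam k)
        \<le> ennreal ((2 powr (real DIM('a) * (1 / 2 - 1 / p) * k) * w k)\<^sup>2)"
    and supp: "\<And>\<phi>. test_fun_off S \<phi> \<Longrightarrow> (\<integral>\<xi>. g \<xi> * inv_fourier \<phi> \<xi> \<partial>lborel) = 0"
    and P: "finite P" "S \<subseteq> (\<Union>p\<in>P. ball (y p) (2 / 2 ^ \<kappa> p))"
  shows "cmod (\<integral>\<xi>. g \<xi> * inv_fourier \<psi> \<xi> \<partial>lborel)
    \<le> pairing_const DIM('a) * B * scale_cost (2 * real DIM('a) / p) w \<kappa> P"
proof -
  let ?Q = "cover_cubes P y \<kappa>"
  obtain N where N: "\<kappa> ` P \<subseteq> {..<N}" using finite_nat_bounded P(1) by blast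
  have "cmod (\<integral>\<xi>. g \<xi> * inv_fourier \<psi> \<xi> \<partial>lborel)
      \<le> (\<Sum>k<N. cmod (\<integral>\<xi>. g \<xi> * inv_fourier (\<lambda>x. \<psi> x * cutoff_layer ?Q k x) \<xi> \<partial>lborel))"
  proof (rule norm_pairing_le_sum_layers[OF g lam(1)])
    show "tail_energy lborel g (lam 0) < \<infinity>" using tail[of 0] by (rule le_less_trans) simp
    show "(\<integral>\<xi>. g \<xi> * inv_fourier (\<lambda>x. \<psi> x * cutoff_remainder ?Q N x) \<xi> \<partial>lborel) = 0"
      by (intro supp test_fun_off_cutoff_remainder \<psi> P N)
  qed (rule \<psi>)
  also have "\<dots> \<le> (\<Sum>k<N. pairing_const DIM('a) * B *
      (w k * sqrt (card {p\<in>P. \<kappa> p = k} * 2 powr (- (2 * real DIM('a) / p) * k))))"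
  proof (rule sum_mono)
    fix k
    show "cmod (\<integral>\<xi>. g \<xi> * inv_fourier (\<lambda>x. \<psi> x * cutoff_layer ?Q k x) \<xi> \<partial>lborel)
        \<le> pairing_const DIM('a) * B *
        (w k * sqrt (card {p\<in>P. \<kappa> p = k} * 2 powr (- (2 * real DIM('a) / p) * k)))"
      by (rule norm_pairing_layer_le[OF g \<psi> B bs grid_indices_cover_cubes[OF P(1)]
            card_cover_cubes_le[OF P(1)] lam w tail])
  qed
  also have "\<dots> = pairing_const DIM('a) * B * scale_cost (2 * real DIM('a) / p) w \<kappa> P"
    unfolding sum_distrib_left[symmetric] by (simp add: scale_cost_eq_sum[OF _ N])
  finally show ?thesis .
qed

section \<open>Vanishing of distributions supported on sets of finite capacity\<close>

lemma pairing_vanishes: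
  fixes S :: "'a::euclidean_space set" and g \<psi> :: "'a \<Rightarrow> complex" and p q :: real
  assumes p: "2 < p" and q: "1 \<le> q"
    and S: "compact S" "sigma_finite_NH (2 * real DIM('a) / p) (dual_exp q / 2) S"
    and lorentz: "in_lorentz p q lborel g"
    and supp: "\<And>\<phi>. test_fun_off S \<phi> \<Longrightarrow> (\<integral>\<xi>. g \<xi> * inv_fourier \<phi> \<xi> \<partial>lborel) = 0"
    and \<psi>: "test_fun \<psi>"
  shows "(\<integral>\<xi>. g \<xi> * inv_fourier \<psi> \<xi> \<partial>lborel) = 0"
proof -
  interpret lorentz: lorentz_function lborel g p q using p q lorentz by unfold_locales auto
  have g: "g \<in> borel_measurable borel" using lorentz.measurable_g by simp
  have dim: "0 < real DIM('a)" by simp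
  obtain lam w :: "nat \<Rightarrow> real" where lam: "\<And>k. 0 \<le> lam k"
    and w: "\<And>k. 0 \<le> w k" "summable (\<lambda>k. w k powr q)"
    and tail: "\<And>k. tail_energy lborel g (lam k)
        \<le> ennreal ((2 powr (real DIM('a) * (1 / 2 - 1 / p) * k) * w k)\<^sup>2)"
    and lam_le: "\<And>k. lam k * 2 powr (real DIM('a) * k / p) \<le> w k"
    by (rule lorentz.dyadic_truncation[OF dim p], rule that)
  obtain bs :: "'a list" where bs: "set bs = Basis" "distinct bs"
    using finite_distinct_list[of Basis] by auto
  obtain B where B: "0 \<le> B" "\<And>x. mixed_deriv_norm 1 bs \<psi> x \<le> B"
    using mixed_deriv_norm_test_fun_bounded[OF \<psi>] by blast
  define C where "C = pairing_const DIM('a) * B + 1"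
  have C: "0 < C" using B pairing_const_nonneg[of "DIM('a)"] by (simp add: C_def add_nonneg_pos)
  have "cmod (\<integral>\<xi>. g \<xi> * inv_fourier \<psi> \<xi> \<partial>lborel) \<le> 0 + e" if e: "0 < e" for e
  proof -
    have "0 < 2 * real DIM('a) / p" "0 < e / C" using p e C by auto
    from sigma_finite_weighted_cover[OF this(1) q S w this(2)]
    obtain P :: "(nat \<times> nat) set" and y :: "nat \<times> nat \<Rightarrow> 'a" and \<kappa> :: "nat \<times> nat \<Rightarrow> nat"
      where P: "finite P" "S \<subseteq> (\<Union>p\<in>P. ball (y p) (2 / 2 ^ \<kappa> p))" "scale_cost (2 * real DIM('a) / p) w \<kappa> P \<le> e / C" .
    have "cmod (\<integral>\<xi>. g \<xi> * inv_fourier \<psi> \<xi> \<partial>lborel)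
        \<le> pairing_const DIM('a) * B * scale_cost (2 * real DIM('a) / p) w \<kappa> P"
      by (rule norm_pairing_le_scale_cost[OF g \<psi> B(2,1) bs lam lam_le w(1) tail supp P(1,2)])
    also have "\<dots> \<le> C * (e / C)"
      using P(3) C B e pairing_const_nonneg[of "DIM('a)"] w(1)
      by (intro mult_mono) (auto simp: C_def scale_cost_def intro!: sum_nonneg mult_nonneg_nonneg)
    finally show ?thesis using C by simp
  qed
  then have "cmod (\<integral>\<xi>. g \<xi> * inv_fourier \<psi> \<xi> \<partial>lborel) \<le> 0" by (rule field_le_epsilon)
  then show ?thesis by simp
qed

lemma lorentz_uniformly_locally_integrable:
  fixes g :: "'a::euclidean_space \<Rightarrow> complex"
  assumes "2 < p" "1 \<le> q" "in_lorentz p q lborel g"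
  shows "uniformly_locally_integrable g"
proof -
  interpret lorentz_function lborel g p q using assms by unfold_locales auto
  obtain lam w :: "nat \<Rightarrow> real" where "\<And>k. 0 \<le> lam k"
    and tail: "\<And>k. tail_energy lborel g (lam k) \<le> ennreal ((2 powr (1 * (1 / 2 - 1 / p) * k) * w k)\<^sup>2)"
    by (rule dyadic_truncation[OF zero_less_one assms(1)], rule that)
  then show ?thesis
    using measurable_g le_less_trans[OF tail[of 0]]
    by (intro uniformly_locally_integrable_tail_energy[of g "lam 0"]) auto
qed

lemma lebesgue_ex_borel_complex:
  fixes g :: "'a::euclidean_space \<Rightarrow> complex"
  assumes [measurable]: "g \<in> borel_measurable lebesgue"
  obtains h where "h \<in> borel_measurable borel" "AE x in lborel. g x = h x"
proof -
  obtain u where u: "u \<in> borel_measurable lborel" "AE x in lborel. Re (g x) = u x"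
    using completion_ex_borel_measurable_real[of "\<lambda>x. Re (g x)" lborel] by auto
  obtain v where v: "v \<in> borel_measurable lborel" "AE x in lborel. Im (g x) = v x"
    using completion_ex_borel_measurable_real[of "\<lambda>x. Im (g x)" lborel] by auto
  show ?thesis
  proof
    show "(\<lambda>x. of_real (u x) + \<i> * of_real (v x)) \<in> borel_measurable borel" using u v by simp
    show "AE x in lborel. g x = of_real (u x) + \<i> * of_real (v x)"
      using u(2) v(2) by eventually_elim (simp add: complex_eq_iff)
  qed
qed

lemma in_lorentz_borel:
  fixes g h :: "'a::euclidean_space \<Rightarrow> complex"
  assumes g: "in_lorentz p q lebesgue g" and h [measurable]: "h \<in> borel_measurable borel"
    and eq: "AE x in lborel. g x = h x"
  shows "in_lorentz p q lborel h"
proof -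
  have [measurable]: "g \<in> borel_measurable lebesgue" using g by (simp add: in_lorentz_def)
  have [measurable]: "h \<in> borel_measurable lebesgue" by (intro measurable_completion) simp
  have "distrib_fun lebesgue g t = distrib_fun lborel h t" for t
  proof -
    have "distrib_fun lebesgue g t = distrib_fun lebesgue h t"
      unfolding distrib_fun_def
    proof (rule emeasure_eq_AE)
      show "AE x in lebesgue. x \<in> {x \<in> space lebesgue. t \<le> cmod (g x)} \<longleftrightarrow> x \<in> {x \<in> space lebesgue. t \<le> cmod (h x)}"
        using AE_completion[OF eq] by eventually_elim simp
    qed measurable
    also have "\<dots> = distrib_fun lborel h t"
      unfolding distrib_fun_def by (subst emeasure_completion) simp_all
    finally show ?thesis .
  qed
  then show ?thesis using g by (simp add: in_lorentz_def lorentz_qnorm_pow_def)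
qed

lemma ft_distrib_supported_in_borel:
  fixes g h :: "'a::euclidean_space \<Rightarrow> complex"
  assumes supp: "ft_distrib_supported_in g S" and \<phi>: "test_fun_off S \<phi>"
    and [measurable]: "g \<in> borel_measurable lebesgue" "h \<in> borel_measurable borel"
    and eq: "AE x in lborel. g x = h x"
  shows "(\<integral>\<xi>. h \<xi> * inv_fourier \<phi> \<xi> \<partial>lborel) = 0"
proof -
  have [measurable]: "inv_fourier \<phi> \<in> borel_measurable borel"
    using \<phi> by (intro borel_measurable_inv_fourier smooth_fun_borel) (simp add: test_fun_off_def)
  have [measurable]: "inv_fourier \<phi> \<in> borel_measurable lebesgue" "h \<in> borel_measurable lebesgue"
    by (intro measurable_completion; simp)+
  have "(\<integral>\<xi>. h \<xi> * inv_fourier \<phi> \<xi> \<partial>lborel) = (\<integral>\<xi>. h \<xi> * inv_fourier \<phi> \<xi> \<partial>lebesgue)"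
    by (rule integral_completion[symmetric]) measurable
  also have "\<dots> = (\<integral>\<xi>. g \<xi> * inv_fourier \<phi> \<xi> \<partial>lebesgue)"
    using AE_completion[OF eq] by (intro integral_cong_AE) (measurable, auto elim!: AE_mp)
  also have "\<dots> = 0" using supp \<phi> by (simp add: ft_distrib_supported_in_def)
  finally show ?thesis .
qed

theorem theorem1p7:
  fixes S :: "'a::euclidean_space set" and g :: "'a \<Rightarrow> complex" and p q :: real
  assumes "2 < p" and "1 \<le> q"
    and "compact S"
    and "sigma_finite_NH (2 * real DIM('a) / p) (dual_exp q / 2) S"
    and "in_lorentz p q lebesgue g"
    and "ft_distrib_supported_in g S"
  shows "AE \<xi> in lebesgue. g \<xi> = 0"
proof -
  have g: "g \<in> borel_measurable lebesgue" using assms(5) by (simp add: in_lorentz_def)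
  then obtain h where h: "h \<in> borel_measurable borel" and eq: "AE x in lborel. g x = h x"
    by (rule lebesgue_ex_borel_complex)
  have lorentz: "in_lorentz p q lborel h" by (rule in_lorentz_borel[OF assms(5) h eq])
  have "(\<integral>\<xi>. h \<xi> * inv_fourier \<phi> \<xi> \<partial>lborel) = 0" if "test_fun_off S \<phi>" for \<phi>
    by (rule ft_distrib_supported_in_borel[OF assms(6) that g h eq])
  then have "(\<integral>\<xi>. h \<xi> * inv_fourier \<psi> \<xi> \<partial>lborel) = 0" if "test_fun \<psi>" for \<psi>
    using that by (rule pairing_vanishes[OF assms(1-4) lorentz])
  then have "AE \<xi> in lborel. h \<xi> = 0"
    by (intro AE_zero_of_inv_fourier_pairings lorentz_uniformly_locally_integrable[OF assms(1,2) lorentz])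
  with eq have "AE \<xi> in lborel. g \<xi> = 0" by eventually_elim simp
  then show ?thesis by (rule AE_completion)
qed

end
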